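(* Let $X$ be a symmetric Lévy process on $\mathbf{R}^d$ with characteristic exponent $\Psi$ and $L^2$-generator $\mathscr{L}$, and let $W=\{W(t,\phi);\,t\ge0,\phi\in\mathscr{S}(\mathbf{R}^d)\}$ denote the weak solution to the stochastic wave equation $\partial_{tt}W=\mathscr{L}W+\dot w$, $W(0,\cdot)=\partial_tW(0,\cdot)=0$. Then $$\tfrac14\,t\,\mathscr{E}(t^2;\phi)\le\mathrm{E}\big(|W(t,\phi)|^2\big)\le2t\,\mathscr{E}(t^2;\phi)$$ for all $t\ge0$ and $\phi\in\mathscr{S}(\mathbf{R}^d)$. Moreover, $W$ can be extended by density so that the preceding display remains valid for all $t\ge0$ and $\phi\in L^2_{\mathscr{L}}(\mathbf{R}^d)$.
   Context: Lévy process: $X_0=0$, $\mathrm{E}\,e^{i\xi\cdot X_t}=e^{-t\Psi(\xi)}$; symmetric means $X_t$ and $-X_t$ have the same law for all $t$, equivalently $\Psi$ is real and nonnegative. Fourier transform: $\hat f(\xi)=\int_{\mathbf{R}^d}e^{i\xi\cdot x}f(x)\,dx$. $\mathscr{S}(\mathbf{R}^d)$ is the space of rapidly decreasing test functions. $\dot w$ is space-time white noise on $\mathbf{R}_+\times\mathbf{R}^d$ with Wiener integral $w(h)$, $h\in L^2(\mathbf{R}_+\times\mathbf{R}^d)$; $\hat w(h):=(2\pi)^{-d/2}w(\hat h)$, where $\hat h$ is the Fourier transform in the spatial variable; then $\mathrm{E}|\hat w(h)|^2=\|h\|^2_{L^2(\mathbf{R}_+\times\mathbf{R}^d)}$. The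 weak solution is $W(t,\phi):=(2\pi)^{-d/2}\int_{\mathbf{R}^d}\int_0^t\frac{\sin(\sqrt{\Psi(\xi)}(t-s))}{\sqrt{\Psi(\xi)}}\,\overline{\hat\phi(\xi)}\,\hat w(ds\,d\xi)$ (the quotient is read as $t-s$ where $\Psi(\xi)=0$). For $\lambda>0$, $\mathscr{E}(\lambda;\phi):=\frac1{(2\pi)^d}\int_{\mathbf{R}^d}\frac{|\hat\phi(\xi)|^2}{(1/\lambda)+\mathrm{Re}\,\Psi(\xi)}\,d\xi$, with the convention $\mathscr{E}(0;\phi)=0$. $L^2_{\mathscr{L}}(\mathbf{R}^d)$ is the completion of $\mathscr{S}(\mathbf{R}^d)$ in the norm $\mathscr{E}(\lambda;\bullet)^{1/2}$ (it does not depend on $\lambda>0$). *)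

theory Defs
  imports "HOL-Probability.Probability"
begin

text \<open>
  The space \<open>R^d\<close> is a type \<^typ>\<open>'a::euclidean_space\<close>, with \<open>d = DIM('a)\<close>. Second moments and
  energies are nonnegative integrals with values in \<^typ>\<open>ennreal\<close>, so that no integrability
  assumption is hidden in them.
\<close>

section \<open>Symmetric Levy processes\<close>

definition levy_process :: "'o measure \<Rightarrow> (real \<Rightarrow> 'o \<Rightarrow> 'a::euclidean_space) \<Rightarrow> bool" where
  "levy_process M X \<longleftrightarrow>
     prob_space M \<and>
     (\<forall>t\<ge>0. X t \<in> borel_measurable M) \<and>
     (AE \<omega> in M. X 0 \<omega> = 0) \<and>
     (\<forall>(\<tau> :: nat \<Rightarrow> real) n. 0 \<le> \<tau> 0 \<and> mono \<tau> \<longrightarrow>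
        prob_space.indep_vars M (\<lambda>_. borel) (\<lambda>i \<omega>. X (\<tau> (Suc i)) \<omega> - X (\<tau> i) \<omega>) {..<n}) \<and>
     (\<forall>s\<ge>0. \<forall>h\<ge>0. distr M borel (\<lambda>\<omega>. X (s + h) \<omega> - X s \<omega>) = distr M borel (X h)) \<and>
     (AE \<omega> in M. (\<forall>t\<ge>0. continuous (at_right t) (\<lambda>s. X s \<omega>)) \<and>
                 (\<forall>t>0. \<exists>l. ((\<lambda>s. X s \<omega>) \<longlongrightarrow> l) (at_left t)))"

definition symmetric_process :: "'o measure \<Rightarrow> (real \<Rightarrow> 'o \<Rightarrow> 'a::euclidean_space) \<Rightarrow> bool" where
  "symmetric_process M X \<longleftrightarrow>
     (\<forall>t\<ge>0. distr M borel (X t) = distr M borel (\<lambda>\<omega>. - X t \<omega>))"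

text \<open>Requiring the identity for all \<open>t \<ge> 0\<close> determines \<open>\<Psi>\<close> (no branch of the logarithm is left open).\<close>

definition characteristic_exponent ::
  "'o measure \<Rightarrow> (real \<Rightarrow> 'o \<Rightarrow> 'a::euclidean_space) \<Rightarrow> ('a \<Rightarrow> complex) \<Rightarrow> bool" where
  "characteristic_exponent M X \<Psi> \<longleftrightarrow>
     (\<forall>t\<ge>0. \<forall>\<xi>. (LINT \<omega>|M. exp (\<i> * complex_of_real (\<xi> \<bullet> X t \<omega>)))
                 = exp (- (complex_of_real t * \<Psi> \<xi>)))"

section \<open>Test functions and the Fourier transform\<close>

fun iterated_partial :: "'a list \<Rightarrow> ('a::euclidean_space \<Rightarrow> complex) \<Rightarrow> 'a \<Rightarrow> complex" where
  "iterated_partial [] f = f"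
| "iterated_partial (b # bs) f = (\<lambda>x. frechet_derivative (iterated_partial bs f) (at x) b)"

text \<open>Differentiability of all iterated partial derivatives is equivalent to being \<open>C\<^sup>\<infinity>\<close>.\<close>

definition schwartz :: "('a::euclidean_space \<Rightarrow> complex) set" where
  "schwartz = {f. \<forall>bs\<in>lists Basis.
      (\<forall>x. iterated_partial bs f differentiable (at x)) \<and>
      (\<forall>k::nat. bounded (range (\<lambda>x. norm x ^ k * cmod (iterated_partial bs f x))))}"

definition fourier :: "('a::euclidean_space \<Rightarrow> complex) \<Rightarrow> 'a \<Rightarrow> complex" where
  "fourier f \<xi> = (LINT x|lborel. exp (\<i> * complex_of_real (\<xi> \<bullet> x)) * f x)"

section \<open>Space-time white noise\<close>

definition st_measure :: "(real \<times> 'a::euclidean_space) measure" where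
  "st_measure = restrict_space lborel {0..} \<Otimes>\<^sub>M lborel"

text \<open>Square integrable functions are not identified when they agree almost everywhere.\<close>

definition L2_fun :: "'b measure \<Rightarrow> ('b \<Rightarrow> 'c::euclidean_space) set" where
  "L2_fun M = {f \<in> borel_measurable M. integrable M (\<lambda>x. (norm (f x))\<^sup>2)}"

definition L2_tendsto :: "'b measure \<Rightarrow> (nat \<Rightarrow> 'b \<Rightarrow> 'c::euclidean_space) \<Rightarrow> ('b \<Rightarrow> 'c) \<Rightarrow> bool" where
  "L2_tendsto M f g \<longleftrightarrow> (\<lambda>n. \<integral>\<^sup>+x. ennreal ((norm (f n x - g x))\<^sup>2) \<partial>M) \<longlonglongrightarrow> 0"

text \<open>
  The Wiener integral \<open>h \<mapsto> w(h)\<close>: a centred Gaussian family (every finite linear combination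
  has the law of \<open>\<sigma>Z\<close> with \<open>Z\<close> standard normal, \<open>\<sigma> = 0\<close> being allowed) whose covariance is the
  inner product of \<open>L\<^sup>2(R\<^sub>+ \<times> R^d)\<close>. Linearity of \<open>w\<close>, and equality of \<open>w(h)\<close> and \<open>w(g)\<close> when
  \<open>h = g\<close> almost everywhere, hold almost surely as consequences.
\<close>

definition white_noise :: "'p measure \<Rightarrow> ((real \<times> 'a::euclidean_space \<Rightarrow> real) \<Rightarrow> 'p \<Rightarrow> real) \<Rightarrow> bool" where
  "white_noise P w \<longleftrightarrow>
     prob_space P \<and>
     (\<forall>h \<in> L2_fun st_measure. w h \<in> borel_measurable P) \<and>
     (\<forall>H c. finite H \<and> H \<subseteq> L2_fun st_measure \<longrightarrow>
        (\<exists>\<sigma>\<ge>0. distr P borel (\<lambda>\<omega>. \<Sum>h\<in>H. c h * w h \<omega>)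
               = distr std_normal_distribution borel (\<lambda>x. \<sigma> * x))) \<and>
     (\<forall>h \<in> L2_fun st_measure. \<forall>g \<in> L2_fun st_measure.
        (LINT \<omega>|P. w h \<omega> * w g \<omega>) = (LINT z|st_measure. h z * g z))"

definition wiener_complex ::
  "((real \<times> 'a::euclidean_space \<Rightarrow> real) \<Rightarrow> 'p \<Rightarrow> real) \<Rightarrow> (real \<times> 'a \<Rightarrow> complex) \<Rightarrow> 'p \<Rightarrow> complex" where
  "wiener_complex w h \<omega> = Complex (w (\<lambda>z. Re (h z)) \<omega>) (w (\<lambda>z. Im (h z)) \<omega>)"

definition spatial_fourier :: "(real \<times> 'a::euclidean_space \<Rightarrow> complex) \<Rightarrow> real \<times> 'a \<Rightarrow> complex" where
  "spatial_fourier h = (\<lambda>(s, \<xi>). fourier (\<lambda>x. h (s, x)) \<xi>)"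

text \<open>
  The spatial Fourier transform on all of \<open>L\<^sup>2(R\<^sub>+ \<times> R^d)\<close> is the \<open>L\<^sup>2\<close>-continuous extension of the
  transform given by the integral on \<open>L\<^sup>1 \<inter> L\<^sup>2\<close>; by Plancherel's theorem it exists and is unique
  up to almost everywhere equality.
\<close>

definition is_L2_spatial_fourier ::
  "(real \<times> 'a::euclidean_space \<Rightarrow> complex) \<Rightarrow> (real \<times> 'a \<Rightarrow> complex) \<Rightarrow> bool" where
  "is_L2_spatial_fourier h g \<longleftrightarrow>
     g \<in> L2_fun st_measure \<and>
     (\<exists>k. (\<forall>n. k n \<in> L2_fun st_measure \<and> integrable st_measure (k n)) \<and>
          L2_tendsto st_measure k h \<and>
          L2_tendsto st_measure (\<lambda>n. spatial_fourier (k n)) g)"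

definition L2_spatial_fourier :: "(real \<times> 'a::euclidean_space \<Rightarrow> complex) \<Rightarrow> real \<times> 'a \<Rightarrow> complex" where
  "L2_spatial_fourier h = (SOME g. is_L2_spatial_fourier h g)"

definition noise_hat ::
  "((real \<times> 'a::euclidean_space \<Rightarrow> real) \<Rightarrow> 'p \<Rightarrow> real) \<Rightarrow> (real \<times> 'a \<Rightarrow> complex) \<Rightarrow> 'p \<Rightarrow> complex" where
  "noise_hat w h \<omega> =
     complex_of_real ((2 * pi) powr (- real DIM('a) / 2)) * wiener_complex w (L2_spatial_fourier h) \<omega>"

section \<open>The weak solution of the stochastic wave equation\<close>

text \<open>
  The generator of the process acts as the Fourier multiplier \<open>-\<Psi>\<close>, so the equation enters only
  through the fundamental solution \<open>sin(\<surd>\<Psi>(\<xi>) r) / \<surd>\<Psi>(\<xi>)\<close> of \<open>u'' = -\<Psi>(\<xi>) u\<close>.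
\<close>

definition wave_multiplier :: "complex \<Rightarrow> real \<Rightarrow> complex" where
  "wave_multiplier z r =
     (if z = 0 then complex_of_real r else sin (csqrt z * complex_of_real r) / csqrt z)"

definition weak_solution ::
  "('a::euclidean_space \<Rightarrow> complex) \<Rightarrow> ((real \<times> 'a \<Rightarrow> real) \<Rightarrow> 'p \<Rightarrow> real) \<Rightarrow>
   real \<Rightarrow> ('a \<Rightarrow> complex) \<Rightarrow> 'p \<Rightarrow> complex" where
  "weak_solution \<Psi> w t \<phi> \<omega> =
     complex_of_real ((2 * pi) powr (- real DIM('a) / 2)) *
     noise_hat w (\<lambda>(s, \<xi>). indicator {0..t} s * wave_multiplier (\<Psi> \<xi>) (t - s) * cnj (fourier \<phi> \<xi>)) \<omega>"

section \<open>The energy and the completion of the test functions\<close>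

definition energy :: "('a::euclidean_space \<Rightarrow> complex) \<Rightarrow> real \<Rightarrow> ('a \<Rightarrow> complex) \<Rightarrow> ennreal" where
  "energy \<Psi> \<kappa> \<phi> =
     (if \<kappa> = 0 then 0
      else ennreal (1 / (2 * pi) ^ DIM('a)) *
           (\<integral>\<^sup>+\<xi>. ennreal ((cmod (fourier \<phi> \<xi>))\<^sup>2 / (1 / \<kappa> + Re (\<Psi> \<xi>))) \<partial>lborel))"

text \<open>
  The completion of the test functions in the norm \<open>energy \<Psi> \<kappa> \<phi>\<close> to the power \<open>1/2\<close>: Cauchy
  sequences of test functions modulo sequences of norm tending to zero. The test functions embed
  as classes of constant sequences, and the members of a class \<open>\<Phi>\<close> are exactly the sequences of
  test functions that converge to \<open>\<Phi>\<close> in the completion.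
\<close>

definition energy_Cauchy ::
  "('a::euclidean_space \<Rightarrow> complex) \<Rightarrow> real \<Rightarrow> (nat \<Rightarrow> 'a \<Rightarrow> complex) set" where
  "energy_Cauchy \<Psi> \<kappa> =
     {\<phi>. (\<forall>n. \<phi> n \<in> schwartz) \<and>
         (\<forall>e>0. \<exists>N. \<forall>m\<ge>N. \<forall>n\<ge>N. energy \<Psi> \<kappa> (\<lambda>x. \<phi> m x - \<phi> n x) < ennreal (e\<^sup>2))}"

definition energy_equiv ::
  "('a::euclidean_space \<Rightarrow> complex) \<Rightarrow> real \<Rightarrow> ((nat \<Rightarrow> 'a \<Rightarrow> complex) \<times> (nat \<Rightarrow> 'a \<Rightarrow> complex)) set" where
  "energy_equiv \<Psi> \<kappa> =
     {(\<phi>, \<psi>). \<phi> \<in> energy_Cauchy \<Psi> \<kappa> \<and> \<psi> \<in> energy_Cauchy \<Psi> \<kappa> \<and>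
              (\<lambda>n. energy \<Psi> \<kappa> (\<lambda>x. \<phi> n x - \<psi> n x)) \<longlonglongrightarrow> 0}"

definition L2_completion ::
  "('a::euclidean_space \<Rightarrow> complex) \<Rightarrow> real \<Rightarrow> (nat \<Rightarrow> 'a \<Rightarrow> complex) set set" where
  "L2_completion \<Psi> \<kappa> = energy_Cauchy \<Psi> \<kappa> // energy_equiv \<Psi> \<kappa>"

definition completion_of ::
  "('a::euclidean_space \<Rightarrow> complex) \<Rightarrow> real \<Rightarrow> ('a \<Rightarrow> complex) \<Rightarrow> (nat \<Rightarrow> 'a \<Rightarrow> complex) set" where
  "completion_of \<Psi> \<kappa> \<phi> = energy_equiv \<Psi> \<kappa> `` {\<lambda>_. \<phi>}"

text \<open>
  The continuous extension of \<open>energy \<Psi> \<mu>\<close> to the completion. The norms for different positive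
  parameters are equivalent, so \<open>\<mu>\<close> need not be the parameter used to form the completion.
\<close>

definition completion_energy ::
  "('a::euclidean_space \<Rightarrow> complex) \<Rightarrow> real \<Rightarrow> (nat \<Rightarrow> 'a \<Rightarrow> complex) set \<Rightarrow> ennreal" where
  "completion_energy \<Psi> \<mu> \<Phi> = (THE E. \<forall>\<phi>\<in>\<Phi>. (\<lambda>n. energy \<Psi> \<mu> (\<phi> n)) \<longlonglongrightarrow> E)"

definition second_moment :: "'p measure \<Rightarrow> ('p \<Rightarrow> complex) \<Rightarrow> ennreal" where
  "second_moment P Y = (\<integral>\<^sup>+\<omega>. ennreal ((cmod (Y \<omega>))\<^sup>2) \<partial>P)"

end

theory Submission
  imports Defs
begin

text \<open>
  The Fourier-transformed noise is an isometry: the Wiener integral is one by its covariance, and the factor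
  \<open>(2\<pi>)\<^sup>d\<close> in Plancherel's theorem, applied slice by slice in time, cancels the normalization. So
  \<open>E |W(t,\<phi>)|\<^sup>2\<close> is the integral of \<open>(2\<pi>)\<^sup>-\<^sup>d |\<phi>\<^sup>^(\<xi>)|\<^sup>2\<close> against
  \<open>\<integral>\<^sub>0\<^sup>t sin\<^sup>2(\<theta> r) / \<theta>\<^sup>2 dr = t / (2\<theta>\<^sup>2) - sin(2\<theta>t) / (4\<theta>\<^sup>3)\<close> with \<open>\<theta>\<^sup>2 = \<Psi>(\<xi>) \<ge> 0\<close>.
  The upper bound uses that the integrand is at most \<open>min (t\<^sup>2) (1/\<theta>\<^sup>2)\<close>; with \<open>y = 2\<theta>t\<close> the lower bound
  is exactly \<open>sin y \<le> y (8 + y\<^sup>2) / (8 + 2y\<^sup>2)\<close>. Applied to differences of test functions, the upper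
  bound makes \<open>\<phi> \<mapsto> W(t,\<phi>)\<close> Lipschitz for the energy norm, so that it extends to the completion.

  Plancherel's theorem on \<open>L\<^sup>1 \<inter> L\<^sup>2\<close> comes from Gaussian regularization: this gives the inequality
  \<open>\<le>\<close> for all functions and equality for bounded continuous ones, which are dense.
\<close>

section \<open>Convergence in mean square\<close>

text \<open>\<open>L2_spatial_fourier\<close> is an arbitrary choice and \<open>white_noise\<close>
  is linear only almost surely, so W(t,\<phi>) - W(t,\<eta>) is not literally the noise of a
  difference of integrands. Hence the isometries are proved for differences: the mean square
  distance of two images is a constant times that of the two integrands. This makes the choice
  harmless and gives the Lipschitz estimate without any linearity statement.

  Plancherel's inequality precedes the equality because it supplies both the integrable majorant in
  the limit c \<longlonglongrightarrow> 0 and the continuity behind the density argument.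

  Of the two powers of 2\<pi>, the one in \<open>noise_hat\<close> pays for Plancherel's theorem and
  the one in \<open>weak_solution\<close> becomes the factor in front of the energy.

  The completion is formed with a fixed \<kappa>, whereas the bounds at time t use the parameter
  t^2; energies with different positive parameters are comparable. Up to a factor, an energy is the
  squared L2 norm of a weighted Fourier transform, so one extension lemma serves both for
  W(t,\<phi>) and for the energy on the completion.\<close>

definition L2_sq :: "'b measure \<Rightarrow> ('b \<Rightarrow> 'c::euclidean_space) \<Rightarrow> ennreal" where
  "L2_sq M f = (\<integral>\<^sup>+x. ennreal ((norm (f x))\<^sup>2) \<partial>M)"

lemma L2_fun_iff: "f \<in> L2_fun M \<longleftrightarrow> f \<in> borel_measurable M \<and> L2_sq M f < \<infinity>"
  by (auto simp: L2_fun_def L2_sq_def integrable_iff_bounded)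

lemma L2_fun_measurable[measurable_dest]: "f \<in> L2_fun M \<Longrightarrow> f \<in> borel_measurable M"
  by (simp add: L2_fun_def)

lemma L2_sq_eq_integral:
  assumes "f \<in> L2_fun M"
  shows "L2_sq M f = ennreal (\<integral>x. (norm (f x))\<^sup>2 \<partial>M)"
  unfolding L2_sq_def using assms by (intro nn_integral_eq_integral) (auto simp: L2_fun_def)

lemma L2_tendsto_iff: "L2_tendsto M f g \<longleftrightarrow> (\<lambda>n. L2_sq M (\<lambda>x. f n x - g x)) \<longlonglongrightarrow> 0"
  by (simp add: L2_tendsto_def L2_sq_def)

lemma norm_add_sq_le:
  fixes a b :: "'a::real_normed_vector"
  shows "(norm (a + b))\<^sup>2 \<le> 2 * (norm a)\<^sup>2 + 2 * (norm b)\<^sup>2"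
proof -
  have "(norm (a + b))\<^sup>2 \<le> (norm a + norm b)\<^sup>2"
    by (intro power_mono norm_triangle_ineq) auto
  also have "\<dots> \<le> 2 * (norm a)\<^sup>2 + 2 * (norm b)\<^sup>2"
    using sum_squares_bound[of "norm a" "norm b"] by (simp add: power2_sum)
  finally show ?thesis .
qed

text \<open>The factor 2 stands in for the triangle inequality of the norm: no square roots of
  \<open>ennreal\<close> values appear, and the constants are immaterial because the estimate serves
  only finiteness, Cauchy and convergence arguments.\<close>

lemma L2_sq_add_le:
  assumes [measurable]: "f \<in> borel_measurable M" "g \<in> borel_measurable M"
  shows "L2_sq M (\<lambda>x. f x + g x) \<le> 2 * L2_sq M f + 2 * L2_sq M g"
proof -
  have "L2_sq M (\<lambda>x. f x + g x)
      \<le> (\<integral>\<^sup>+x. 2 * ennreal ((norm (f x))\<^sup>2) + 2 * ennreal ((norm (g x))\<^sup>2) \<partial>M)"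
    unfolding L2_sq_def
  proof (rule nn_integral_mono)
    fix x
    have "ennreal ((norm (f x + g x))\<^sup>2) \<le> ennreal (2 * (norm (f x))\<^sup>2 + 2 * (norm (g x))\<^sup>2)"
      by (intro ennreal_leI norm_add_sq_le)
    also have "\<dots> = 2 * ennreal ((norm (f x))\<^sup>2) + 2 * ennreal ((norm (g x))\<^sup>2)"
      by (simp add: ennreal_plus ennreal_mult)
    finally show "ennreal ((norm (f x + g x))\<^sup>2) \<le> 2 * ennreal ((norm (f x))\<^sup>2) + 2 * ennreal ((norm (g x))\<^sup>2)" .
  qed
  also have "\<dots> = 2 * L2_sq M f + 2 * L2_sq M g"
    by (simp add: nn_integral_add nn_integral_cmult L2_sq_def)
  finally show ?thesis .
qed

lemma L2_sq_minus: "L2_sq M (\<lambda>x. - f x) = L2_sq M f"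
  by (simp add: L2_sq_def)

lemma L2_sq_minus_commute: "L2_sq M (\<lambda>x. f x - g x) = L2_sq M (\<lambda>x. g x - f x)"
  by (simp add: L2_sq_def norm_minus_commute)

lemma L2_sq_cmult:
  fixes f :: "'b \<Rightarrow> complex"
  assumes [measurable]: "f \<in> borel_measurable M"
  shows "L2_sq M (\<lambda>x. c * f x) = ennreal ((cmod c)\<^sup>2) * L2_sq M f"
  unfolding L2_sq_def
  by (simp add: norm_mult power_mult_distrib ennreal_mult nn_integral_cmult)

lemma L2_sq_diff_triangle:
  assumes [measurable]: "f \<in> borel_measurable M" "g \<in> borel_measurable M" "h \<in> borel_measurable M"
  shows "L2_sq M (\<lambda>x. f x - h x) \<le> 2 * L2_sq M (\<lambda>x. f x - g x) + 2 * L2_sq M (\<lambda>x. g x - h x)"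
  using L2_sq_add_le[of "\<lambda>x. f x - g x" M "\<lambda>x. g x - h x"] by simp

lemma L2_fun_add:
  assumes "f \<in> L2_fun M" "g \<in> L2_fun M"
  shows "(\<lambda>x. f x + g x) \<in> L2_fun M"
proof -
  have [measurable]: "f \<in> borel_measurable M" "g \<in> borel_measurable M"
    using assms by (auto simp: L2_fun_def)
  have "2 * L2_sq M f + 2 * L2_sq M g < \<infinity>"
    using assms by (auto simp: L2_fun_iff ennreal_mult_less_top)
  then have "L2_sq M (\<lambda>x. f x + g x) < \<infinity>"
    using L2_sq_add_le[of f M g] by (simp add: order_le_less_trans)
  then show ?thesis by (simp add: L2_fun_iff)
qed

lemma L2_fun_minus: "f \<in> L2_fun M \<Longrightarrow> (\<lambda>x. - f x) \<in> L2_fun M"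
  by (simp add: L2_fun_def)

lemma L2_fun_diff:
  assumes "f \<in> L2_fun M" "g \<in> L2_fun M"
  shows "(\<lambda>x. f x - g x) \<in> L2_fun M"
  using L2_fun_add[OF assms(1) L2_fun_minus[OF assms(2)]] by simp

lemma L2_fun_cmult:
  fixes f :: "'b \<Rightarrow> complex"
  shows "f \<in> L2_fun M \<Longrightarrow> (\<lambda>x. c * f x) \<in> L2_fun M"
  by (auto simp: L2_fun_def norm_mult power_mult_distrib)

lemma L2_fun_bound:
  assumes "g \<in> L2_fun M" "f \<in> borel_measurable M" "\<And>x. norm (f x) \<le> norm (g x)"
  shows "f \<in> L2_fun M"
proof -
  have "L2_sq M f \<le> L2_sq M g"
    unfolding L2_sq_def by (intro nn_integral_mono ennreal_leI power_mono assms) auto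
  then show ?thesis using assms(1,2) by (auto simp: L2_fun_iff)
qed

lemma L2_sq_eq_0_iff:
  assumes [measurable]: "f \<in> borel_measurable M"
  shows "L2_sq M f = 0 \<longleftrightarrow> (AE x in M. f x = 0)"
  unfolding L2_sq_def by (subst nn_integral_0_iff_AE) auto

lemma L2_limits_AE_eq:
  assumes [measurable]: "\<And>n. f n \<in> borel_measurable M" "\<And>n. f' n \<in> borel_measurable M"
    "g \<in> borel_measurable M" "g' \<in> borel_measurable M"
    and "L2_tendsto M f g" "L2_tendsto M f' g'"
    and "(\<lambda>n. L2_sq M (\<lambda>x. f n x - f' n x)) \<longlonglongrightarrow> 0"
  shows "AE x in M. g x = g' x"
proof -
  have "L2_sq M (\<lambda>x. g x - g' x) \<le> 2 * L2_sq M (\<lambda>x. f n x - g x)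
      + (4 * L2_sq M (\<lambda>x. f n x - f' n x) + 4 * L2_sq M (\<lambda>x. f' n x - g' x))" for n
  proof -
    have "L2_sq M (\<lambda>x. g x - g' x) \<le> 2 * L2_sq M (\<lambda>x. g x - f n x) + 2 * L2_sq M (\<lambda>x. f n x - g' x)"
      by (rule L2_sq_diff_triangle) measurable
    also have "\<dots> \<le> 2 * L2_sq M (\<lambda>x. g x - f n x)
        + 2 * (2 * L2_sq M (\<lambda>x. f n x - f' n x) + 2 * L2_sq M (\<lambda>x. f' n x - g' x))"
      by (intro add_left_mono mult_left_mono L2_sq_diff_triangle) auto
    finally show ?thesis
      by (simp add: L2_sq_minus_commute[of M g] distrib_left mult.assoc[symmetric])
  qed
  moreover have "(\<lambda>n. 2 * L2_sq M (\<lambda>x. f n x - g x)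
      + (4 * L2_sq M (\<lambda>x. f n x - f' n x) + 4 * L2_sq M (\<lambda>x. f' n x - g' x))) \<longlonglongrightarrow> 2 * 0 + (4 * 0 + 4 * 0)"
    using assms(5-7) unfolding L2_tendsto_iff
    by (intro tendsto_add ennreal_tendsto_cmult) auto
  ultimately have "L2_sq M (\<lambda>x. g x - g' x) \<le> 2 * 0 + (4 * 0 + 4 * 0)"
    by (intro LIMSEQ_le_const) auto
  then show ?thesis by (simp add: L2_sq_eq_0_iff)
qed

lemma L2_tendsto_unique:
  assumes [measurable]: "\<And>n. f n \<in> borel_measurable M"
    "g \<in> borel_measurable M" "g' \<in> borel_measurable M"
    and "L2_tendsto M f g" "L2_tendsto M f g'"
  shows "AE x in M. g x = g' x"
  by (rule L2_limits_AE_eq[of f _ f]) (use assms in \<open>auto simp: L2_sq_def\<close>)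

lemma L2_tendsto_close:
  assumes [measurable]: "\<And>n. f n \<in> borel_measurable M" "\<And>n. f' n \<in> borel_measurable M"
    "g \<in> borel_measurable M"
    and "L2_tendsto M f g" "(\<lambda>n. L2_sq M (\<lambda>x. f n x - f' n x)) \<longlonglongrightarrow> 0"
  shows "L2_tendsto M f' g"
  unfolding L2_tendsto_iff
proof (rule tendsto_sandwich[where f = "\<lambda>_. 0"])
  show "(\<lambda>n. 2 * L2_sq M (\<lambda>x. f n x - f' n x) + 2 * L2_sq M (\<lambda>x. f n x - g x)) \<longlonglongrightarrow> 0"
  proof -
    have "(\<lambda>n. 2 * L2_sq M (\<lambda>x. f n x - f' n x) + 2 * L2_sq M (\<lambda>x. f n x - g x)) \<longlonglongrightarrow> 2 * 0 + 2 * 0"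
      using assms(4,5) unfolding L2_tendsto_iff by (intro tendsto_add ennreal_tendsto_cmult) auto
    then show ?thesis by simp
  qed
  show "\<forall>\<^sub>F n in sequentially. L2_sq M (\<lambda>x. f' n x - g x)
      \<le> 2 * L2_sq M (\<lambda>x. f n x - f' n x) + 2 * L2_sq M (\<lambda>x. f n x - g x)"
    unfolding L2_sq_minus_commute[of M "f _" "f' _"]
    by (intro always_eventually allI L2_sq_diff_triangle) measurable
qed auto

text \<open>Young's inequality splits the cross term with a free parameter. After integration the
  error is a \<delta>-dependent multiple of the squared distance, which vanishes in the limit, plus
  \<delta> times a fixed finite number; the Cauchy-Schwarz inequality for integrals is
  bypassed.\<close>

lemma abs_norm_sq_diff_le:
  fixes a b :: "'a::real_normed_vector"
  assumes "0 < \<delta>"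
  shows "\<bar>(norm a)\<^sup>2 - (norm b)\<^sup>2\<bar> \<le> (1 + 1 / \<delta>) * (norm (a - b))\<^sup>2 + \<delta> * (norm b)\<^sup>2"
proof -
  define d where "d = norm (a - b)"
  have d: "\<bar>norm a - norm b\<bar> \<le> d" unfolding d_def by (rule norm_triangle_ineq3)
  have "\<bar>(norm a)\<^sup>2 - (norm b)\<^sup>2\<bar> = \<bar>norm a - norm b\<bar> * (norm a + norm b)"
    by (simp add: power2_eq_square square_diff_square_factored abs_mult)
  also have "\<dots> \<le> d * (d + 2 * norm b)"
    using d by (intro mult_mono) auto
  also have "\<dots> = d\<^sup>2 + 2 * (d * norm b)"
    by (simp add: power2_eq_square algebra_simps)
  also have "2 * (d * norm b) \<le> d\<^sup>2 / \<delta> + \<delta> * (norm b)\<^sup>2"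
  proof -
    have "0 \<le> (d - \<delta> * norm b)\<^sup>2 / \<delta>" using assms by simp
    also have "\<dots> = d\<^sup>2 / \<delta> + \<delta> * (norm b)\<^sup>2 - 2 * (d * norm b)"
      using assms by (simp add: power2_eq_square field_simps)
    finally show ?thesis by simp
  qed
  finally show ?thesis by (simp add: d_def algebra_simps)
qed

lemma L2_tendsto_sq:
  assumes f: "\<And>n. f n \<in> L2_fun M" and g: "g \<in> L2_fun M" and lim: "L2_tendsto M f g"
  shows "(\<lambda>n. L2_sq M (f n)) \<longlonglongrightarrow> L2_sq M g"
proof -
  define a where "a n = (\<integral>x. (norm (f n x))\<^sup>2 \<partial>M)" for n
  define b where "b = (\<integral>x. (norm (g x))\<^sup>2 \<partial>M)"
  define e where "e n = (\<integral>x. (norm (f n x - g x))\<^sup>2 \<partial>M)" for n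
  have int1: "integrable M (\<lambda>x. (norm (f n x))\<^sup>2)" for n
    using f[of n] by (auto simp: L2_fun_def)
  have int2: "integrable M (\<lambda>x. (norm (g x))\<^sup>2)"
    using g by (auto simp: L2_fun_def)
  have int3: "integrable M (\<lambda>x. (norm (f n x - g x))\<^sup>2)" for n
    using L2_fun_diff[OF f g, of n] by (auto simp: L2_fun_def)
  note int = int1 int2 int3
  have "(\<lambda>n. ennreal (e n)) \<longlonglongrightarrow> ennreal 0"
    using lim unfolding L2_tendsto_iff e_def by (simp add: L2_sq_eq_integral[OF L2_fun_diff[OF f g]])
  then have e0: "e \<longlonglongrightarrow> 0"
    by (subst (asm) tendsto_ennreal_iff) (auto simp: e_def)
  have b0: "0 \<le> b" unfolding b_def by simp
  have bd: "\<bar>a n - b\<bar> \<le> (1 + 1 / \<delta>) * e n + \<delta> * b" if "\<delta> > 0" for \<delta> n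
  proof -
    have "\<bar>a n - b\<bar> = \<bar>\<integral>x. (norm (f n x))\<^sup>2 - (norm (g x))\<^sup>2 \<partial>M\<bar>"
      unfolding a_def b_def by (subst Bochner_Integration.integral_diff) (use int in auto)
    also have "\<dots> \<le> (\<integral>x. \<bar>(norm (f n x))\<^sup>2 - (norm (g x))\<^sup>2\<bar> \<partial>M)"
      by (rule integral_abs_bound)
    also have "\<dots> \<le> (\<integral>x. (1 + 1 / \<delta>) * (norm (f n x - g x))\<^sup>2 + \<delta> * (norm (g x))\<^sup>2 \<partial>M)"
      using int that by (intro integral_mono abs_norm_sq_diff_le) auto
    also have "\<dots> = (1 + 1 / \<delta>) * e n + \<delta> * b"
      unfolding e_def b_def using int by simp
    finally show ?thesis .
  qed
  have "a \<longlonglongrightarrow> b"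
  proof (rule LIMSEQ_I)
    fix r :: real assume r: "0 < r"
    \<comment> \<open>The second error term is \<delta> * b; the summand 1 keeps the quotient
      meaningful when b = 0.\<close>
    define \<delta> where "\<delta> = r / (2 * (b + 1))"
    have \<delta>: "\<delta> > 0" using r b0 by (simp add: \<delta>_def)
    have "r * b < r * (b + 1)" using r by simp
    then have \<delta>b: "\<delta> * b < r / 2" using r b0 by (simp add: \<delta>_def field_simps)
    have "(\<lambda>n. (1 + 1 / \<delta>) * e n) \<longlonglongrightarrow> (1 + 1 / \<delta>) * 0"
      by (intro tendsto_mult tendsto_const e0)
    then have "\<forall>\<^sub>F n in sequentially. (1 + 1 / \<delta>) * e n < r / 2"
      using r by (intro order_tendstoD) auto
    then have "\<forall>\<^sub>F n in sequentially. norm (a n - b) < r"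
    proof eventually_elim
      case (elim n)
      then show ?case using bd[OF \<delta>, of n] \<delta>b unfolding real_norm_def by linarith
    qed
    then show "\<exists>no. \<forall>n\<ge>no. norm (a n - b) < r" by (simp add: eventually_sequentially)
  qed
  then show ?thesis
    unfolding L2_sq_eq_integral[OF f] L2_sq_eq_integral[OF g] a_def b_def by (rule tendsto_ennrealI)
qed

text \<open>The weights \<open>2\<^sup>k\<close> make the increments of a fast subsequence square summable almost everywhere
  with room to spare, so that Minkowski's inequality is not needed.\<close>

lemma L2_fast_Cauchy_AE_convergent:
  fixes f :: "nat \<Rightarrow> 'b \<Rightarrow> 'c::euclidean_space"
  assumes [measurable]: "\<And>k. f k \<in> borel_measurable M"
    and fast: "\<And>k. L2_sq M (\<lambda>x. f (Suc k) x - f k x) \<le> ennreal ((1/4) ^ k)"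
  shows "AE x in M. convergent (\<lambda>k. f k x)"
proof -
  define d where "d k x = norm (f (Suc k) x - f k x)" for k x
  have [measurable]: "d k \<in> borel_measurable M" for k unfolding d_def by measurable
  have "(\<integral>\<^sup>+x. (\<Sum>k. ennreal (2 ^ k * (d k x)\<^sup>2)) \<partial>M) = (\<Sum>k. \<integral>\<^sup>+x. ennreal (2 ^ k * (d k x)\<^sup>2) \<partial>M)"
    by (intro nn_integral_suminf) measurable
  also have "\<dots> = (\<Sum>k. ennreal (2 ^ k) * L2_sq M (\<lambda>x. f (Suc k) x - f k x))"
    by (intro suminf_cong) (simp add: ennreal_mult nn_integral_cmult L2_sq_def d_def)
  also have "\<dots> \<le> (\<Sum>k. ennreal (2 ^ k) * ennreal ((1/4) ^ k))"
    by (intro suminf_le mult_left_mono fast summableI) auto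
  also have "\<dots> = (\<Sum>k. ennreal ((1/2) ^ k))"
  proof (intro suminf_cong)
    fix k :: nat
    have "ennreal (2 ^ k) * ennreal ((1/4) ^ k) = ennreal (2 ^ k * (1/4) ^ k)"
      by (rule ennreal_mult[symmetric]) auto
    also have "(2::real) ^ k * (1/4) ^ k = (1/2) ^ k"
      by (simp only: power_mult_distrib[symmetric]) simp
    finally show "ennreal (2 ^ k) * ennreal ((1/4) ^ k) = ennreal ((1/2) ^ k)" .
  qed
  also have "\<dots> = ennreal (\<Sum>k. (1/2) ^ k)"
    by (intro suminf_ennreal2 summable_geometric) auto
  also have "\<dots> < \<infinity>" by simp
  finally have "(\<integral>\<^sup>+x. (\<Sum>k. ennreal (2 ^ k * (d k x)\<^sup>2)) \<partial>M) \<noteq> \<infinity>" by simp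
  then have "AE x in M. (\<Sum>k. ennreal (2 ^ k * (d k x)\<^sup>2)) \<noteq> \<infinity>"
    by (intro nn_integral_noteq_infinite) measurable
  then show ?thesis
  proof eventually_elim
    case (elim x)
    define C where "C = enn2real (\<Sum>k. ennreal (2 ^ k * (d k x)\<^sup>2))"
    have C0: "0 \<le> C" by (simp add: C_def)
    have C: "2 ^ k * (d k x)\<^sup>2 \<le> C" for k
    proof -
      have "ennreal (2 ^ k * (d k x)\<^sup>2) = (\<Sum>i\<in>{k}. ennreal (2 ^ i * (d i x)\<^sup>2))" by simp
      also have "\<dots> \<le> (\<Sum>k. ennreal (2 ^ k * (d k x)\<^sup>2))"
        by (intro sum_le_suminf) auto
      also have "\<dots> = ennreal C" using elim by (simp add: C_def less_top)
      finally show ?thesis using C0 by (simp add: ennreal_le_iff)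
    qed
    have "d k x \<le> sqrt C * sqrt (1/2) ^ k" for k
    proof -
      have "(d k x)\<^sup>2 \<le> C * (1/2) ^ k" using C[of k] by (simp add: field_simps)
      then have "sqrt ((d k x)\<^sup>2) \<le> sqrt (C * (1/2) ^ k)" by (rule real_sqrt_le_mono)
      also have "sqrt (C * (1/2) ^ k) = sqrt C * sqrt (1/2) ^ k"
        by (simp only: real_sqrt_mult real_sqrt_power)
      also have "sqrt ((d k x)\<^sup>2) = d k x" by (simp add: d_def)
      finally show ?thesis .
    qed
    then have bd: "norm (f (Suc k) x - f k x) \<le> sqrt C * sqrt (1/2) ^ k" if "k \<ge> 0" for k
      unfolding d_def by blast
    have "norm (sqrt (1/2)) < (1::real)"
    proof -
      have "sqrt (1/2) < sqrt 1" by (rule real_sqrt_less_mono) simp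
      moreover have "norm (sqrt (1/2)) = sqrt (1/2)"
        unfolding real_norm_def by (rule abs_of_nonneg) (rule real_sqrt_ge_zero, simp)
      ultimately show ?thesis unfolding real_sqrt_one by linarith
    qed
    then have "summable (\<lambda>k. sqrt C * sqrt (1/2) ^ k)"
      by (intro summable_mult summable_geometric)
    then have "summable (\<lambda>k. f (Suc k) x - f k x)"
      by (rule summable_comparison_test'[of _ 0]) (rule bd)
    then have "convergent (\<lambda>n. \<Sum>k<n. f (Suc k) x - f k x)"
      by (simp add: summable_iff_convergent)
    then have "convergent (\<lambda>n. (\<Sum>k<n. f (Suc k) x - f k x) + f 0 x)"
      by (intro convergent_add convergent_const)
    moreover have "(\<Sum>k<n. f (Suc k) x - f k x) + f 0 x = f n x" for n
      using sum_lessThan_telescope[of "\<lambda>k. f k x" n] by simp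
    ultimately show ?case by simp
  qed
qed

text \<open>Riesz-Fischer, for functions instead of classes. The limit is taken pointwise with
  \<open>lim\<close> along a fast subsequence; its unspecified value on the exceptional null set
  does not affect the integrals.\<close>

theorem L2_complete:
  fixes f :: "nat \<Rightarrow> 'b \<Rightarrow> 'c::euclidean_space"
  assumes f: "\<And>n. f n \<in> L2_fun M"
    and Cauchy: "\<And>e. e > 0 \<Longrightarrow> \<exists>N. \<forall>m\<ge>N. \<forall>n\<ge>N. L2_sq M (\<lambda>x. f m x - f n x) \<le> ennreal e"
  obtains g where "g \<in> L2_fun M" "L2_tendsto M f g"
proof -
  have [measurable]: "f n \<in> borel_measurable M" for n using f by (simp add: L2_fun_def)
  have "\<exists>N. \<forall>m\<ge>N. \<forall>n\<ge>N. L2_sq M (\<lambda>x. f m x - f n x) \<le> ennreal ((1/4) ^ k)" for k :: nat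
    by (intro Cauchy) simp
  then obtain N where N: "\<And>k m n. m \<ge> N k \<Longrightarrow> n \<ge> N k \<Longrightarrow> L2_sq M (\<lambda>x. f m x - f n x) \<le> ennreal ((1/4) ^ k)"
    by metis
  \<comment> \<open>The sum puts \<open>s k\<close> beyond \<open>N k\<close> and makes
    \<open>s\<close> monotone, so consecutive terms are within \<open>(1/4) ^ k\<close>. The summand
    \<open>k\<close> makes the indices exceed any given bound, which the passage to the limit
    inferior needs.\<close>
  define s where "s k = k + (\<Sum>i\<le>k. N i)" for k
  have sN: "N k \<le> s k" for k
    unfolding s_def by (simp add: member_le_sum trans_le_add2)
  have s_mono: "s k \<le> s (Suc k)" for k by (simp add: s_def)
  have AEc: "AE x in M. convergent (\<lambda>k. f (s k) x)"
  proof (rule L2_fast_Cauchy_AE_convergent)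
    fix k show "L2_sq M (\<lambda>x. f (s (Suc k)) x - f (s k) x) \<le> ennreal ((1/4) ^ k)"
      using sN[of k] s_mono[of k] by (intro N) auto
  qed measurable
  define g where "g x = lim (\<lambda>k. f (s k) x)" for x
  have [measurable]: "g \<in> borel_measurable M"
    unfolding g_def by (rule borel_measurable_lim_metric) measurable
  \<comment> \<open>Fatou's lemma compares \<open>f m\<close> directly with the limit of the
    subsequence, so that convergence of the whole sequence and square integrability of
    \<open>g\<close> both follow from the Cauchy condition.\<close>
  have bound: "L2_sq M (\<lambda>x. f m x - g x) \<le> ennreal e"
    if "\<forall>m\<ge>K. \<forall>n\<ge>K. L2_sq M (\<lambda>x. f m x - f n x) \<le> ennreal e" "m \<ge> K" for e m K
  proof -
    have "L2_sq M (\<lambda>x. f m x - g x) = (\<integral>\<^sup>+x. liminf (\<lambda>k. ennreal ((norm (f m x - f (s k) x))\<^sup>2)) \<partial>M)"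
      unfolding L2_sq_def
    proof (rule nn_integral_cong_AE)
      show "AE x in M. ennreal ((norm (f m x - g x))\<^sup>2) = liminf (\<lambda>k. ennreal ((norm (f m x - f (s k) x))\<^sup>2))"
        using AEc
      proof eventually_elim
        case (elim x)
        then have "(\<lambda>k. f (s k) x) \<longlonglongrightarrow> g x" by (simp add: g_def convergent_LIMSEQ_iff)
        then have "(\<lambda>k. ennreal ((norm (f m x - f (s k) x))\<^sup>2)) \<longlonglongrightarrow> ennreal ((norm (f m x - g x))\<^sup>2)"
          by (intro tendsto_intros tendsto_ennrealI)
        then show ?case by (intro lim_imp_Liminf[symmetric]) auto
      qed
    qed
    also have "\<dots> \<le> liminf (\<lambda>k. L2_sq M (\<lambda>x. f m x - f (s k) x))"
      unfolding L2_sq_def by (rule nn_integral_liminf) measurable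
    also have "\<dots> \<le> ennreal e"
    proof -
      have "s k \<ge> K" if "k \<ge> K" for k using that by (simp add: s_def)
      then have "\<forall>\<^sub>F k in sequentially. L2_sq M (\<lambda>x. f m x - f (s k) x) \<le> ennreal e"
        using that by (auto simp: eventually_sequentially intro!: exI[of _ K])
      then have "limsup (\<lambda>k. L2_sq M (\<lambda>x. f m x - f (s k) x)) \<le> ennreal e"
        by (rule Limsup_bounded)
      then show ?thesis
        using Liminf_le_Limsup[of sequentially "\<lambda>k. L2_sq M (\<lambda>x. f m x - f (s k) x)"] by (auto intro: order_trans)
    qed
    finally show ?thesis .
  qed
  have tend: "L2_tendsto M f g"
    unfolding L2_tendsto_iff
  proof (rule order_tendstoI)
    fix a :: ennreal assume "0 < a"
    have "\<exists>e>0. ennreal e < a"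
    proof (cases a)
      case (real r)
      with \<open>0 < a\<close> have "0 < r / 2" "ennreal (r / 2) < a" by (auto simp: ennreal_less_iff)
      then show ?thesis by blast
    next
      case top
      then have "(0::real) < 1" "ennreal 1 < a" by simp_all
      then show ?thesis by blast
    qed
    then obtain e where e: "0 < e" "ennreal e < a" by blast
    obtain K where K: "\<forall>m\<ge>K. \<forall>n\<ge>K. L2_sq M (\<lambda>x. f m x - f n x) \<le> ennreal e"
      using Cauchy[OF e(1)] by blast
    show "\<forall>\<^sub>F n in sequentially. L2_sq M (\<lambda>x. f n x - g x) < a"
      unfolding eventually_sequentially
    proof (intro exI[of _ K] allI impI)
      fix n assume "K \<le> n"
      from bound[OF K this] e(2) show "L2_sq M (\<lambda>x. f n x - g x) < a" by (rule order_le_less_trans)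
    qed
  qed auto
  obtain K where K: "\<forall>m\<ge>K. \<forall>n\<ge>K. L2_sq M (\<lambda>x. f m x - f n x) \<le> ennreal 1"
    using Cauchy[of 1] by auto
  have "L2_sq M (\<lambda>x. f K x - g x) < \<infinity>" using bound[OF K order_refl] by (simp add: order_le_less_trans)
  then have "(\<lambda>x. f K x - g x) \<in> L2_fun M" by (simp add: L2_fun_iff)
  from L2_fun_diff[OF f[of K] this] have "g \<in> L2_fun M" by simp
  then show ?thesis using tend that by blast
qed

section \<open>Gaussian regularization of the Fourier transform\<close>

text \<open>A non-integrable \<open>f\<close> stays non-integrable after rescaling, and both
  integrals then take the default value 0; so measurability suffices.\<close>

lemma lborel_integral_affine:
  fixes f :: "'a::euclidean_space \<Rightarrow> complex"
  assumes [measurable]: "f \<in> borel_measurable borel" and c: "c \<noteq> 0"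
  shows "(\<integral>x. f x \<partial>lborel) = complex_of_real (\<bar>c\<bar> ^ DIM('a)) * (\<integral>x. f (t + c *\<^sub>R x) \<partial>lborel)"
proof -
  have "(\<integral>x. f x \<partial>lborel) = (\<integral>x. f x \<partial>density (distr lborel borel (\<lambda>x. t + c *\<^sub>R x)) (\<lambda>_. \<bar>c\<bar> ^ DIM('a)))"
    using lborel_affine[OF c, of t] by simp
  also have "\<dots> = (\<integral>x. (\<bar>c\<bar> ^ DIM('a)) *\<^sub>R f (t + c *\<^sub>R x) \<partial>lborel)"
    by (subst integral_density) (auto simp: integral_distr)
  finally show ?thesis by (simp add: scaleR_conv_of_real)
qed

lemma nn_integral_lborel_translate:
  fixes f :: "'a::euclidean_space \<Rightarrow> ennreal"
  assumes [measurable]: "f \<in> borel_measurable borel"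
  shows "(\<integral>\<^sup>+x. f (x + t) \<partial>lborel) = (\<integral>\<^sup>+x. f x \<partial>lborel)"
proof -
  have "(\<integral>\<^sup>+x. f x \<partial>lborel) = (\<integral>\<^sup>+x. f x \<partial>distr lborel borel (\<lambda>x. t + x))"
    using lborel_affine[of 1 t] by (simp add: density_1)
  also have "\<dots> = (\<integral>\<^sup>+x. f (x + t) \<partial>lborel)"
    by (subst nn_integral_distr) (auto simp: add.commute)
  finally show ?thesis by simp
qed

text \<open>Left unnormalized: with value 1 at the origin and bound 1 it acts as a cutoff that tends
  to 1 when its argument is scaled to 0. Its mass then shows up as an explicit constant.\<close>

definition gauss :: "'a::euclidean_space \<Rightarrow> real" where
  "gauss x = exp (- (norm x)\<^sup>2 / 2)"

lemma gauss_measurable[measurable]: "gauss \<in> borel_measurable borel"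
  unfolding gauss_def by measurable

lemma gauss_pos: "0 < gauss x" and gauss_le_1: "gauss x \<le> 1"
  by (simp_all add: gauss_def)

text \<open>The integral is the characteristic function of the standard normal law, multiplied by
  the factor sqrt (2 \<pi>) that normalizes the density.\<close>

lemma integrable_exp_gauss_real:
  "integrable lborel (\<lambda>x::real. exp (\<i> * complex_of_real (t * x)) * complex_of_real (exp (- x\<^sup>2 / 2)))"
  and integral_exp_gauss_real:
  "(\<integral>x. exp (\<i> * complex_of_real (t * x)) * complex_of_real (exp (- x\<^sup>2 / 2)) \<partial>lborel)
    = complex_of_real (sqrt (2 * pi) * exp (- t\<^sup>2 / 2))"
proof -
  have eq: "complex_of_real (exp (- x\<^sup>2 / 2)) = complex_of_real (sqrt (2 * pi)) * complex_of_real (std_normal_density x)" for x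
    by (simp add: std_normal_density_def)
  have intd: "integrable lborel std_normal_density" by (rule integrable_normal_density) simp
  show "integrable lborel (\<lambda>x::real. exp (\<i> * complex_of_real (t * x)) * complex_of_real (exp (- x\<^sup>2 / 2)))"
    unfolding eq
    by (rule Bochner_Integration.integrable_bound[of _ "\<lambda>x. sqrt (2 * pi) * std_normal_density x"])
       (use intd in \<open>auto simp: norm_mult\<close>)
  have "complex_of_real (exp (- t\<^sup>2 / 2)) = char std_normal_distribution t"
    by (simp add: char_std_normal_distribution)
  also have "\<dots> = (\<integral>x. std_normal_density x *\<^sub>R exp (\<i> * complex_of_real (t * x)) \<partial>lborel)"
    unfolding char_def by (subst integral_density) auto
  finally have *: "(\<integral>x. std_normal_density x *\<^sub>R exp (\<i> * complex_of_real (t * x)) \<partial>lborel) = complex_of_real (exp (- t\<^sup>2 / 2))" ..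
  have "(\<integral>x. exp (\<i> * complex_of_real (t * x)) * complex_of_real (exp (- x\<^sup>2 / 2)) \<partial>lborel)
     = (\<integral>x. complex_of_real (sqrt (2 * pi)) * (std_normal_density x *\<^sub>R exp (\<i> * complex_of_real (t * x))) \<partial>lborel)"
    unfolding eq by (simp add: scaleR_conv_of_real mult_ac)
  also have "\<dots> = complex_of_real (sqrt (2 * pi)) * complex_of_real (exp (- t\<^sup>2 / 2))"
    by (subst integral_mult_right_zero) (simp only: *)
  finally show "(\<integral>x. exp (\<i> * complex_of_real (t * x)) * complex_of_real (exp (- x\<^sup>2 / 2)) \<partial>lborel)
    = complex_of_real (sqrt (2 * pi) * exp (- t\<^sup>2 / 2))" by simp
qed

lemma exp_gauss_prod:
  fixes x z :: "'a::euclidean_space"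
  shows "exp (\<i> * complex_of_real (x \<bullet> z)) * complex_of_real (gauss x)
    = (\<Prod>b\<in>Basis. exp (\<i> * complex_of_real ((z \<bullet> b) * (x \<bullet> b))) * complex_of_real (exp (- (x \<bullet> b)\<^sup>2 / 2)))"
proof -
  have "x \<bullet> z = (\<Sum>b\<in>Basis. (z \<bullet> b) * (x \<bullet> b))"
    by (subst euclidean_inner) (simp add: mult.commute)
  moreover have "(norm x)\<^sup>2 = (\<Sum>b\<in>Basis. (x \<bullet> b)\<^sup>2)"
    unfolding power2_norm_eq_inner by (subst euclidean_inner) (simp add: power2_eq_square)
  then have "- (norm x)\<^sup>2 / 2 = (\<Sum>b\<in>Basis. - (x \<bullet> b)\<^sup>2 / 2)"
    by (simp add: sum_negf sum_divide_distrib[symmetric])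
  ultimately have e: "exp (\<i> * complex_of_real (x \<bullet> z)) = (\<Prod>b\<in>Basis. exp (\<i> * complex_of_real ((z \<bullet> b) * (x \<bullet> b))))"
    "gauss x = (\<Prod>b\<in>Basis. exp (- (x \<bullet> b)\<^sup>2 / 2))"
    unfolding gauss_def
    by (simp_all only: exp_sum[symmetric, OF finite_Basis] of_real_sum sum_distrib_left)
  show ?thesis
    unfolding e prod.distrib of_real_prod ..
qed

text \<open>Lebesgue measure is the image of a product measure under the coordinate map, and the
  integrand factorizes over the coordinates; so both claims reduce to dimension one.\<close>

lemma integrable_exp_gauss:
  fixes z :: "'a::euclidean_space"
  shows "integrable lborel (\<lambda>x. exp (\<i> * complex_of_real (x \<bullet> z)) * complex_of_real (gauss x))"
  and integral_exp_gauss: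
  "(\<integral>x. exp (\<i> * complex_of_real (x \<bullet> z)) * complex_of_real (gauss x) \<partial>lborel)
    = complex_of_real (sqrt (2 * pi) ^ DIM('a) * gauss z)"
proof -
  interpret product_sigma_finite "\<lambda>_::'a. lborel :: real measure"
    by standard
  let ?h = "\<lambda>b x. exp (\<i> * complex_of_real ((z \<bullet> b) * x)) * complex_of_real (exp (- x\<^sup>2 / 2))"
  have comp: "(\<Sum>b'\<in>Basis. x b' *\<^sub>R b') \<bullet> b = x b" if "b \<in> Basis" for x and b :: 'a
    using that by (simp add: inner_sum_left inner_Basis if_distrib cong: if_cong)
  have meas[measurable]: "(\<lambda>x::'a. exp (\<i> * complex_of_real (x \<bullet> z)) * complex_of_real (gauss x)) \<in> borel_measurable borel"
    by measurable
  have eq: "exp (\<i> * complex_of_real ((\<Sum>b\<in>Basis. x b *\<^sub>R b) \<bullet> z)) * complex_of_real (gauss (\<Sum>b\<in>Basis. x b *\<^sub>R b))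
      = (\<Prod>b\<in>Basis. ?h b (x b))" for x
    unfolding exp_gauss_prod by (intro prod.cong refl) (simp add: comp)
  show "integrable lborel (\<lambda>x. exp (\<i> * complex_of_real (x \<bullet> z)) * complex_of_real (gauss x))"
    by (subst lborel_eq, subst integrable_distr_eq)
       (auto simp only: eq meas intro!: product_integrable_prod integrable_exp_gauss_real finite_Basis, measurable)
  have "(\<integral>x. exp (\<i> * complex_of_real (x \<bullet> z)) * complex_of_real (gauss x) \<partial>lborel)
      = (\<integral>x. (\<Prod>b\<in>Basis. ?h b (x b)) \<partial>(\<Pi>\<^sub>M b\<in>Basis. lborel))"
    by (subst lborel_eq, subst integral_distr) (auto simp: eq)
  also have "\<dots> = (\<Prod>b\<in>Basis. complex_of_real (sqrt (2 * pi) * exp (- (z \<bullet> b)\<^sup>2 / 2)))"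
    by (subst product_integral_prod[OF finite_Basis integrable_exp_gauss_real]) (simp only: integral_exp_gauss_real)
  \<comment> \<open>The factorization at frequency 0 folds the product of one-dimensional Gaussians
    back into \<open>gauss z\<close>.\<close>
  also have "\<dots> = complex_of_real (sqrt (2 * pi) ^ DIM('a) * gauss z)"
    using exp_gauss_prod[of z "0::'a"] by (simp add: prod.distrib)
  finally show "(\<integral>x. exp (\<i> * complex_of_real (x \<bullet> z)) * complex_of_real (gauss x) \<partial>lborel)
    = complex_of_real (sqrt (2 * pi) ^ DIM('a) * gauss z)" .
qed

lemma integrable_gauss: "integrable lborel (gauss :: 'a::euclidean_space \<Rightarrow> real)"
  using integrable_exp_gauss[of "0::'a"] by (simp add: complex_of_real_integrable_eq)

lemma integral_gauss: "(\<integral>x. gauss x \<partial>(lborel :: 'a::euclidean_space measure)) = sqrt (2 * pi) ^ DIM('a)"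
  using integral_exp_gauss[of "0::'a"] by (simp add: gauss_def[of 0] del: of_real_power of_real_mult)


lemma integral_exp_gauss_scaled:
  fixes z :: "'a::euclidean_space"
  assumes c: "c > 0"
  shows "(\<integral>x. exp (\<i> * complex_of_real (x \<bullet> z)) * complex_of_real (gauss (c *\<^sub>R x)) \<partial>lborel)
    = complex_of_real (sqrt (2 * pi) ^ DIM('a) * gauss (z /\<^sub>R c) / c ^ DIM('a))"
proof -
  have "(\<integral>x. exp (\<i> * complex_of_real (x \<bullet> z)) * complex_of_real (gauss (c *\<^sub>R x)) \<partial>lborel)
    = complex_of_real (\<bar>inverse c\<bar> ^ DIM('a)) *
      (\<integral>x. exp (\<i> * complex_of_real ((0 + inverse c *\<^sub>R x) \<bullet> z)) * complex_of_real (gauss (c *\<^sub>R (0 + inverse c *\<^sub>R x))) \<partial>lborel)"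
    using c by (intro lborel_integral_affine) auto
  also have "\<dots> = complex_of_real (\<bar>inverse c\<bar> ^ DIM('a)) *
      (\<integral>x. exp (\<i> * complex_of_real (x \<bullet> (z /\<^sub>R c))) * complex_of_real (gauss x) \<partial>lborel)"
    using c by simp
  also have "\<dots> = complex_of_real (sqrt (2 * pi) ^ DIM('a) * gauss (z /\<^sub>R c) / c ^ DIM('a))"
    unfolding integral_exp_gauss using c by (simp add: field_simps)
  finally show ?thesis .
qed

lemma integrable_gauss_scaled:
  assumes c: "c > 0"
  shows "integrable lborel (\<lambda>x::'a::euclidean_space. gauss (c *\<^sub>R x))"
proof -
  have "integrable (density (distr lborel borel (\<lambda>x::'a. 0 + inverse c *\<^sub>R x)) (\<lambda>_. \<bar>inverse c\<bar> ^ DIM('a))) (\<lambda>x::'a. gauss (c *\<^sub>R x))"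
    using c integrable_gauss[where 'a='a]
    by (subst integrable_density) (auto simp: integrable_distr_eq)
  then show ?thesis
    using lborel_affine[of "inverse c" "0::'a"] c by simp
qed

lemma borel_measurable_cnj[measurable (raw)]:
  assumes [measurable]: "f \<in> borel_measurable M"
  shows "(\<lambda>x. cnj (f x)) \<in> borel_measurable M"
  by (rule borel_measurable_continuous_on[OF _ assms]) (intro continuous_intros)

lemma fourier_measurable:
  fixes f :: "'a::euclidean_space \<Rightarrow> complex"
  assumes [measurable]: "f \<in> borel_measurable borel"
  shows "fourier f \<in> borel_measurable borel"
proof -
  have "(\<lambda>\<xi>. LINT x|lborel. exp (\<i> * complex_of_real (\<xi> \<bullet> x)) * f x) \<in> borel_measurable borel"
    by measurable
  then show ?thesis by (simp add: fourier_def[abs_def])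
qed

lemma integrable_fourier_integrand:
  fixes f :: "'a::euclidean_space \<Rightarrow> complex"
  assumes "integrable lborel f"
  shows "integrable lborel (\<lambda>x. exp (\<i> * complex_of_real (\<xi> \<bullet> x)) * f x)"
proof -
  have [measurable]: "f \<in> borel_measurable borel" using assms by auto
  show ?thesis
    by (rule Bochner_Integration.integrable_bound[OF assms]) (auto simp: norm_mult)
qed

lemma fourier_diff:
  assumes "integrable lborel f" "integrable lborel g"
  shows "fourier (\<lambda>x. f x - g x) \<xi> = fourier f \<xi> - fourier g \<xi>"
  unfolding fourier_def right_diff_distrib
  by (intro Bochner_Integration.integral_diff integrable_fourier_integrand assms)

lemma norm_fourier_le:
  assumes "integrable lborel f"
  shows "cmod (fourier f \<xi>) \<le> (\<integral>x. cmod (f x) \<partial>lborel)"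
  unfolding fourier_def
  by (rule order_trans[OF integral_norm_bound]) (simp add: norm_mult)

text \<open>The substitution \<open>y = x + c z\<close> absorbs the power of \<open>c\<close> in the transform of the scaled
  Gaussian, which leaves a form suited to \<open>c \<longlonglongrightarrow> 0\<close>.\<close>

lemma fourier_sq_gauss:
  fixes f :: "'a::euclidean_space \<Rightarrow> complex"
  assumes f: "integrable lborel f" and c: "c > 0"
  shows "(\<integral>\<xi>. complex_of_real ((cmod (fourier f \<xi>))\<^sup>2 * gauss (c *\<^sub>R \<xi>)) \<partial>lborel)
    = complex_of_real (sqrt (2 * pi) ^ DIM('a)) *
      (\<integral>x. f x * (\<integral>z. cnj (f (x + c *\<^sub>R z)) * complex_of_real (gauss z) \<partial>lborel) \<partial>lborel)"
proof -
  have [measurable]: "f \<in> borel_measurable borel" using f by auto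
  define K where "K = sqrt (2 * pi) ^ DIM('a)"
  define F where "F p = f (fst p) * cnj (f (snd p))" for p :: "'a \<times> 'a"
  have [measurable]: "F \<in> borel_measurable borel" unfolding F_def borel_prod[symmetric] by measurable
  have [measurable]: "F \<in> borel_measurable (borel \<Otimes>\<^sub>M borel)" unfolding F_def by measurable
  have F: "integrable (lborel \<Otimes>\<^sub>M lborel) F"
  proof (rule lborel_pair.Fubini_integrable)
    show "integrable lborel (\<lambda>x. \<integral>y. norm (F (x, y)) \<partial>lborel)"
      using f by (simp add: F_def norm_mult)
    show "AE x in lborel. integrable lborel (\<lambda>y. F (x, y))"
      using f by (simp add: F_def)
  qed simp
  \<comment> \<open>The integrand over frequency and two space variables: |f^|^2 is f^ times its
    conjugate, hence a double integral of \<open>F\<close> against a character of x - y.\<close>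
  define H where "H \<xi> p = exp (\<i> * complex_of_real (\<xi> \<bullet> (fst p - snd p))) * complex_of_real (gauss (c *\<^sub>R \<xi>)) * F p"
    for \<xi> and p :: "'a \<times> 'a"
  have [measurable]: "case_prod H \<in> borel_measurable (borel \<Otimes>\<^sub>M (borel \<Otimes>\<^sub>M borel))"
    unfolding H_def by measurable
  have sq: "complex_of_real ((cmod (fourier f \<xi>))\<^sup>2 * gauss (c *\<^sub>R \<xi>)) = (\<integral>p. H \<xi> p \<partial>(lborel \<Otimes>\<^sub>M lborel))" for \<xi>
  proof -
    have H\<xi>: "integrable (lborel \<Otimes>\<^sub>M lborel) (H \<xi>)"
    proof (rule Bochner_Integration.integrable_bound[OF F])
      show "H \<xi> \<in> borel_measurable (lborel \<Otimes>\<^sub>M lborel)" unfolding H_def by measurable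
      show "AE p in lborel \<Otimes>\<^sub>M lborel. norm (H \<xi> p) \<le> norm (F p)"
        using gauss_le_1[of "c *\<^sub>R \<xi>"] gauss_pos[of "c *\<^sub>R \<xi>"]
        by (intro AE_I2) (simp add: H_def norm_mult mult_left_le_one_le)
    qed
    have "(\<integral>p. H \<xi> p \<partial>(lborel \<Otimes>\<^sub>M lborel)) = (\<integral>x. \<integral>y. H \<xi> (x, y) \<partial>lborel \<partial>lborel)"
      by (rule lborel_pair.integral_fst'[OF H\<xi>, symmetric])
    also have "\<dots> = (\<integral>x. (exp (\<i> * complex_of_real (\<xi> \<bullet> x)) * f x) *
        (\<integral>y. cnj (exp (\<i> * complex_of_real (\<xi> \<bullet> y)) * f y) * complex_of_real (gauss (c *\<^sub>R \<xi>)) \<partial>lborel) \<partial>lborel)"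
    proof (intro Bochner_Integration.integral_cong refl)
      fix x
      have "H \<xi> (x, y) = (exp (\<i> * complex_of_real (\<xi> \<bullet> x)) * f x) *
        (cnj (exp (\<i> * complex_of_real (\<xi> \<bullet> y)) * f y) * complex_of_real (gauss (c *\<^sub>R \<xi>)))" for y
      proof -
        have "exp (\<i> * complex_of_real (\<xi> \<bullet> (x - y)))
            = exp (\<i> * complex_of_real (\<xi> \<bullet> x)) * cnj (exp (\<i> * complex_of_real (\<xi> \<bullet> y)))"
          by (simp add: exp_cnj mult_exp_exp inner_diff_right right_diff_distrib)
        then show ?thesis unfolding H_def F_def by (simp add: mult_ac)
      qed
      then show "(\<integral>y. H \<xi> (x, y) \<partial>lborel) = (exp (\<i> * complex_of_real (\<xi> \<bullet> x)) * f x) *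
        (\<integral>y. cnj (exp (\<i> * complex_of_real (\<xi> \<bullet> y)) * f y) * complex_of_real (gauss (c *\<^sub>R \<xi>)) \<partial>lborel)"
        by (simp only: integral_mult_right_zero)
    qed
    also have "\<dots> = fourier f \<xi> * (cnj (fourier f \<xi>) * complex_of_real (gauss (c *\<^sub>R \<xi>)))"
      by (simp only: integral_mult_left_zero Bochner_Integration.integral_cnj fourier_def)
    also have "\<dots> = complex_of_real ((cmod (fourier f \<xi>))\<^sup>2 * gauss (c *\<^sub>R \<xi>))"
      by (simp only: of_real_mult complex_norm_square mult.assoc)
    finally show ?thesis ..
  qed
  interpret P: pair_sigma_finite "lborel :: 'a measure" "lborel \<Otimes>\<^sub>M lborel :: ('a \<times> 'a) measure"
    unfolding lborel_prod ..
  \<comment> \<open>The Gaussian in \<xi> makes the triple integral absolutely convergent. So far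
    |f^|^2 is only known to be bounded, and without this factor Fubini's theorem could not be
    applied.\<close>
  have HI: "integrable (lborel \<Otimes>\<^sub>M (lborel \<Otimes>\<^sub>M lborel)) (case_prod H)"
  proof (rule P.Fubini_integrable)
    show "case_prod H \<in> borel_measurable (lborel \<Otimes>\<^sub>M (lborel \<Otimes>\<^sub>M lborel))" by measurable
    have n: "norm (case_prod H (\<xi>, p)) = gauss (c *\<^sub>R \<xi>) * norm (F p)" for \<xi> p
      using gauss_pos[of "c *\<^sub>R \<xi>"] by (simp add: H_def norm_mult)
    show "integrable lborel (\<lambda>\<xi>. \<integral>p. norm (case_prod H (\<xi>, p)) \<partial>(lborel \<Otimes>\<^sub>M lborel))"
      unfolding n using integrable_gauss_scaled[OF c, where 'a='a] by simp
    show "AE \<xi> in lborel. integrable (lborel \<Otimes>\<^sub>M lborel) (\<lambda>p. case_prod H (\<xi>, p))"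
    proof (intro AE_I2)
      fix \<xi> :: 'a
      have "integrable (lborel \<Otimes>\<^sub>M lborel) (\<lambda>p. gauss (c *\<^sub>R \<xi>) * norm (F p))" using F by simp
      then show "integrable (lborel \<Otimes>\<^sub>M lborel) (\<lambda>p. case_prod H (\<xi>, p))"
      proof (rule Bochner_Integration.integrable_bound)
        show "(\<lambda>p. case_prod H (\<xi>, p)) \<in> borel_measurable (lborel \<Otimes>\<^sub>M lborel)"
          unfolding H_def prod.case by measurable
        show "AE p in lborel \<Otimes>\<^sub>M lborel. norm (case_prod H (\<xi>, p)) \<le> norm (gauss (c *\<^sub>R \<xi>) * norm (F p))"
          unfolding n real_norm_def by (intro AE_I2 abs_ge_self)
      qed
    qed
  qed
  have "(\<integral>\<xi>. complex_of_real ((cmod (fourier f \<xi>))\<^sup>2 * gauss (c *\<^sub>R \<xi>)) \<partial>lborel)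
      = (\<integral>\<xi>. \<integral>p. H \<xi> p \<partial>(lborel \<Otimes>\<^sub>M lborel) \<partial>lborel)"
    by (simp only: sq)
  also have "\<dots> = (\<integral>p. \<integral>\<xi>. H \<xi> p \<partial>lborel \<partial>(lborel \<Otimes>\<^sub>M lborel))"
    by (rule P.Fubini_integral[OF HI, symmetric])
  also have "\<dots> = (\<integral>p. complex_of_real (K * gauss ((fst p - snd p) /\<^sub>R c) / c ^ DIM('a)) * F p \<partial>(lborel \<Otimes>\<^sub>M lborel))"
    unfolding H_def integral_mult_left_zero integral_exp_gauss_scaled[OF c] K_def ..
  also have "\<dots> = (\<integral>x. \<integral>y. complex_of_real (K * gauss ((x - y) /\<^sub>R c) / c ^ DIM('a)) * F (x, y) \<partial>lborel \<partial>lborel)"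
  proof -
    have "integrable (lborel \<Otimes>\<^sub>M lborel) (\<lambda>p. complex_of_real (K * gauss ((fst p - snd p) /\<^sub>R c) / c ^ DIM('a)) * F p)"
      using P.integrable_snd[OF HI] unfolding H_def integral_mult_left_zero integral_exp_gauss_scaled[OF c] K_def .
    from lborel_pair.integral_fst'[OF this, symmetric] show ?thesis by (simp only: fst_conv snd_conv)
  qed
  also have "\<dots> = (\<integral>x. complex_of_real K * (f x * (\<integral>z. cnj (f (x + c *\<^sub>R z)) * complex_of_real (gauss z) \<partial>lborel)) \<partial>lborel)"
  proof (intro Bochner_Integration.integral_cong refl)
    fix x
    have "(\<integral>y. complex_of_real (K * gauss ((x - y) /\<^sub>R c) / c ^ DIM('a)) * F (x, y) \<partial>lborel)
      = complex_of_real (\<bar>c\<bar> ^ DIM('a)) * (\<integral>z. complex_of_real (K * gauss ((x - (x + c *\<^sub>R z)) /\<^sub>R c) / c ^ DIM('a)) * F (x, x + c *\<^sub>R z) \<partial>lborel)"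
      using c by (intro lborel_integral_affine) (auto simp: F_def)
    also have "\<dots> = (\<integral>z. complex_of_real (\<bar>c\<bar> ^ DIM('a)) * (complex_of_real (K * gauss ((x - (x + c *\<^sub>R z)) /\<^sub>R c) / c ^ DIM('a)) * F (x, x + c *\<^sub>R z)) \<partial>lborel)"
      by (rule integral_mult_right_zero[symmetric])
    also have "\<dots> = (\<integral>z. complex_of_real K * (f x * (cnj (f (x + c *\<^sub>R z)) * complex_of_real (gauss z))) \<partial>lborel)"
      using c by (intro Bochner_Integration.integral_cong refl) (simp add: F_def gauss_def)
    also have "\<dots> = complex_of_real K * (f x * (\<integral>z. cnj (f (x + c *\<^sub>R z)) * complex_of_real (gauss z) \<partial>lborel))"
      by (simp only: integral_mult_right_zero)
    finally show "(\<integral>y. complex_of_real (K * gauss ((x - y) /\<^sub>R c) / c ^ DIM('a)) * F (x, y) \<partial>lborel)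
      = complex_of_real K * (f x * (\<integral>z. cnj (f (x + c *\<^sub>R z)) * complex_of_real (gauss z) \<partial>lborel))" .
  qed
  also have "\<dots> = complex_of_real K * (\<integral>x. f x * (\<integral>z. cnj (f (x + c *\<^sub>R z)) * complex_of_real (gauss z) \<partial>lborel) \<partial>lborel)"
    by (rule integral_mult_right_zero)
  finally show ?thesis unfolding K_def .
qed

section \<open>Plancherel's theorem\<close>

text \<open>Covers the non-integrable case through the default value 0 of the integral, so that
  inner integrals can be estimated before anything is known about their convergence.\<close>

lemma norm_integral_le_nn_integral:
  fixes f :: "'b \<Rightarrow> 'c::{banach, second_countable_topology}"
  shows "ennreal (norm (integral\<^sup>L M f)) \<le> (\<integral>\<^sup>+x. ennreal (norm (f x)) \<partial>M)"
  by (cases "integrable M f") (auto simp: integral_norm_bound_ennreal not_integrable_integral_eq)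

lemma gauss_scaled_tendsto:
  "(\<lambda>n. gauss (inverse (real (Suc n)) *\<^sub>R x)) \<longlonglongrightarrow> 1"
proof -
  have "(\<lambda>n. gauss (inverse (real (Suc n)) *\<^sub>R x)) \<longlonglongrightarrow> exp (- (norm (0 *\<^sub>R x))\<^sup>2 / 2)"
    unfolding gauss_def by (intro tendsto_intros LIMSEQ_inverse_real_of_nat) simp
  then show ?thesis by simp
qed

lemma integrable_fourier_sq_gauss:
  fixes f :: "'a::euclidean_space \<Rightarrow> complex"
  assumes f: "integrable lborel f" and c: "c > 0"
  shows "integrable lborel (\<lambda>\<xi>. (cmod (fourier f \<xi>))\<^sup>2 * gauss (c *\<^sub>R \<xi>))"
proof -
  have [measurable]: "f \<in> borel_measurable borel" using f by auto
  note [measurable] = fourier_measurable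
  define B where "B = (\<integral>x. cmod (f x) \<partial>lborel)"
  have "integrable lborel (\<lambda>\<xi>::'a. B\<^sup>2 * gauss (c *\<^sub>R \<xi>))"
    by (intro integrable_mult_right integrable_gauss_scaled c)
  then show ?thesis
  proof (rule Bochner_Integration.integrable_bound)
    show "AE \<xi> in lborel. norm ((cmod (fourier f \<xi>))\<^sup>2 * gauss (c *\<^sub>R \<xi>)) \<le> norm (B\<^sup>2 * gauss (c *\<^sub>R \<xi>))"
    proof (rule AE_I2)
      fix \<xi> :: 'a
      have "(cmod (fourier f \<xi>))\<^sup>2 \<le> B\<^sup>2"
        unfolding B_def by (intro power_mono norm_fourier_le f) simp
      then show "norm ((cmod (fourier f \<xi>))\<^sup>2 * gauss (c *\<^sub>R \<xi>)) \<le> norm (B\<^sup>2 * gauss (c *\<^sub>R \<xi>))"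
        using gauss_pos[of "c *\<^sub>R \<xi>"] by (simp add: abs_mult)
    qed
  qed measurable
qed

text \<open>In the identity \<open>fourier_sq_gauss\<close>, the product of |f(x)| and |f(x + cz)|
  is at most the mean of the two squares, and translation invariance gives both squares the same
  integral over x. What remains is the mass of the Gaussian times the constant of the identity, that
  is K * K. The bound does not depend on c; its right side may be infinite.\<close>

lemma fourier_sq_gauss_le:
  fixes f :: "'a::euclidean_space \<Rightarrow> complex"
  assumes f: "integrable lborel f" and c: "c > 0"
  shows "(\<integral>\<^sup>+\<xi>. ennreal ((cmod (fourier f \<xi>))\<^sup>2 * gauss (c *\<^sub>R \<xi>)) \<partial>lborel)
    \<le> ennreal ((2 * pi) ^ DIM('a)) * L2_sq lborel f"
proof -
  have [measurable]: "f \<in> borel_measurable borel" using f by auto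
  define K where "K = sqrt (2 * pi) ^ DIM('a)"
  have K0: "0 \<le> K" by (simp add: K_def)
  have KK: "K * K = (2 * pi) ^ DIM('a)" unfolding K_def power_mult_distrib[symmetric] by simp
  define A where "A x = ennreal ((cmod (f x))\<^sup>2)" for x
  have [measurable]: "A \<in> borel_measurable borel" unfolding A_def by measurable
  have int: "integrable lborel (\<lambda>\<xi>. (cmod (fourier f \<xi>))\<^sup>2 * gauss (c *\<^sub>R \<xi>))"
    by (rule integrable_fourier_sq_gauss[OF f c])
  have nn: "0 \<le> (\<integral>\<xi>. (cmod (fourier f \<xi>))\<^sup>2 * gauss (c *\<^sub>R \<xi>) \<partial>lborel)"
    by (intro integral_nonneg_AE AE_I2 mult_nonneg_nonneg zero_le_power2 gauss_pos[THEN less_imp_le])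
  have pw: "ennreal (cmod (f x * (cnj (f (x + c *\<^sub>R z)) * complex_of_real (gauss z))))
      \<le> ennreal (gauss z / 2) * (A x + A (x + c *\<^sub>R z))" for x z
  proof -
    have "cmod (f x * (cnj (f (x + c *\<^sub>R z)) * complex_of_real (gauss z)))
        = (cmod (f x) * cmod (f (x + c *\<^sub>R z))) * gauss z"
      using gauss_pos[of z] by (simp add: norm_mult)
    also have "\<dots> \<le> (((cmod (f x))\<^sup>2 + (cmod (f (x + c *\<^sub>R z)))\<^sup>2) / 2) * gauss z"
      using gauss_pos[of z] sum_squares_bound[of "cmod (f x)" "cmod (f (x + c *\<^sub>R z))"]
      by (intro mult_right_mono) auto
    also have "\<dots> = (gauss z / 2) * ((cmod (f x))\<^sup>2 + (cmod (f (x + c *\<^sub>R z)))\<^sup>2)"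
      by simp
    finally show ?thesis
      using gauss_pos[of z] ennreal_mult[of "gauss z / 2" "(cmod (f x))\<^sup>2 + (cmod (f (x + c *\<^sub>R z)))\<^sup>2"]
        ennreal_plus[of "(cmod (f x))\<^sup>2" "(cmod (f (x + c *\<^sub>R z)))\<^sup>2"]
      unfolding A_def by (metis ennreal_leI add_nonneg_nonneg less_imp_le half_gt_zero zero_le_power2)
  qed
  have "(\<integral>\<^sup>+\<xi>. ennreal ((cmod (fourier f \<xi>))\<^sup>2 * gauss (c *\<^sub>R \<xi>)) \<partial>lborel)
      = ennreal (\<integral>\<xi>. (cmod (fourier f \<xi>))\<^sup>2 * gauss (c *\<^sub>R \<xi>) \<partial>lborel)"
    by (intro nn_integral_eq_integral int AE_I2 mult_nonneg_nonneg zero_le_power2 gauss_pos[THEN less_imp_le])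
  also have "(\<integral>\<xi>. (cmod (fourier f \<xi>))\<^sup>2 * gauss (c *\<^sub>R \<xi>) \<partial>lborel)
      = cmod (complex_of_real (\<integral>\<xi>. (cmod (fourier f \<xi>))\<^sup>2 * gauss (c *\<^sub>R \<xi>) \<partial>lborel))"
    using nn unfolding norm_of_real by (rule abs_of_nonneg[symmetric])
  also have "complex_of_real (\<integral>\<xi>. (cmod (fourier f \<xi>))\<^sup>2 * gauss (c *\<^sub>R \<xi>) \<partial>lborel)
      = (\<integral>\<xi>. complex_of_real ((cmod (fourier f \<xi>))\<^sup>2 * gauss (c *\<^sub>R \<xi>)) \<partial>lborel)"
    by (rule integral_complex_of_real[symmetric])
  also have "\<dots> = complex_of_real K *
      (\<integral>x. f x * (\<integral>z. cnj (f (x + c *\<^sub>R z)) * complex_of_real (gauss z) \<partial>lborel) \<partial>lborel)"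
    unfolding K_def by (rule fourier_sq_gauss[OF f c])
  also have "cmod \<dots> = K * cmod (\<integral>x. f x * (\<integral>z. cnj (f (x + c *\<^sub>R z)) * complex_of_real (gauss z) \<partial>lborel) \<partial>lborel)"
    using K0 by (simp add: norm_mult)
  also have "ennreal \<dots> = ennreal K * ennreal (cmod (\<integral>x. f x * (\<integral>z. cnj (f (x + c *\<^sub>R z)) * complex_of_real (gauss z) \<partial>lborel) \<partial>lborel))"
    using K0 by (simp add: ennreal_mult)
  also have "\<dots> \<le> ennreal K * (\<integral>\<^sup>+x. ennreal (cmod (f x * (\<integral>z. cnj (f (x + c *\<^sub>R z)) * complex_of_real (gauss z) \<partial>lborel))) \<partial>lborel)"
    by (intro mult_left_mono norm_integral_le_nn_integral) simp
  also have "\<dots> \<le> ennreal K * (\<integral>\<^sup>+x. (\<integral>\<^sup>+z. ennreal (gauss z / 2) * (A x + A (x + c *\<^sub>R z)) \<partial>lborel) \<partial>lborel)"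
  proof (intro mult_left_mono nn_integral_mono)
    fix x
    have "ennreal (cmod (f x * (\<integral>z. cnj (f (x + c *\<^sub>R z)) * complex_of_real (gauss z) \<partial>lborel)))
      = ennreal (cmod (\<integral>z. f x * (cnj (f (x + c *\<^sub>R z)) * complex_of_real (gauss z)) \<partial>lborel))"
      by (simp only: integral_mult_right_zero)
    also have "\<dots> \<le> (\<integral>\<^sup>+z. ennreal (cmod (f x * (cnj (f (x + c *\<^sub>R z)) * complex_of_real (gauss z)))) \<partial>lborel)"
      by (rule norm_integral_le_nn_integral)
    also have "\<dots> \<le> (\<integral>\<^sup>+z. ennreal (gauss z / 2) * (A x + A (x + c *\<^sub>R z)) \<partial>lborel)"
      by (intro nn_integral_mono pw)
    finally show "ennreal (cmod (f x * (\<integral>z. cnj (f (x + c *\<^sub>R z)) * complex_of_real (gauss z) \<partial>lborel)))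
      \<le> (\<integral>\<^sup>+z. ennreal (gauss z / 2) * (A x + A (x + c *\<^sub>R z)) \<partial>lborel)" .
  qed simp
  also have "(\<integral>\<^sup>+x. (\<integral>\<^sup>+z. ennreal (gauss z / 2) * (A x + A (x + c *\<^sub>R z)) \<partial>lborel) \<partial>lborel)
      = (\<integral>\<^sup>+z. (\<integral>\<^sup>+x. ennreal (gauss z / 2) * (A x + A (x + c *\<^sub>R z)) \<partial>lborel) \<partial>lborel)"
    by (rule lborel_pair.Fubini') measurable
  also have "\<dots> = (\<integral>\<^sup>+z. ennreal (gauss (z::'a) / 2) * (2 * L2_sq lborel f) \<partial>lborel)"
  proof (rule nn_integral_cong)
    fix z :: 'a
    have "(\<integral>\<^sup>+x. ennreal (gauss z / 2) * (A x + A (x + c *\<^sub>R z)) \<partial>lborel)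
      = ennreal (gauss z / 2) * ((\<integral>\<^sup>+x. A x \<partial>lborel) + (\<integral>\<^sup>+x. A (x + c *\<^sub>R z) \<partial>lborel))"
      by (subst nn_integral_cmult, measurable) (simp add: nn_integral_add)
    also have "(\<integral>\<^sup>+x. A (x + c *\<^sub>R z) \<partial>lborel) = (\<integral>\<^sup>+x. A x \<partial>lborel)"
      by (rule nn_integral_lborel_translate) measurable
    also have "(\<integral>\<^sup>+x. A x \<partial>lborel) = L2_sq lborel f" by (simp add: L2_sq_def A_def)
    finally show "(\<integral>\<^sup>+x. ennreal (gauss z / 2) * (A x + A (x + c *\<^sub>R z)) \<partial>lborel) = ennreal (gauss z / 2) * (2 * L2_sq lborel f)"
      by (simp add: mult_2)
  qed
  also have "\<dots> = (\<integral>\<^sup>+z. ennreal (gauss (z::'a) / 2) \<partial>lborel) * (2 * L2_sq lborel f)"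
    by (rule nn_integral_multc) measurable
  also have "(\<integral>\<^sup>+z. ennreal (gauss (z::'a) / 2) \<partial>lborel) = ennreal (K / 2)"
  proof -
    have "(\<integral>\<^sup>+z. ennreal (gauss (z::'a) / 2) \<partial>lborel) = ennreal (\<integral>z. gauss (z::'a) / 2 \<partial>lborel)"
      by (intro nn_integral_eq_integral AE_I2 integrable_divide integrable_gauss divide_nonneg_nonneg
          gauss_pos[THEN less_imp_le]) simp
    then show ?thesis by (simp add: integral_gauss K_def)
  qed
  also have "ennreal K * (ennreal (K / 2) * (2 * L2_sq lborel f)) = ennreal (K * (K / 2) * 2) * L2_sq lborel f"
  proof -
    have "ennreal (K * (K / 2) * 2) = ennreal K * ennreal (K / 2) * ennreal 2"
      using K0 ennreal_mult[of "K * (K / 2)" 2] ennreal_mult[of K "K / 2"]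
      by (simp only: mult_nonneg_nonneg divide_nonneg_nonneg zero_le_numeral)
    also have "ennreal 2 = (2::ennreal)" by simp
    finally show ?thesis by (simp only: mult.assoc)
  qed
  also have "K * (K / 2) * 2 = (2 * pi) ^ DIM('a)" using KK by simp
  finally show ?thesis .
qed

text \<open>Fatou's lemma removes the Gaussian, because the regularized bound is uniform in c. The
  square integrability of \<open>fourier f\<close> obtained in this way is what later permits
  dominated convergence and hence equality.\<close>

lemma L2_sq_fourier_le:
  fixes f :: "'a::euclidean_space \<Rightarrow> complex"
  assumes f: "integrable lborel f"
  shows "L2_sq lborel (fourier f) \<le> ennreal ((2 * pi) ^ DIM('a)) * L2_sq lborel f"
proof -
  have [measurable]: "fourier f \<in> borel_measurable borel" using f by (intro fourier_measurable) auto
  have "ennreal ((cmod (fourier f \<xi>))\<^sup>2)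
      = liminf (\<lambda>n. ennreal ((cmod (fourier f \<xi>))\<^sup>2 * gauss (inverse (real (Suc n)) *\<^sub>R \<xi>)))" for \<xi>
  proof -
    have "(\<lambda>n. (cmod (fourier f \<xi>))\<^sup>2 * gauss (inverse (real (Suc n)) *\<^sub>R \<xi>)) \<longlonglongrightarrow> (cmod (fourier f \<xi>))\<^sup>2 * 1"
      by (intro tendsto_mult tendsto_const gauss_scaled_tendsto)
    then have "(\<lambda>n. ennreal ((cmod (fourier f \<xi>))\<^sup>2 * gauss (inverse (real (Suc n)) *\<^sub>R \<xi>))) \<longlonglongrightarrow> ennreal ((cmod (fourier f \<xi>))\<^sup>2)"
      by (intro tendsto_ennrealI) simp
    then show ?thesis by (intro lim_imp_Liminf[symmetric]) auto
  qed
  then have "L2_sq lborel (fourier f)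
      = (\<integral>\<^sup>+\<xi>. liminf (\<lambda>n. ennreal ((cmod (fourier f \<xi>))\<^sup>2 * gauss (inverse (real (Suc n)) *\<^sub>R \<xi>))) \<partial>lborel)"
    unfolding L2_sq_def by simp
  also have "\<dots> \<le> liminf (\<lambda>n. \<integral>\<^sup>+\<xi>. ennreal ((cmod (fourier f \<xi>))\<^sup>2 * gauss (inverse (real (Suc n)) *\<^sub>R \<xi>)) \<partial>lborel)"
    by (rule nn_integral_liminf) measurable
  also have "\<dots> \<le> limsup (\<lambda>n. \<integral>\<^sup>+\<xi>. ennreal ((cmod (fourier f \<xi>))\<^sup>2 * gauss (inverse (real (Suc n)) *\<^sub>R \<xi>)) \<partial>lborel)"
    by (rule Liminf_le_Limsup) simp
  also have "\<dots> \<le> ennreal ((2 * pi) ^ DIM('a)) * L2_sq lborel f"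
    by (intro Limsup_bounded always_eventually allI fourier_sq_gauss_le f) simp
  finally show ?thesis .
qed

definition L1_L2 :: "'b measure \<Rightarrow> ('b \<Rightarrow> complex) set" where
  "L1_L2 M = {f \<in> L2_fun M. integrable M f}"

lemma L1_L2_diff: "f \<in> L1_L2 M \<Longrightarrow> g \<in> L1_L2 M \<Longrightarrow> (\<lambda>x. f x - g x) \<in> L1_L2 M"
  by (auto simp: L1_L2_def intro: L2_fun_diff)

lemma L1_L2_D: "f \<in> L1_L2 M \<Longrightarrow> integrable M f" "f \<in> L1_L2 M \<Longrightarrow> f \<in> L2_fun M"
  by (auto simp: L1_L2_def)

lemma fourier_L2:
  assumes "f \<in> L1_L2 lborel"
  shows "fourier f \<in> L2_fun lborel"
proof -
  have "fourier f \<in> borel_measurable borel"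
    using assms by (intro fourier_measurable) (auto simp: L1_L2_def)
  moreover have "L2_sq lborel (fourier f) < \<infinity>"
    using L2_sq_fourier_le[OF L1_L2_D(1)[OF assms]] L1_L2_D(2)[OF assms]
    by (auto simp: L2_fun_iff ennreal_mult_less_top order_le_less_trans)
  ultimately show ?thesis by (simp add: L2_fun_iff)
qed


lemma L2_tendsto_dominated:
  fixes f :: "'b \<Rightarrow> 'c::euclidean_space"
  assumes [measurable]: "\<And>n. g n \<in> borel_measurable M" "f \<in> borel_measurable M"
    and w: "integrable M w"
    and bound: "\<And>n. AE x in M. (norm (g n x - f x))\<^sup>2 \<le> w x"
    and lim: "AE x in M. (\<lambda>n. g n x) \<longlonglongrightarrow> f x"
  shows "L2_tendsto M g f"
proof -
  have [measurable]: "w \<in> borel_measurable M" using w by auto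
  have "(\<lambda>n. \<integral>\<^sup>+x. ennreal ((norm (g n x - f x))\<^sup>2) \<partial>M) \<longlonglongrightarrow> (\<integral>\<^sup>+x. 0 \<partial>M)"
  proof (rule nn_integral_dominated_convergence[where w = "\<lambda>x. ennreal (w x)"])
    show "AE x in M. ennreal ((norm (g n x - f x))\<^sup>2) \<le> ennreal (w x)" for n
      using bound[of n] by eventually_elim (rule ennreal_leI)
    have "(\<integral>\<^sup>+x. ennreal (w x) \<partial>M) \<le> (\<integral>\<^sup>+x. ennreal (norm (w x)) \<partial>M)"
      by (intro nn_integral_mono ennreal_leI) simp
    also have "\<dots> < \<infinity>" using w by (simp add: integrable_iff_bounded)
    finally show "(\<integral>\<^sup>+x. ennreal (w x) \<partial>M) < \<infinity>" .
    show "AE x in M. (\<lambda>n. ennreal ((norm (g n x - f x))\<^sup>2)) \<longlonglongrightarrow> 0"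
      using lim
    proof eventually_elim
      case (elim x)
      then have "(\<lambda>n. (norm (g n x - f x))\<^sup>2) \<longlonglongrightarrow> (norm (f x - f x))\<^sup>2"
        by (intro tendsto_intros)
      from tendsto_ennrealI[OF this] show ?case by simp
    qed
  qed measurable
  then show ?thesis by (simp add: L2_tendsto_def)
qed

definition plancherel_identity :: "('a::euclidean_space \<Rightarrow> complex) \<Rightarrow> bool" where
  "plancherel_identity f \<longleftrightarrow> L2_sq lborel (fourier f) = ennreal ((2 * pi) ^ DIM('a)) * L2_sq lborel f"

text \<open>Both sides of \<open>fourier_sq_gauss\<close> converge as c tends to 0. On the frequency
  side |f^|^2 is a majorant. On the space side continuity gives f(x + cz) \<longlonglongrightarrow>
  f(x) for every z, and boundedness gives the majorants B * gauss for the inner and |f| * B * K for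
  the outer integral.\<close>

lemma plancherel_bounded_continuous:
  fixes f :: "'a::euclidean_space \<Rightarrow> complex"
  assumes f: "f \<in> L1_L2 lborel" and cont: "continuous_on UNIV f" and B: "\<And>x. cmod (f x) \<le> B"
  shows "plancherel_identity f"
proof -
  have [measurable]: "f \<in> borel_measurable borel" using f by (auto simp: L1_L2_def)
  have B0: "0 \<le> B" using B[of 0] norm_ge_zero order_trans by blast
  have fi: "integrable lborel f" using f by (auto simp: L1_L2_def)
  define K where "K = sqrt (2 * pi) ^ DIM('a)"
  have K0: "0 \<le> K" by (simp add: K_def)
  have KK: "K * K = (2 * pi) ^ DIM('a)" unfolding K_def power_mult_distrib[symmetric] by simp
  define c where "c n = inverse (real (Suc n))" for n
  have c: "c n > 0" for n by (simp add: c_def)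
  have c0: "c \<longlonglongrightarrow> 0" unfolding c_def by (rule LIMSEQ_inverse_real_of_nat)
  note [measurable] = fourier_measurable
  have fhat: "integrable lborel (\<lambda>\<xi>. (cmod (fourier f \<xi>))\<^sup>2)"
    using fourier_L2[OF f] by (auto simp: L2_fun_def)
  have l1: "(\<lambda>n. \<integral>\<xi>. complex_of_real ((cmod (fourier f \<xi>))\<^sup>2 * gauss (c n *\<^sub>R \<xi>)) \<partial>lborel)
      \<longlonglongrightarrow> (\<integral>\<xi>. complex_of_real ((cmod (fourier f \<xi>))\<^sup>2) \<partial>lborel)"
  proof (rule integral_dominated_convergence[where w = "\<lambda>\<xi>. (cmod (fourier f \<xi>))\<^sup>2"])
    show "AE \<xi> in lborel. (\<lambda>n. complex_of_real ((cmod (fourier f \<xi>))\<^sup>2 * gauss (c n *\<^sub>R \<xi>)))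
        \<longlonglongrightarrow> complex_of_real ((cmod (fourier f \<xi>))\<^sup>2)"
    proof (rule AE_I2)
      fix \<xi> :: 'a
      have "(\<lambda>n. complex_of_real ((cmod (fourier f \<xi>))\<^sup>2 * gauss (c n *\<^sub>R \<xi>)))
        \<longlonglongrightarrow> complex_of_real ((cmod (fourier f \<xi>))\<^sup>2 * 1)"
        unfolding c_def by (intro tendsto_of_real tendsto_mult tendsto_const gauss_scaled_tendsto)
      then show "(\<lambda>n. complex_of_real ((cmod (fourier f \<xi>))\<^sup>2 * gauss (c n *\<^sub>R \<xi>)))
        \<longlonglongrightarrow> complex_of_real ((cmod (fourier f \<xi>))\<^sup>2)" by simp
    qed
    show "AE \<xi> in lborel. norm (complex_of_real ((cmod (fourier f \<xi>))\<^sup>2 * gauss (c n *\<^sub>R \<xi>))) \<le> (cmod (fourier f \<xi>))\<^sup>2" for n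
    proof (rule AE_I2)
      fix \<xi> :: 'a
      show "norm (complex_of_real ((cmod (fourier f \<xi>))\<^sup>2 * gauss (c n *\<^sub>R \<xi>))) \<le> (cmod (fourier f \<xi>))\<^sup>2"
        using gauss_pos[of "c n *\<^sub>R \<xi>"] gauss_le_1[of "c n *\<^sub>R \<xi>"]
        unfolding norm_of_real abs_mult by (simp add: mult_left_le)
    qed
  qed (use fhat in auto)
  define I where "I n x = (\<integral>z. cnj (f (x + c n *\<^sub>R z)) * complex_of_real (gauss z) \<partial>lborel)" for n x
  have Bg: "integrable lborel (\<lambda>z::'a. B * gauss z)" by (intro integrable_mult_right integrable_gauss)
  have pw: "norm (cnj (f y) * complex_of_real (gauss z)) \<le> B * gauss z" for y z
    using B[of y] gauss_pos[of z] by (simp add: norm_mult)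
  have [measurable]: "I n \<in> borel_measurable borel" for n
    unfolding I_def[abs_def] by measurable
  have I_lim: "(\<lambda>n. I n x) \<longlonglongrightarrow> cnj (f x) * complex_of_real K" for x
  proof -
    have "(\<lambda>n. I n x) \<longlonglongrightarrow> (\<integral>z. cnj (f x) * complex_of_real (gauss (z::'a)) \<partial>lborel)"
      unfolding I_def
    proof (rule integral_dominated_convergence[OF _ _ Bg])
      show "AE z in lborel. (\<lambda>n. cnj (f (x + c n *\<^sub>R z)) * complex_of_real (gauss z)) \<longlonglongrightarrow> cnj (f x) * complex_of_real (gauss z)"
      proof (rule AE_I2)
        fix z :: 'a
        have "(\<lambda>n. x + c n *\<^sub>R z) \<longlonglongrightarrow> x + 0 *\<^sub>R z" by (intro tendsto_intros c0)
        then have "(\<lambda>n. x + c n *\<^sub>R z) \<longlonglongrightarrow> x" by simp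
        moreover have "isCont f x" using cont by (simp add: continuous_on_eq_continuous_at)
        ultimately have "(\<lambda>n. f (x + c n *\<^sub>R z)) \<longlonglongrightarrow> f x" by (rule isCont_tendsto_compose[rotated])
        then show "(\<lambda>n. cnj (f (x + c n *\<^sub>R z)) * complex_of_real (gauss z)) \<longlonglongrightarrow> cnj (f x) * complex_of_real (gauss z)"
          by (intro tendsto_intros)
      qed
    qed (use pw in \<open>auto simp del: norm_mult\<close>)
    also have "(\<integral>z. cnj (f x) * complex_of_real (gauss (z::'a)) \<partial>lborel) = cnj (f x) * complex_of_real K"
      unfolding integral_mult_right_zero integral_complex_of_real integral_gauss K_def ..
    finally show ?thesis .
  qed
  have I_bound: "cmod (I n x) \<le> B * K" for n x
  proof -
    have "cmod (I n x) \<le> (\<integral>z. cmod (cnj (f (x + c n *\<^sub>R z)) * complex_of_real (gauss z)) \<partial>lborel)"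
      unfolding I_def by (rule integral_norm_bound)
    also have "\<dots> \<le> (\<integral>z. B * gauss (z::'a) \<partial>lborel)"
    proof (rule integral_mono[OF _ Bg pw])
      show "integrable lborel (\<lambda>z. cmod (cnj (f (x + c n *\<^sub>R z)) * complex_of_real (gauss z)))"
      proof (rule Bochner_Integration.integrable_bound[OF Bg])
        show "AE z in lborel. norm (cmod (cnj (f (x + c n *\<^sub>R z)) * complex_of_real (gauss z))) \<le> norm (B * gauss z)"
          unfolding real_norm_def abs_norm_cancel by (intro AE_I2 order_trans[OF pw abs_ge_self])
      qed measurable
    qed
    also have "\<dots> = B * K" by (simp add: integral_gauss K_def)
    finally show ?thesis .
  qed
  have l2: "(\<lambda>n. \<integral>x. f x * I n x \<partial>lborel) \<longlonglongrightarrow> (\<integral>x. f x * (cnj (f x) * complex_of_real K) \<partial>lborel)"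
  proof (rule integral_dominated_convergence[where w = "\<lambda>x. cmod (f x) * (B * K)"])
    show "AE x in lborel. (\<lambda>n. f x * I n x) \<longlonglongrightarrow> f x * (cnj (f x) * complex_of_real K)"
      by (intro AE_I2 tendsto_mult tendsto_const I_lim)
    show "AE x in lborel. norm (f x * I n x) \<le> cmod (f x) * (B * K)" for n
      unfolding norm_mult by (intro AE_I2 mult_left_mono I_bound) simp
  qed (use fi in auto)
  have "(\<integral>\<xi>. complex_of_real ((cmod (fourier f \<xi>))\<^sup>2) \<partial>lborel)
      = complex_of_real K * (\<integral>x. f x * (cnj (f x) * complex_of_real K) \<partial>lborel)"
  proof (rule LIMSEQ_unique[OF l1])
    show "(\<lambda>n. \<integral>\<xi>. complex_of_real ((cmod (fourier f \<xi>))\<^sup>2 * gauss (c n *\<^sub>R \<xi>)) \<partial>lborel)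
        \<longlonglongrightarrow> complex_of_real K * (\<integral>x. f x * (cnj (f x) * complex_of_real K) \<partial>lborel)"
      unfolding fourier_sq_gauss[OF fi c] I_def[symmetric] K_def[symmetric]
      by (intro tendsto_mult tendsto_const l2)
  qed
  \<comment> \<open>One factor K comes from the transform of the Gaussian, the other from its mass
    in the limit of \<open>I\<close>; together they make (2 \<pi>)^d.\<close>
  also have "\<dots> = complex_of_real (K * (K * (\<integral>x. (cmod (f x))\<^sup>2 \<partial>lborel)))"
    unfolding mult.assoc[symmetric] complex_norm_square[symmetric] integral_mult_left_zero integral_complex_of_real
    by simp
  finally have "(\<integral>\<xi>. (cmod (fourier f \<xi>))\<^sup>2 \<partial>lborel) = K * (K * (\<integral>x. (cmod (f x))\<^sup>2 \<partial>lborel))"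
    unfolding integral_complex_of_real of_real_eq_iff .
  then have "(\<integral>\<xi>. (cmod (fourier f \<xi>))\<^sup>2 \<partial>lborel) = (2 * pi) ^ DIM('a) * (\<integral>x. (cmod (f x))\<^sup>2 \<partial>lborel)"
    using KK by simp
  then show ?thesis
    unfolding plancherel_identity_def L2_sq_eq_integral[OF fourier_L2[OF f]] L2_sq_eq_integral[OF L1_L2_D(2)[OF f]]
    by (simp add: ennreal_mult)
qed

section \<open>Density: from bounded continuous functions to L1 and L2\<close>

lemma L2_sq_fourier_diff_le:
  fixes f g :: "'a::euclidean_space \<Rightarrow> complex"
  assumes "f \<in> L1_L2 lborel" "g \<in> L1_L2 lborel"
  shows "L2_sq lborel (\<lambda>\<xi>. fourier f \<xi> - fourier g \<xi>) \<le> ennreal ((2 * pi) ^ DIM('a)) * L2_sq lborel (\<lambda>x. f x - g x)"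
proof -
  have "fourier (\<lambda>x. f x - g x) = (\<lambda>\<xi>. fourier f \<xi> - fourier g \<xi>)"
    by (intro ext fourier_diff L1_L2_D assms)
  then show ?thesis
    using L2_sq_fourier_le[OF L1_L2_D(1)[OF L1_L2_diff[OF assms]]] by (simp only:)
qed

text \<open>The inequality, applied to differences, makes the Fourier transform continuous for the
  L2 distance; hence both sides of the identity pass to the limit. No convergence in L1 is
  required.\<close>

lemma plancherel_closed:
  fixes f :: "'a::euclidean_space \<Rightarrow> complex"
  assumes f: "f \<in> L1_L2 lborel" and g: "\<And>n. g n \<in> L1_L2 lborel" and lim: "L2_tendsto lborel g f"
    and id: "\<And>n. plancherel_identity (g n)"
  shows "plancherel_identity f"
proof -
  have "L2_tendsto lborel (\<lambda>n. fourier (g n)) (fourier f)"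
    unfolding L2_tendsto_iff
  proof (rule tendsto_sandwich[where f = "\<lambda>_. 0"])
    have "(\<lambda>n. ennreal ((2 * pi) ^ DIM('a)) * L2_sq lborel (\<lambda>x. g n x - f x)) \<longlonglongrightarrow> ennreal ((2 * pi) ^ DIM('a)) * 0"
      using lim unfolding L2_tendsto_iff by (intro ennreal_tendsto_cmult) auto
    then show "(\<lambda>n. ennreal ((2 * pi) ^ DIM('a)) * L2_sq lborel (\<lambda>x. g n x - f x)) \<longlonglongrightarrow> 0" by simp
    show "\<forall>\<^sub>F n in sequentially. L2_sq lborel (\<lambda>\<xi>. fourier (g n) \<xi> - fourier f \<xi>)
        \<le> ennreal ((2 * pi) ^ DIM('a)) * L2_sq lborel (\<lambda>x. g n x - f x)"
      by (intro always_eventually allI L2_sq_fourier_diff_le f g)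
  qed auto
  then have "(\<lambda>n. L2_sq lborel (fourier (g n))) \<longlonglongrightarrow> L2_sq lborel (fourier f)"
    by (intro L2_tendsto_sq fourier_L2 f g)
  moreover have "(\<lambda>n. L2_sq lborel (fourier (g n))) \<longlonglongrightarrow> ennreal ((2 * pi) ^ DIM('a)) * L2_sq lborel f"
    using id unfolding plancherel_identity_def
    by (auto intro!: ennreal_tendsto_cmult L2_tendsto_sq lim L1_L2_D f g)
  ultimately show ?thesis
    unfolding plancherel_identity_def by (rule LIMSEQ_unique)
qed


text \<open>The predicate \<open>measurable_on\<close> is by definition approximation by continuous
  functions off a negligible set, and it agrees with Lebesgue measurability; the completion of
  \<open>lborel\<close> has the same almost everywhere statements.\<close>

lemma AE_limit_of_continuous:
  fixes f :: "'a::euclidean_space \<Rightarrow> 'b::euclidean_space"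
  assumes "f \<in> borel_measurable borel"
  obtains g where "\<And>n. continuous_on UNIV (g n)" "AE x in lborel. (\<lambda>n. g n x) \<longlonglongrightarrow> f x"
proof -
  have "f \<in> borel_measurable lebesgue" using assms by (intro measurable_completion) simp
  then have "f measurable_on UNIV" by (intro lebesgue_measurable_imp_measurable_on) auto
  then obtain N g where N: "negligible N" and g: "\<And>n. continuous_on UNIV (g n)"
    and lim: "\<And>x. x \<notin> N \<Longrightarrow> (\<lambda>n. g n x) \<longlonglongrightarrow> f x"
    unfolding measurable_on_def by auto
  have "AE x in lebesgue. (\<lambda>n. g n x) \<longlonglongrightarrow> f x"
    using N lim by (intro AE_I'[of N]) (auto simp: negligible_iff_null_sets)
  then show ?thesis using g that unfolding AE_completion_iff by blast
qed

lemma L1_L2_bounded_support: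
  fixes f :: "'a::euclidean_space \<Rightarrow> complex"
  assumes [measurable]: "f \<in> borel_measurable borel" and B: "\<And>x. cmod (f x) \<le> B"
    and R: "\<And>x. norm x > R \<Longrightarrow> f x = 0"
  shows "f \<in> L1_L2 lborel"
proof -
  have B0: "0 \<le> B" using B[of 0] norm_ge_zero order_trans by blast
  have fin: "integrable lborel (\<lambda>x. b * indicator (cball (0::'a) R) x)" for b :: real
    using emeasure_lborel_cball_finite[of "0::'a" R] by (intro integrable_mult_right) (simp add: less_top)
  have "integrable lborel f"
  proof (rule Bochner_Integration.integrable_bound[OF fin])
    show "AE x in lborel. norm (f x) \<le> norm (B * indicator (cball 0 R) x)"
      using B R B0 by (intro AE_I2) (auto simp: indicator_def)
  qed simp
  moreover have "integrable lborel (\<lambda>x. (cmod (f x))\<^sup>2)"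
  proof (rule Bochner_Integration.integrable_bound[OF fin])
    show "AE x in lborel. norm ((cmod (f x))\<^sup>2) \<le> norm (B\<^sup>2 * indicator (cball 0 R) x)"
      using B R B0 by (intro AE_I2) (auto simp: indicator_def intro: power_mono)
  qed simp
  ultimately show ?thesis by (simp add: L1_L2_def L2_fun_def)
qed

lemma plancherel_bounded_support:
  fixes f :: "'a::euclidean_space \<Rightarrow> complex"
  assumes f[measurable]: "f \<in> borel_measurable borel" and B: "\<And>x. cmod (f x) \<le> B"
    and R: "\<And>x. norm x > R \<Longrightarrow> f x = 0" and B1: "0 < B"
  shows "plancherel_identity f"
proof -
  obtain g where g: "\<And>n. continuous_on UNIV (g n)" and lim: "AE x in lborel. (\<lambda>n. g n x) \<longlonglongrightarrow> f x"
    using AE_limit_of_continuous[OF f] by blast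
  \<comment> \<open>The approximants have no uniform bound or common support. The continuous cutoff
    \<open>cut\<close> is 1 on the ball of radius R and 0 outside radius R + 1, and the factor B /
    max B |g| shrinks values to modulus at most B. Neither operation changes the limit, since
    \<open>f\<close> already obeys both restrictions.\<close>
  define cut where "cut x = max 0 (min 1 (R + 1 - norm x))" for x :: 'a
  define h where "h n x = (cut x * (B / max B (norm (g n x)))) *\<^sub>R g n x" for n x
  have mx: "max B r > 0" for r using B1 by (simp add: less_max_iff_disj)
  have cont: "continuous_on UNIV (h n)" for n
    unfolding h_def cut_def using mx by (intro continuous_intros g) (auto simp: less_imp_neq[symmetric])
  then have [measurable]: "h n \<in> borel_measurable borel" for n by (rule borel_measurable_continuous_onI)
  have hB: "cmod (h n x) \<le> B" for n x
  proof -
    have "cmod (h n x) = cut x * (B * (norm (g n x) / max B (norm (g n x))))"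
      using mx[of "norm (g n x)"] B1 by (simp add: h_def cut_def abs_mult)
    also have "\<dots> \<le> 1 * (B * 1)"
      using mx[of "norm (g n x)"] B1 by (intro mult_mono mult_left_mono) (auto simp: cut_def divide_le_eq)
    finally show ?thesis by simp
  qed
  have hR: "h n x = 0" if "norm x > R + 1" for n x using that by (simp add: h_def cut_def)
  have fL: "f \<in> L1_L2 lborel" and hL: "h n \<in> L1_L2 lborel" for n
    by (rule L1_L2_bounded_support[OF _ B R] L1_L2_bounded_support[OF _ hB hR]; (assumption | measurable))+
  have "L2_tendsto lborel h f"
  proof (rule L2_tendsto_dominated)
    show "integrable lborel (\<lambda>x. (2 * B)\<^sup>2 * indicator (cball (0::'a) (R + 1)) x)"
      using emeasure_lborel_cball_finite[of "0::'a" "R + 1"] by (intro integrable_mult_right) (simp add: less_top)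
    show "AE x in lborel. (norm (h n x - f x))\<^sup>2 \<le> (2 * B)\<^sup>2 * indicator (cball 0 (R + 1)) x" for n
    proof (rule AE_I2)
      fix x
      show "(norm (h n x - f x))\<^sup>2 \<le> (2 * B)\<^sup>2 * indicator (cball 0 (R + 1)) x"
      proof (cases "norm x \<le> R + 1")
        case True
        have "norm (h n x - f x) \<le> 2 * B"
          using norm_triangle_ineq4[of "h n x" "f x"] hB[of n x] B[of x] by simp
        then have "(norm (h n x - f x))\<^sup>2 \<le> (2 * B)\<^sup>2" by (intro power_mono) auto
        then show ?thesis using True by simp
      qed (simp add: hR R)
    qed
    show "AE x in lborel. (\<lambda>n. h n x) \<longlonglongrightarrow> f x"
      using lim
    proof eventually_elim
      case (elim x)
      have "(\<lambda>n. h n x) \<longlonglongrightarrow> (cut x * (B / max B (norm (f x)))) *\<^sub>R f x"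
        unfolding h_def using mx[of "norm (f x)"] by (intro tendsto_intros elim) auto
      also have "(cut x * (B / max B (norm (f x)))) *\<^sub>R f x = f x"
      proof (cases "norm x > R")
        case False
        then show ?thesis using B[of x] B1 by (simp add: cut_def max_absorb1)
      qed (simp add: R)
      finally show ?case .
    qed
  qed measurable
  then show ?thesis
    by (rule plancherel_closed[OF fL hL]) (rule plancherel_bounded_continuous[OF hL cont hB])
qed

theorem plancherel:
  fixes f :: "'a::euclidean_space \<Rightarrow> complex"
  assumes f: "f \<in> L1_L2 lborel"
  shows "L2_sq lborel (fourier f) = ennreal ((2 * pi) ^ DIM('a)) * L2_sq lborel f"
proof -
  have [measurable]: "f \<in> borel_measurable borel" using f by (auto simp: L1_L2_def)
  define g where "g n x = (if norm x \<le> real n \<and> cmod (f x) \<le> real n then f x else 0)" for n x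
  have [measurable]: "g n \<in> borel_measurable borel" for n unfolding g_def by measurable
  \<comment> \<open>The bound is \<open>real n + 1\<close> instead of \<open>real n\<close> because
    a positive bound is required, also for n = 0.\<close>
  have gB: "cmod (g n x) \<le> real n + 1" and gR: "norm x > real n \<Longrightarrow> g n x = 0" for n x
    by (auto simp: g_def)
  have gL: "g n \<in> L1_L2 lborel" for n
    by (rule L1_L2_bounded_support[OF _ gB gR]; (assumption | measurable))
  have "plancherel_identity f"
  proof (rule plancherel_closed[OF f gL])
    show "L2_tendsto lborel g f"
    proof (rule L2_tendsto_dominated)
      show "integrable lborel (\<lambda>x. (cmod (f x))\<^sup>2)" using L1_L2_D(2)[OF f] by (simp add: L2_fun_def)
      show "AE x in lborel. (norm (g n x - f x))\<^sup>2 \<le> (cmod (f x))\<^sup>2" for n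
        by (intro AE_I2) (simp add: g_def)
      show "AE x in lborel. (\<lambda>n. g n x) \<longlonglongrightarrow> f x"
      proof (rule AE_I2)
        fix x
        have "\<forall>\<^sub>F n in sequentially. g n x = f x"
          using eventually_ge_at_top[of "nat \<lceil>max (norm x) (cmod (f x))\<rceil>"]
        proof eventually_elim
          case (elim n)
          then have "max (norm x) (cmod (f x)) \<le> real n" by linarith
          then show ?case by (simp add: g_def)
        qed
        then show "(\<lambda>n. g n x) \<longlonglongrightarrow> f x" by (rule tendsto_eventually)
      qed
    qed measurable
    show "plancherel_identity (g n)" for n
      by (rule plancherel_bounded_support[OF _ gB gR]) auto
  qed
  then show ?thesis by (simp add: plancherel_identity_def)
qed

section \<open>Isometry of the noise\<close>

lemma L2_tendsto_diff:
  assumes [measurable]: "\<And>n. f n \<in> borel_measurable M" "\<And>n. g n \<in> borel_measurable M"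
    "f' \<in> borel_measurable M" "g' \<in> borel_measurable M"
    and lim: "L2_tendsto M f f'" "L2_tendsto M g g'"
  shows "L2_tendsto M (\<lambda>n x. f n x - g n x) (\<lambda>x. f' x - g' x)"
  unfolding L2_tendsto_iff
proof (rule tendsto_sandwich[where f = "\<lambda>_. 0"])
  have "(\<lambda>n. 2 * L2_sq M (\<lambda>x. f n x - f' x) + 2 * L2_sq M (\<lambda>x. g n x - g' x)) \<longlonglongrightarrow> 2 * 0 + 2 * 0"
    using lim unfolding L2_tendsto_iff by (intro tendsto_add ennreal_tendsto_cmult) auto
  then show "(\<lambda>n. 2 * L2_sq M (\<lambda>x. f n x - f' x) + 2 * L2_sq M (\<lambda>x. g n x - g' x)) \<longlonglongrightarrow> 0" by simp
  show "\<forall>\<^sub>F n in sequentially. L2_sq M (\<lambda>x. f n x - g n x - (f' x - g' x))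
      \<le> 2 * L2_sq M (\<lambda>x. f n x - f' x) + 2 * L2_sq M (\<lambda>x. g n x - g' x)"
  proof (intro always_eventually allI)
    fix n
    have "L2_sq M (\<lambda>x. (f n x - f' x) + - (g n x - g' x))
        \<le> 2 * L2_sq M (\<lambda>x. f n x - f' x) + 2 * L2_sq M (\<lambda>x. - (g n x - g' x))"
      by (rule L2_sq_add_le) measurable
    moreover have "(\<lambda>x. (f n x - f' x) + - (g n x - g' x)) = (\<lambda>x. f n x - g n x - (f' x - g' x))"
      by (auto simp: algebra_simps)
    ultimately show "L2_sq M (\<lambda>x. f n x - g n x - (f' x - g' x))
      \<le> 2 * L2_sq M (\<lambda>x. f n x - f' x) + 2 * L2_sq M (\<lambda>x. g n x - g' x)"
      unfolding L2_sq_minus by (simp only:)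
  qed
qed auto

lemma L2_tendsto_Cauchy:
  assumes [measurable]: "\<And>n. f n \<in> borel_measurable M" "g \<in> borel_measurable M"
    and lim: "L2_tendsto M f g" and e: "(0::real) < e"
  shows "\<exists>N. \<forall>m\<ge>N. \<forall>n\<ge>N. L2_sq M (\<lambda>x. f m x - f n x) \<le> ennreal e"
proof -
  have "\<forall>\<^sub>F n in sequentially. L2_sq M (\<lambda>x. f n x - g x) < ennreal (e / 4)"
    using lim e unfolding L2_tendsto_iff by (intro order_tendstoD) auto
  then obtain N where N: "\<And>n. n \<ge> N \<Longrightarrow> L2_sq M (\<lambda>x. f n x - g x) < ennreal (e / 4)"
    by (auto simp: eventually_sequentially)
  have "L2_sq M (\<lambda>x. f m x - f n x) \<le> ennreal e" if "m \<ge> N" "n \<ge> N" for m n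
  proof -
    have "L2_sq M (\<lambda>x. f m x - f n x) \<le> 2 * L2_sq M (\<lambda>x. f m x - g x) + 2 * L2_sq M (\<lambda>x. g x - f n x)"
      by (rule L2_sq_diff_triangle) measurable
    also have "\<dots> \<le> 2 * ennreal (e / 4) + 2 * ennreal (e / 4)"
      unfolding L2_sq_minus_commute[of M g] using N that by (intro add_mono mult_left_mono less_imp_le) auto
    also have "\<dots> = ennreal (2 * (e / 4)) + ennreal (2 * (e / 4))"
      using e by (subst (1 2) ennreal_mult) auto
    also have "\<dots> = ennreal (2 * (e / 4) + 2 * (e / 4))"
      using e by (subst ennreal_plus) auto
    finally show ?thesis by simp
  qed
  then show ?thesis by blast
qed

lemma L1_L2_dense:
  assumes h: "h \<in> L2_fun M"
  obtains k where "\<And>n. k n \<in> L1_L2 M" "L2_tendsto M k h"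
proof -
  have [measurable]: "h \<in> borel_measurable M" using h by (simp add: L2_fun_def)
  have hi: "integrable M (\<lambda>x. (cmod (h x))\<^sup>2)" using h by (simp add: L2_fun_def)
  \<comment> \<open>Discarding the small values of \<open>h\<close>: where |h| \<ge> 1/(n+1), |h| is
    at most (n+1) |h|^2, which is integrable. This works on an arbitrary measure space, with no
    exhaustion by sets of finite measure.\<close>
  define k where "k n x = (if real (Suc n) * cmod (h x) \<ge> 1 then h x else 0)" for n x
  have [measurable]: "k n \<in> borel_measurable M" for n unfolding k_def by measurable
  have "k n \<in> L1_L2 M" for n
  proof -
    have "integrable M (k n)"
    proof (rule Bochner_Integration.integrable_bound)
      show "integrable M (\<lambda>x. real (Suc n) * (cmod (h x))\<^sup>2)" using hi by simp
      show "AE x in M. norm (k n x) \<le> norm (real (Suc n) * (cmod (h x))\<^sup>2)"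
      proof (rule AE_I2)
        fix x
        have "1 * cmod (h x) \<le> (real (Suc n) * cmod (h x)) * cmod (h x)" if "real (Suc n) * cmod (h x) \<ge> 1"
          using that by (intro mult_right_mono) auto
        then show "norm (k n x) \<le> norm (real (Suc n) * (cmod (h x))\<^sup>2)"
          by (simp add: k_def power2_eq_square mult.assoc)
      qed
    qed simp
    moreover have "k n \<in> L2_fun M"
      by (rule L2_fun_bound[OF h]) (auto simp: k_def)
    ultimately show ?thesis by (simp add: L1_L2_def)
  qed
  moreover have "L2_tendsto M k h"
  proof (rule L2_tendsto_dominated)
    show "integrable M (\<lambda>x. (cmod (h x))\<^sup>2)" by (rule hi)
    show "AE x in M. (norm (k n x - h x))\<^sup>2 \<le> (cmod (h x))\<^sup>2" for n
      by (intro AE_I2) (simp add: k_def)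
    show "AE x in M. (\<lambda>n. k n x) \<longlonglongrightarrow> h x"
    proof (rule AE_I2)
      fix x
      show "(\<lambda>n. k n x) \<longlonglongrightarrow> h x"
      proof (cases "h x = 0")
        case False
        then obtain N where N: "1 < real N * cmod (h x)"
          using ex_less_of_nat_mult[of "cmod (h x)" 1] by auto
        have "\<forall>\<^sub>F n in sequentially. k n x = h x"
          using eventually_ge_at_top[of N]
        proof eventually_elim
          case (elim n)
          then have "real N * cmod (h x) \<le> real (Suc n) * cmod (h x)" by (intro mult_right_mono) auto
          then show ?case using N by (simp add: k_def)
        qed
        then show ?thesis by (rule tendsto_eventually)
      qed (simp add: k_def)
    qed
  qed measurable
  ultimately show ?thesis using that by blast
qed

section \<open>Plancherel's theorem in the spatial variable\<close>

lemma pair_sigma_finite_st: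
  "pair_sigma_finite (restrict_space lborel {0..} :: real measure) (lborel :: 'a::euclidean_space measure)"
  by (intro pair_sigma_finite.intro sigma_finite_measure_restrict_space) (auto intro: lborel.sigma_finite_measure_axioms)

lemma L2_sq_st:
  assumes "f \<in> borel_measurable st_measure"
  shows "L2_sq st_measure f = (\<integral>\<^sup>+s. L2_sq lborel (\<lambda>x. f (s, x)) \<partial>restrict_space lborel {0..})"
proof -
  have [measurable]: "f \<in> borel_measurable (restrict_space lborel {0..} \<Otimes>\<^sub>M lborel)"
    using assms by (simp add: st_measure_def)
  show ?thesis
    unfolding L2_sq_def st_measure_def by (rule lborel.nn_integral_fst[symmetric]) measurable
qed

lemma spatial_fourier_measurable:
  fixes k :: "real \<times> 'a::euclidean_space \<Rightarrow> complex"
  assumes "k \<in> borel_measurable st_measure"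
  shows "spatial_fourier k \<in> borel_measurable st_measure"
proof -
  have [measurable]: "k \<in> borel_measurable (restrict_space lborel {0..} \<Otimes>\<^sub>M lborel)"
    using assms by (simp add: st_measure_def)
  show ?thesis
    unfolding spatial_fourier_def fourier_def st_measure_def by measurable
qed

lemma L1_L2_st_AE_slice:
  fixes k :: "real \<times> 'a::euclidean_space \<Rightarrow> complex"
  assumes k: "k \<in> L1_L2 st_measure"
  shows "AE s in restrict_space lborel {0..}. (\<lambda>x. k (s, x)) \<in> L1_L2 lborel"
proof -
  interpret pair_sigma_finite "restrict_space lborel {0..} :: real measure" "lborel :: 'a measure"
    by (rule pair_sigma_finite_st)
  have "integrable (restrict_space lborel {0..} \<Otimes>\<^sub>M lborel) k"
    "integrable (restrict_space lborel {0..} \<Otimes>\<^sub>M lborel) (\<lambda>z. (cmod (k z))\<^sup>2)"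
    using k by (auto simp: L1_L2_def L2_fun_def st_measure_def)
  from this[THEN AE_integrable_fst'] show ?thesis
    by eventually_elim (auto simp: L1_L2_def L2_fun_def)
qed

text \<open>Slices of an integrable function are integrable only for almost every time, and on the
  remaining times the integral defaults to 0, so \<open>spatial_fourier\<close> is not additive
  everywhere. Plancherel's theorem is therefore applied to the difference on each good slice; l = 0
  gives the identity for a single function.\<close>

lemma plancherel_spatial_diff:
  fixes k l :: "real \<times> 'a::euclidean_space \<Rightarrow> complex"
  assumes k: "k \<in> L1_L2 st_measure" and l: "l \<in> L1_L2 st_measure"
  shows "L2_sq st_measure (\<lambda>z. spatial_fourier k z - spatial_fourier l z)
    = ennreal ((2 * pi) ^ DIM('a)) * L2_sq st_measure (\<lambda>z. k z - l z)"
proof -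
  have kl[measurable]: "k \<in> borel_measurable st_measure" "l \<in> borel_measurable st_measure"
    using k l by (auto simp: L1_L2_def)
  note [measurable] = spatial_fourier_measurable
  have [measurable]: "k \<in> borel_measurable (restrict_space lborel {0..} \<Otimes>\<^sub>M lborel)"
    "l \<in> borel_measurable (restrict_space lborel {0..} \<Otimes>\<^sub>M lborel)"
    using kl by (simp_all add: st_measure_def)
  have "L2_sq st_measure (\<lambda>z. spatial_fourier k z - spatial_fourier l z)
      = (\<integral>\<^sup>+s. L2_sq lborel (\<lambda>\<xi>. spatial_fourier k (s, \<xi>) - spatial_fourier l (s, \<xi>)) \<partial>restrict_space lborel {0..})"
    by (rule L2_sq_st) measurable
  also have "\<dots> = (\<integral>\<^sup>+s. ennreal ((2 * pi) ^ DIM('a)) * L2_sq lborel (\<lambda>x. k (s, x) - l (s, x)) \<partial>restrict_space lborel {0..})"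
  proof (rule nn_integral_cong_AE)
    show "AE s in restrict_space lborel {0..}. L2_sq lborel (\<lambda>\<xi>. spatial_fourier k (s, \<xi>) - spatial_fourier l (s, \<xi>))
        = ennreal ((2 * pi) ^ DIM('a)) * L2_sq lborel (\<lambda>x. k (s, x) - l (s, x))"
      using L1_L2_st_AE_slice[OF k] L1_L2_st_AE_slice[OF l]
    proof eventually_elim
      case (elim s)
      have "fourier (\<lambda>x. k (s, x) - l (s, x)) = (\<lambda>\<xi>. spatial_fourier k (s, \<xi>) - spatial_fourier l (s, \<xi>))"
        unfolding spatial_fourier_def prod.case by (intro ext fourier_diff L1_L2_D elim)
      with plancherel[OF L1_L2_diff[OF elim]] show ?case by (simp only:)
    qed
  qed
  also have "\<dots> = ennreal ((2 * pi) ^ DIM('a)) * (\<integral>\<^sup>+s. L2_sq lborel (\<lambda>x. k (s, x) - l (s, x)) \<partial>restrict_space lborel {0..})"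
    unfolding L2_sq_def by (rule nn_integral_cmult) measurable
  also have "(\<integral>\<^sup>+s. L2_sq lborel (\<lambda>x. k (s, x) - l (s, x)) \<partial>restrict_space lborel {0..}) = L2_sq st_measure (\<lambda>z. k z - l z)"
    by (rule L2_sq_st[symmetric]) measurable
  finally show ?thesis .
qed

lemma zero_L1_L2: "(\<lambda>_. 0) \<in> L1_L2 M"
  by (simp add: L1_L2_def L2_fun_def)

lemma spatial_fourier_0: "spatial_fourier (\<lambda>_. 0) = (\<lambda>_. 0)"
  by (simp add: spatial_fourier_def fourier_def fun_eq_iff)

lemma spatial_fourier_L2:
  fixes k :: "real \<times> 'a::euclidean_space \<Rightarrow> complex"
  assumes k: "k \<in> L1_L2 st_measure"
  shows "spatial_fourier k \<in> L2_fun st_measure"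
proof -
  have "spatial_fourier k \<in> borel_measurable st_measure"
    using k by (intro spatial_fourier_measurable) (auto simp: L1_L2_def)
  moreover have "L2_sq st_measure (spatial_fourier k) < \<infinity>"
    using plancherel_spatial_diff[OF k zero_L1_L2] L1_L2_D(2)[OF k]
    by (simp add: spatial_fourier_0 L2_fun_iff ennreal_mult_less_top)
  ultimately show ?thesis by (simp add: L2_fun_iff)
qed

lemma is_L2_spatial_fourier_exists:
  fixes h :: "real \<times> 'a::euclidean_space \<Rightarrow> complex"
  assumes h: "h \<in> L2_fun st_measure"
  shows "\<exists>g. is_L2_spatial_fourier h g"
proof -
  obtain k where k: "\<And>n. k n \<in> L1_L2 st_measure" and lim: "L2_tendsto st_measure k h"
    using L1_L2_dense[OF h] by blast
  have [measurable]: "\<And>n. k n \<in> borel_measurable st_measure" "h \<in> borel_measurable st_measure"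
    using k h by (auto simp: L1_L2_def L2_fun_def)
  have "\<exists>N. \<forall>m\<ge>N. \<forall>n\<ge>N. L2_sq st_measure (\<lambda>z. spatial_fourier (k m) z - spatial_fourier (k n) z) \<le> ennreal e"
    if e: "e > 0" for e
  proof -
    define C where "C = (2 * pi) ^ DIM('a)"
    have C: "C > 0" by (simp add: C_def)
    obtain N where N: "\<And>m n. m \<ge> N \<Longrightarrow> n \<ge> N \<Longrightarrow> L2_sq st_measure (\<lambda>z. k m z - k n z) \<le> ennreal (e / C)"
      using L2_tendsto_Cauchy[OF _ _ lim, of "e / C"] e C by auto
    have "L2_sq st_measure (\<lambda>z. spatial_fourier (k m) z - spatial_fourier (k n) z) \<le> ennreal e"
      if "m \<ge> N" "n \<ge> N" for m n
    proof -
      have "L2_sq st_measure (\<lambda>z. spatial_fourier (k m) z - spatial_fourier (k n) z) \<le> ennreal C * ennreal (e / C)"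
        unfolding plancherel_spatial_diff[OF k k] C_def[symmetric] by (intro mult_left_mono N that) simp
      also have "\<dots> = ennreal e" using C e by (subst ennreal_mult[symmetric]) auto
      finally show ?thesis .
    qed
    then show ?thesis by blast
  qed
  then obtain g where "g \<in> L2_fun st_measure" "L2_tendsto st_measure (\<lambda>n. spatial_fourier (k n)) g"
    using L2_complete[of "\<lambda>n. spatial_fourier (k n)" st_measure, OF spatial_fourier_L2[OF k]] by blast
  then show ?thesis
    using k lim by (auto simp: is_L2_spatial_fourier_def L1_L2_def)
qed

text \<open>For h = h' the right side vanishes, so any two candidates for the transform agree almost
  everywhere. This is why the unspecified choice in \<open>L2_spatial_fourier\<close> does no
  harm.\<close>

lemma is_L2_spatial_fourier_diff_isometry:
  fixes h h' :: "real \<times> 'a::euclidean_space \<Rightarrow> complex"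
  assumes h: "h \<in> L2_fun st_measure" and h': "h' \<in> L2_fun st_measure"
    and g: "is_L2_spatial_fourier h g" and g': "is_L2_spatial_fourier h' g'"
  shows "L2_sq st_measure (\<lambda>z. g z - g' z) = ennreal ((2 * pi) ^ DIM('a)) * L2_sq st_measure (\<lambda>z. h z - h' z)"
proof -
  obtain k where k: "\<And>n. k n \<in> L1_L2 st_measure" "L2_tendsto st_measure k h"
    "L2_tendsto st_measure (\<lambda>n. spatial_fourier (k n)) g" and gL: "g \<in> L2_fun st_measure"
    using g by (auto simp: is_L2_spatial_fourier_def L1_L2_def)
  obtain k' where k': "\<And>n. k' n \<in> L1_L2 st_measure" "L2_tendsto st_measure k' h'"
    "L2_tendsto st_measure (\<lambda>n. spatial_fourier (k' n)) g'" and g'L: "g' \<in> L2_fun st_measure"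
    using g' by (auto simp: is_L2_spatial_fourier_def L1_L2_def)
  have l1: "(\<lambda>n. L2_sq st_measure (\<lambda>z. spatial_fourier (k n) z - spatial_fourier (k' n) z)) \<longlonglongrightarrow> L2_sq st_measure (\<lambda>z. g z - g' z)"
    by (intro L2_tendsto_sq L2_tendsto_diff L2_fun_diff L2_fun_measurable spatial_fourier_L2 k k' gL g'L)
  have "(\<lambda>n. L2_sq st_measure (\<lambda>z. k n z - k' n z)) \<longlonglongrightarrow> L2_sq st_measure (\<lambda>z. h z - h' z)"
    by (intro L2_tendsto_sq L2_tendsto_diff L2_fun_diff L2_fun_measurable L1_L2_D(2) k k' h h')
  then have "(\<lambda>n. ennreal ((2 * pi) ^ DIM('a)) * L2_sq st_measure (\<lambda>z. k n z - k' n z))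
      \<longlonglongrightarrow> ennreal ((2 * pi) ^ DIM('a)) * L2_sq st_measure (\<lambda>z. h z - h' z)"
    by (intro ennreal_tendsto_cmult) auto
  with l1 show ?thesis
    unfolding plancherel_spatial_diff[OF k(1) k'(1)] by (rule LIMSEQ_unique)
qed

lemma is_L2_spatial_fourier_0: "is_L2_spatial_fourier (\<lambda>_. 0) (\<lambda>_. 0)"
  unfolding is_L2_spatial_fourier_def
  by (auto simp: spatial_fourier_0 L2_tendsto_def L2_fun_def intro!: exI[of _ "\<lambda>_ _. 0"])

lemma is_L2_spatial_fourier_SOME:
  "h \<in> L2_fun st_measure \<Longrightarrow> is_L2_spatial_fourier h (L2_spatial_fourier h)"
  unfolding L2_spatial_fourier_def by (rule someI_ex[OF is_L2_spatial_fourier_exists])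

lemma L2_spatial_fourier_L2:
  "h \<in> L2_fun st_measure \<Longrightarrow> L2_spatial_fourier h \<in> L2_fun st_measure"
  using is_L2_spatial_fourier_SOME by (auto simp: is_L2_spatial_fourier_def)

lemma L2_spatial_fourier_diff_isometry:
  fixes h h' :: "real \<times> 'a::euclidean_space \<Rightarrow> complex"
  assumes "h \<in> L2_fun st_measure" "h' \<in> L2_fun st_measure"
  shows "L2_sq st_measure (\<lambda>z. L2_spatial_fourier h z - L2_spatial_fourier h' z)
    = ennreal ((2 * pi) ^ DIM('a)) * L2_sq st_measure (\<lambda>z. h z - h' z)"
  by (intro is_L2_spatial_fourier_diff_isometry is_L2_spatial_fourier_SOME assms)

lemma L2_spatial_fourier_isometry:
  fixes h :: "real \<times> 'a::euclidean_space \<Rightarrow> complex"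
  assumes h: "h \<in> L2_fun st_measure"
  shows "L2_sq st_measure (L2_spatial_fourier h) = ennreal ((2 * pi) ^ DIM('a)) * L2_sq st_measure h"
  using is_L2_spatial_fourier_diff_isometry[OF h L1_L2_D(2)[OF zero_L1_L2] is_L2_spatial_fourier_SOME[OF h] is_L2_spatial_fourier_0]
  by simp


section \<open>Isometry of the complex Wiener integral and of the transformed noise\<close>

lemma borel_measurable_Complex[measurable (raw)]:
  assumes [measurable]: "u \<in> borel_measurable M" "v \<in> borel_measurable M"
  shows "(\<lambda>x. Complex (u x) (v x)) \<in> borel_measurable M"
  unfolding Complex_eq by measurable

lemma L2_sq_Complex:
  assumes [measurable]: "u \<in> borel_measurable M" "v \<in> borel_measurable M"
  shows "L2_sq M (\<lambda>x. Complex (u x) (v x)) = L2_sq M u + L2_sq M v"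
  unfolding L2_sq_def
  by (simp add: nn_integral_add[symmetric] cmod_def ennreal_plus[symmetric] del: ennreal_plus)

lemma L2_sq_Re_Im:
  assumes [measurable]: "f \<in> borel_measurable M"
  shows "L2_sq M f = L2_sq M (\<lambda>x. Re (f x)) + L2_sq M (\<lambda>x. Im (f x))"
  using L2_sq_Complex[of "\<lambda>x. Re (f x)" M "\<lambda>x. Im (f x)"] by simp

lemma L2_fun_Re: "f \<in> L2_fun M \<Longrightarrow> (\<lambda>x. Re (f x)) \<in> L2_fun M"
  by (rule L2_fun_bound[where g = "\<lambda>x. f x"]) (auto simp: L2_fun_def abs_Re_le_cmod)

lemma L2_fun_Im: "f \<in> L2_fun M \<Longrightarrow> (\<lambda>x. Im (f x)) \<in> L2_fun M"
  by (rule L2_fun_bound[where g = "\<lambda>x. f x"]) (auto simp: L2_fun_def abs_Im_le_cmod)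

lemma L2_fun_mult_integrable:
  fixes f g :: "'b \<Rightarrow> real"
  assumes f: "f \<in> L2_fun M" and g: "g \<in> L2_fun M"
  shows "integrable M (\<lambda>x. f x * g x)"
proof (rule Bochner_Integration.integrable_bound)
  show "integrable M (\<lambda>x. (f x)\<^sup>2 + (g x)\<^sup>2)" using f g by (auto simp: L2_fun_def)
  show "(\<lambda>x. f x * g x) \<in> borel_measurable M" using f g by (auto simp: L2_fun_def)
  show "AE x in M. norm (f x * g x) \<le> norm ((f x)\<^sup>2 + (g x)\<^sup>2)"
  proof (rule AE_I2)
    fix x
    have "2 * (\<bar>f x\<bar> * \<bar>g x\<bar>) \<le> (f x)\<^sup>2 + (g x)\<^sup>2"
      using sum_squares_bound[of "\<bar>f x\<bar>" "\<bar>g x\<bar>"] by (simp add: mult.assoc)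
    moreover have "0 \<le> \<bar>f x\<bar> * \<bar>g x\<bar>" by simp
    moreover have "norm ((f x)\<^sup>2 + (g x)\<^sup>2) = (f x)\<^sup>2 + (g x)\<^sup>2" by simp
    ultimately show "norm (f x * g x) \<le> norm ((f x)\<^sup>2 + (g x)\<^sup>2)"
      unfolding real_norm_def abs_mult by linarith
  qed
qed

lemma L2_sq_diff_expand:
  fixes f g :: "'b \<Rightarrow> real"
  assumes f: "f \<in> L2_fun M" and g: "g \<in> L2_fun M"
  shows "L2_sq M (\<lambda>x. f x - g x)
    = ennreal ((\<integral>x. f x * f x \<partial>M) - 2 * (\<integral>x. f x * g x \<partial>M) + (\<integral>x. g x * g x \<partial>M))"
proof -
  have "(\<integral>x. (norm (f x - g x))\<^sup>2 \<partial>M) = (\<integral>x. (f x * f x - 2 * (f x * g x)) + g x * g x \<partial>M)"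
    by (intro Bochner_Integration.integral_cong refl) (simp add: power2_eq_square algebra_simps)
  also have "\<dots> = (\<integral>x. f x * f x \<partial>M) - 2 * (\<integral>x. f x * g x \<partial>M) + (\<integral>x. g x * g x \<partial>M)"
    using L2_fun_mult_integrable[OF f f] L2_fun_mult_integrable[OF f g] L2_fun_mult_integrable[OF g g] by simp
  finally show ?thesis unfolding L2_sq_eq_integral[OF L2_fun_diff[OF f g]] by simp
qed

text \<open>The covariance identity alone does not yield this, since a divergent integral has the
  default value 0. The Gaussian law of \<open>w h\<close>, obtained from the linear combination with
  the single term h, has a finite second moment.\<close>

lemma white_noise_L2:
  assumes w: "white_noise P w" and h: "h \<in> L2_fun st_measure"
  shows "w h \<in> L2_fun P"
proof -
  have [measurable]: "w h \<in> borel_measurable P" using w h by (auto simp: white_noise_def)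
  have "\<And>H c. finite H \<and> H \<subseteq> L2_fun st_measure \<Longrightarrow>
      \<exists>\<sigma>\<ge>0. distr P borel (\<lambda>\<omega>. \<Sum>h\<in>H. c h * w h \<omega>) = distr std_normal_distribution borel (\<lambda>x. \<sigma> * x)"
    using w unfolding white_noise_def by blast
  from this[of "{h}" "\<lambda>_. 1"] obtain \<sigma> where
    "distr P borel (\<lambda>\<omega>. \<Sum>k\<in>{h}. 1 * w k \<omega>) = distr std_normal_distribution borel (\<lambda>x. \<sigma> * x)"
    using h by auto
  then have eq: "distr P borel (w h) = distr std_normal_distribution borel (\<lambda>x. \<sigma> * x)" by simp
  have "integrable std_normal_distribution (\<lambda>x. (\<sigma> * x)\<^sup>2)"
    unfolding power_mult_distrib by (intro integrable_mult_right integrable_std_normal_distribution_moment)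
  then have "integrable (distr P borel (w h)) (\<lambda>x. x\<^sup>2)"
    unfolding eq by (subst integrable_distr_eq) auto
  then have "integrable P (\<lambda>\<omega>. (w h \<omega>)\<^sup>2)" by (subst (asm) integrable_distr_eq) auto
  then show ?thesis by (simp add: L2_fun_def)
qed

text \<open>Both squares expand into the same three inner products. This is the quantitative form of
  linearity: nothing is claimed about \<open>w\<close> at h - g.\<close>

lemma white_noise_diff_isometry:
  assumes w: "white_noise P w" and h: "h \<in> L2_fun st_measure" and g: "g \<in> L2_fun st_measure"
  shows "L2_sq P (\<lambda>\<omega>. w h \<omega> - w g \<omega>) = L2_sq st_measure (\<lambda>z. h z - g z)"
proof -
  have "(LINT \<omega>|P. w a \<omega> * w b \<omega>) = (LINT z|st_measure. a z * b z)"
    if "a \<in> L2_fun st_measure" "b \<in> L2_fun st_measure" for a b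
    using w that by (auto simp: white_noise_def)
  then show ?thesis
    unfolding L2_sq_diff_expand[OF white_noise_L2[OF w h] white_noise_L2[OF w g]] L2_sq_diff_expand[OF h g]
    using h g by (simp only:)
qed

lemma white_noise_isometry:
  assumes w: "white_noise P w" and h: "h \<in> L2_fun st_measure"
  shows "L2_sq P (w h) = L2_sq st_measure h"
proof -
  have "(LINT \<omega>|P. w h \<omega> * w h \<omega>) = (LINT z|st_measure. h z * h z)"
    using w h by (auto simp: white_noise_def)
  then show ?thesis
    unfolding L2_sq_eq_integral[OF white_noise_L2[OF w h]] L2_sq_eq_integral[OF h]
    by (simp add: power2_eq_square)
qed

lemma wiener_complex_L2:
  assumes w: "white_noise P w" and h: "h \<in> L2_fun st_measure"
  shows "wiener_complex w h \<in> L2_fun P"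
    and "L2_sq P (wiener_complex w h) = L2_sq st_measure h"
proof -
  have L: "w (\<lambda>z. Re (h z)) \<in> L2_fun P" "w (\<lambda>z. Im (h z)) \<in> L2_fun P"
    by (intro white_noise_L2[OF w] L2_fun_Re L2_fun_Im h)+
  note [measurable] = L[THEN L2_fun_measurable] L2_fun_measurable[OF h]
  have wc: "wiener_complex w h = (\<lambda>\<omega>. Complex (w (\<lambda>z. Re (h z)) \<omega>) (w (\<lambda>z. Im (h z)) \<omega>))"
    by (simp add: wiener_complex_def fun_eq_iff)
  show eq: "L2_sq P (wiener_complex w h) = L2_sq st_measure h"
    unfolding wc by (simp add: L2_sq_Complex L2_sq_Re_Im[of h] white_noise_isometry[OF w] L2_fun_Re L2_fun_Im h)
  show "wiener_complex w h \<in> L2_fun P"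
    using h unfolding L2_fun_iff eq by (simp add: wc)
qed

lemma wiener_complex_diff_isometry:
  assumes w: "white_noise P w" and h: "h \<in> L2_fun st_measure" and g: "g \<in> L2_fun st_measure"
  shows "L2_sq P (\<lambda>\<omega>. wiener_complex w h \<omega> - wiener_complex w g \<omega>) = L2_sq st_measure (\<lambda>z. h z - g z)"
proof -
  have L: "w (\<lambda>z. Re (h z)) \<in> L2_fun P" "w (\<lambda>z. Im (h z)) \<in> L2_fun P"
    "w (\<lambda>z. Re (g z)) \<in> L2_fun P" "w (\<lambda>z. Im (g z)) \<in> L2_fun P"
    by (intro white_noise_L2[OF w] L2_fun_Re L2_fun_Im h g)+
  note [measurable] = L[THEN L2_fun_measurable] L2_fun_measurable[OF h] L2_fun_measurable[OF g]
  have "L2_sq P (\<lambda>\<omega>. wiener_complex w h \<omega> - wiener_complex w g \<omega>)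
    = L2_sq P (\<lambda>\<omega>. Complex (w (\<lambda>z. Re (h z)) \<omega> - w (\<lambda>z. Re (g z)) \<omega>) (w (\<lambda>z. Im (h z)) \<omega> - w (\<lambda>z. Im (g z)) \<omega>))"
    by (simp add: wiener_complex_def complex_diff)
  also have "\<dots> = L2_sq P (\<lambda>\<omega>. w (\<lambda>z. Re (h z)) \<omega> - w (\<lambda>z. Re (g z)) \<omega>) + L2_sq P (\<lambda>\<omega>. w (\<lambda>z. Im (h z)) \<omega> - w (\<lambda>z. Im (g z)) \<omega>)"
    by (rule L2_sq_Complex) measurable
  also have "\<dots> = L2_sq st_measure (\<lambda>z. Re (h z) - Re (g z)) + L2_sq st_measure (\<lambda>z. Im (h z) - Im (g z))"
    by (simp only: white_noise_diff_isometry[OF w] L2_fun_Re L2_fun_Im h g)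
  also have "\<dots> = L2_sq st_measure (\<lambda>z. h z - g z)"
    by (subst L2_sq_Re_Im[of "\<lambda>z. h z - g z"]) simp_all
  finally show ?thesis .
qed

lemma two_pi_powr_sq: "(cmod (complex_of_real ((2 * pi) powr (- real d / 2))))\<^sup>2 = 1 / (2 * pi) ^ d"
proof -
  have "(cmod (complex_of_real ((2 * pi) powr (- real d / 2))))\<^sup>2 = (2 * pi) powr (- real d / 2) * (2 * pi) powr (- real d / 2)"
    by (simp add: power2_eq_square)
  also have "\<dots> = (2 * pi) powr (- real d)" by (simp add: powr_add[symmetric])
  also have "\<dots> = 1 / (2 * pi) ^ d"
    by (simp add: powr_minus_divide powr_realpow del: power_mult_distrib)
  finally show ?thesis .
qed

lemma two_pi_cancel: "ennreal (1 / (2 * pi) ^ d) * (ennreal ((2 * pi) ^ d) * x) = x"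
proof -
  have "ennreal (1 / (2 * pi) ^ d) * ennreal ((2 * pi) ^ d) = 1"
    by (subst ennreal_mult[symmetric]) auto
  then show ?thesis by (simp only: mult.assoc[symmetric] mult_1)
qed

lemma noise_hat_L2:
  fixes w :: "(real \<times> 'a::euclidean_space \<Rightarrow> real) \<Rightarrow> 'p \<Rightarrow> real"
  assumes w: "white_noise P w" and h: "h \<in> L2_fun st_measure"
  shows "noise_hat w h \<in> L2_fun P" and "L2_sq P (noise_hat w h) = L2_sq st_measure h"
proof -
  note W = wiener_complex_L2[OF w L2_spatial_fourier_L2[OF h]]
  show "noise_hat w h \<in> L2_fun P"
    unfolding noise_hat_def[abs_def] by (intro L2_fun_cmult W)
  show "L2_sq P (noise_hat w h) = L2_sq st_measure h"
    unfolding noise_hat_def[abs_def] L2_sq_cmult[OF L2_fun_measurable[OF W(1)]] W(2)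
      L2_spatial_fourier_isometry[OF h] two_pi_powr_sq two_pi_cancel ..
qed

lemma noise_hat_diff_isometry:
  fixes w :: "(real \<times> 'a::euclidean_space \<Rightarrow> real) \<Rightarrow> 'p \<Rightarrow> real"
  assumes w: "white_noise P w" and h: "h \<in> L2_fun st_measure" and g: "g \<in> L2_fun st_measure"
  shows "L2_sq P (\<lambda>\<omega>. noise_hat w h \<omega> - noise_hat w g \<omega>) = L2_sq st_measure (\<lambda>z. h z - g z)"
proof -
  note W = wiener_complex_L2(1)[OF w L2_spatial_fourier_L2[OF h]] wiener_complex_L2(1)[OF w L2_spatial_fourier_L2[OF g]]
  show ?thesis
    unfolding noise_hat_def right_diff_distrib[symmetric] L2_sq_cmult[OF L2_fun_measurable[OF L2_fun_diff[OF W]]]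
      wiener_complex_diff_isometry[OF w L2_spatial_fourier_L2[OF h] L2_spatial_fourier_L2[OF g]]
      L2_spatial_fourier_diff_isometry[OF h g] two_pi_powr_sq two_pi_cancel ..
qed

section \<open>The exponent and the wave propagator\<close>

text \<open>Symmetry makes the characteristic function of X(t) equal to its conjugate, hence real,
  for every t; a single t would fix the imaginary part of \<Psi> only up to multiples of \<pi>/t.
  Nonnegativity holds because characteristic functions are bounded by 1.\<close>

lemma symmetric_exponent_real:
  fixes X :: "real \<Rightarrow> 'o \<Rightarrow> 'a::euclidean_space"
  assumes levy: "levy_process M X" and sym: "symmetric_process M X"
    and ce: "characteristic_exponent M X \<Psi>"
  shows "Im (\<Psi> \<xi>) = 0" "0 \<le> Re (\<Psi> \<xi>)" "\<Psi> \<in> borel_measurable borel"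
proof -
  interpret prob_space M using levy by (simp add: levy_process_def)
  have X[measurable]: "X t \<in> borel_measurable M" if "t \<ge> 0" for t
    using levy that by (simp add: levy_process_def)
  have ch: "(LINT \<omega>|M. exp (\<i> * complex_of_real (\<xi> \<bullet> X t \<omega>))) = exp (- (complex_of_real t * \<Psi> \<xi>))"
    if "t \<ge> 0" for t \<xi>
    using ce that by (simp add: characteristic_exponent_def)
  have real: "Im (exp (- (complex_of_real t * \<Psi> \<xi>))) = 0" if t: "t \<ge> 0" for t \<xi>
  proof -
    note [measurable] = X[OF t]
    have "(LINT \<omega>|M. exp (\<i> * complex_of_real (\<xi> \<bullet> X t \<omega>)))
        = (LINT x|distr M borel (X t). exp (\<i> * complex_of_real (\<xi> \<bullet> x)))"
      by (subst integral_distr) auto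
    also have "\<dots> = (LINT x|distr M borel (\<lambda>\<omega>. - X t \<omega>). exp (\<i> * complex_of_real (\<xi> \<bullet> x)))"
      using sym t by (simp add: symmetric_process_def)
    also have "\<dots> = (LINT \<omega>|M. cnj (exp (\<i> * complex_of_real (\<xi> \<bullet> X t \<omega>))))"
      by (subst integral_distr) (auto simp: exp_cnj)
    also have "\<dots> = cnj (LINT \<omega>|M. exp (\<i> * complex_of_real (\<xi> \<bullet> X t \<omega>)))"
      by (rule Bochner_Integration.integral_cnj)
    finally have "exp (- (complex_of_real t * \<Psi> \<xi>)) = cnj (exp (- (complex_of_real t * \<Psi> \<xi>)))"
      unfolding ch[OF t] .
    then show ?thesis by (metis complex_is_Real_iff Reals_cnj_iff)
  qed
  show im: "Im (\<Psi> \<xi>) = 0" for \<xi>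
  proof (rule ccontr)
    define y where "y = Im (\<Psi> \<xi>)"
    assume "Im (\<Psi> \<xi>) \<noteq> 0"
    then have y: "y \<noteq> 0" by (simp add: y_def)
    \<comment> \<open>The time \<pi> / (2 |y|) moves a nonzero imaginary part to \<pi>/2 or
      -\<pi>/2, where the sine is 1 or -1.\<close>
    have "sin (pi / 2 / \<bar>y\<bar> * y) = 0"
      using real[of "pi / 2 / \<bar>y\<bar>" \<xi>] by (simp add: Im_exp y_def)
    moreover have "pi / 2 / \<bar>y\<bar> * y = pi / 2 \<or> pi / 2 / \<bar>y\<bar> * y = - (pi / 2)"
      using y by (cases "y > 0") (auto simp: abs_if)
    ultimately have "sin (pi / 2) = (0::real) \<or> sin (- (pi / 2)) = (0::real)" by metis
    then show False by simp
  qed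
  show "0 \<le> Re (\<Psi> \<xi>)" for \<xi>
  proof -
    have "exp (- Re (\<Psi> \<xi>)) = cmod (LINT \<omega>|M. exp (\<i> * complex_of_real (\<xi> \<bullet> X 1 \<omega>)))"
      using ch[of 1 \<xi>] by (simp add: norm_exp_eq_Re)
    also have "\<dots> \<le> (LINT \<omega>|M. cmod (exp (\<i> * complex_of_real (\<xi> \<bullet> X 1 \<omega>))))"
      by (rule integral_norm_bound)
    also have "\<dots> = 1" by (simp add: prob_space)
    finally show ?thesis by simp
  qed
  note [measurable] = X[of 1, simplified]
  \<comment> \<open>With \<Psi> real, the real logarithm recovers it from the characteristic
    function at time 1, a parameter integral that is measurable in \<xi>.\<close>
  have "Re (\<Psi> \<xi>) = - ln (Re (LINT \<omega>|M. exp (\<i> * complex_of_real (\<xi> \<bullet> X 1 \<omega>))))" for \<xi>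
    using ch[of 1 \<xi>] im[of \<xi>] by (simp add: Re_exp)
  then have "\<Psi> = (\<lambda>\<xi>. complex_of_real (- ln (Re (LINT \<omega>|M. exp (\<i> * complex_of_real (\<xi> \<bullet> X 1 \<omega>))))))"
    using im by (auto simp: fun_eq_iff complex_eq_iff)
  moreover have "(\<lambda>\<xi>. complex_of_real (- ln (Re (LINT \<omega>|M. exp (\<i> * complex_of_real (\<xi> \<bullet> X 1 \<omega>)))))) \<in> borel_measurable borel"
    by measurable
  ultimately show "\<Psi> \<in> borel_measurable borel" by simp
qed

section \<open>The propagator at a fixed frequency\<close>

definition real_wave :: "real \<Rightarrow> real \<Rightarrow> real" where
  "real_wave \<psi> r = (if \<psi> = 0 then r else sin (sqrt \<psi> * r) / sqrt \<psi>)"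

lemma wave_multiplier_real:
  assumes "Im z = 0" "0 \<le> Re z"
  shows "wave_multiplier z r = complex_of_real (real_wave (Re z) r)"
proof -
  have z: "z = complex_of_real (Re z)" using assms by (simp add: complex_eq_iff)
  have "csqrt z = complex_of_real (sqrt (Re z))"
    by (subst z, subst csqrt_of_real_nonneg) (use assms in auto)
  moreover have "z = 0 \<longleftrightarrow> Re z = 0" using assms by (simp add: complex_eq_iff)
  ultimately show ?thesis
    by (simp add: wave_multiplier_def real_wave_def sin_of_real[symmetric])
qed

lemma real_wave_measurable[measurable (raw)]:
  assumes [measurable]: "f \<in> borel_measurable M" "g \<in> borel_measurable M"
  shows "(\<lambda>x. real_wave (f x) (g x)) \<in> borel_measurable M"
  unfolding real_wave_def by measurable

text \<open>The two bounds t^2 and 1/\<psi> for the square m say m / t^2 \<le> 1 and m * \<psi>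
  \<le> 1. Adding them gives m * (1/t^2 + \<psi>) \<le> 2, which is the origin of the factor 2 in
  the upper bound.\<close>

lemma real_wave_sq_le:
  assumes \<psi>: "0 \<le> \<psi>" and r: "0 \<le> r" "r \<le> t" and t: "0 < t"
  shows "(real_wave \<psi> r)\<^sup>2 \<le> 2 / (1 / t\<^sup>2 + \<psi>)"
proof -
  have den: "0 < 1 / t\<^sup>2 + \<psi>" using t \<psi> by (simp add: add_pos_nonneg)
  have "\<bar>real_wave \<psi> r\<bar> \<le> r"
  proof (cases "\<psi> = 0")
    case False
    then have "0 < sqrt \<psi>" using \<psi> by simp
    moreover have "\<bar>sin (sqrt \<psi> * r)\<bar> \<le> sqrt \<psi> * r"
      using abs_sin_x_le_abs_x[of "sqrt \<psi> * r"] r \<psi> by (simp add: abs_mult)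
    ultimately show ?thesis using False by (simp add: real_wave_def abs_divide divide_le_eq mult.commute)
  qed (use r in \<open>simp add: real_wave_def\<close>)
  then have "\<bar>real_wave \<psi> r\<bar> \<le> t" using r by simp
  then have "(real_wave \<psi> r)\<^sup>2 \<le> t\<^sup>2" using power_mono[of "\<bar>real_wave \<psi> r\<bar>" t 2] by simp
  then have a: "(real_wave \<psi> r)\<^sup>2 * (1 / t\<^sup>2) \<le> 1" using t by (simp add: divide_le_eq)
  have b: "(real_wave \<psi> r)\<^sup>2 * \<psi> \<le> 1"
  proof (cases "\<psi> = 0")
    case False
    have "(sin (sqrt \<psi> * r))\<^sup>2 \<le> 1" by (simp add: abs_square_le_1)
    then show ?thesis using False \<psi> by (simp add: real_wave_def power_divide)
  qed simp
  have "(real_wave \<psi> r)\<^sup>2 * (1 / t\<^sup>2 + \<psi>) \<le> 2" using a b by (simp add: distrib_left)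
  then show ?thesis using den by (simp add: le_divide_eq)
qed

text \<open>For y > 2 the right side is at least 1. Near 0 its expansion y - y^3/8 + ... lies above
  y - y^3/6 + ..., and the Taylor polynomial of degree 4 with remainder y^5/120 is sharp enough up
  to y = 2.\<close>

lemma sin_le_rational:
  fixes y :: real
  assumes y: "0 < y"
  shows "sin y \<le> y * (8 + y\<^sup>2) / (8 + 2 * y\<^sup>2)"
proof (cases "y \<le> 2")
  case True
  have "\<bar>sin y - (\<Sum>m<5. sin_coeff m * y ^ m)\<bar> \<le> inverse (fact 5) * \<bar>y\<bar> ^ 5"
    by (rule Maclaurin_sin_bound)
  moreover have "(\<Sum>m<5. sin_coeff m * y ^ m) = y - y ^ 3 / 6"
  proof -
    have "{..<5} = {0, 1, 2, 3, 4::nat}" by auto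
    then show ?thesis by (simp add: sin_coeff_def fact_numeral)
  qed
  moreover have "inverse (fact 5) * \<bar>y\<bar> ^ 5 = y ^ 5 / 120"
    using y by (simp add: eval_nat_numeral)
  ultimately have "sin y \<le> y - y ^ 3 / 6 + y ^ 5 / 120" by linarith
  also have "\<dots> \<le> y * (8 + y\<^sup>2) / (8 + 2 * y\<^sup>2)"
  proof -
    have pos: "0 < 8 + 2 * y\<^sup>2" by (simp add: add_pos_nonneg)
    have "y\<^sup>2 \<le> 2\<^sup>2" using True y by (intro power_mono) auto
    then have "0 \<le> y ^ 3 * (40 + 32 * y\<^sup>2 - 2 * (y\<^sup>2)\<^sup>2)"
    proof (intro mult_nonneg_nonneg)
      assume "y\<^sup>2 \<le> 2\<^sup>2"
      then have "2 * (y\<^sup>2 * y\<^sup>2) \<le> 2 * (y\<^sup>2 * 4)" by (intro mult_left_mono) auto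
      then show "0 \<le> 40 + 32 * y\<^sup>2 - 2 * (y\<^sup>2)\<^sup>2"
        using zero_le_power2[of y] unfolding power2_eq_square[of "y\<^sup>2"] by linarith
    qed (use y in simp)
    \<comment> \<open>The difference of both sides after clearing the denominators 120 and 8 + 2
      y^2. It is nonnegative because y^2 \<le> 4 gives 2 y^4 \<le> 8 y^2.\<close>
    also have "y ^ 3 * (40 + 32 * y\<^sup>2 - 2 * (y\<^sup>2)\<^sup>2)
        = 120 * (y * (8 + y\<^sup>2) - (y - y ^ 3 / 6 + y ^ 5 / 120) * (8 + 2 * y\<^sup>2))"
      by (simp add: algebra_simps eval_nat_numeral)
    finally show ?thesis using pos by (simp add: le_divide_eq)
  qed
  finally show ?thesis .
next
  case False
  have "sin y \<le> 1" by simp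
  also have "1 \<le> y * (8 + y\<^sup>2) / (8 + 2 * y\<^sup>2)"
  proof -
    have "2 * (8 + y\<^sup>2) \<le> y * (8 + y\<^sup>2)" using False by (intro mult_right_mono) auto
    then show ?thesis by (subst le_divide_eq) (auto simp: add_pos_nonneg)
  qed
  finally show ?thesis .
qed

lemma wave_integral_eq:
  assumes \<theta>: "0 < \<theta>" and t: "0 \<le> t"
  shows "(\<integral>\<^sup>+s. ennreal ((sin (\<theta> * (t - s)) / \<theta>)\<^sup>2) * indicator {0..t} s \<partial>lborel)
    = ennreal (t / (2 * \<theta>\<^sup>2) - sin (2 * \<theta> * t) / (4 * \<theta> ^ 3))"
proof -
  define a b where "a = 1 / (2 * \<theta>\<^sup>2)" and "b = 1 / (4 * \<theta> ^ 3)"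
  \<comment> \<open>The antiderivative from sin^2 x = (1 - cos (2 x)) / 2; the sine vanishes at s =
    t, so it contributes only at the lower limit.\<close>
  define F where "F s = a * s + b * sin (2 * \<theta> * (t - s))" for s
  have "(\<integral>\<^sup>+s. ennreal ((sin (\<theta> * (t - s)) / \<theta>)\<^sup>2) * indicator {0..t} s \<partial>lborel) = ennreal (F t - F 0)"
  proof (rule nn_integral_FTC_Icc)
    fix s
    have "DERIV F s :> a + b * (cos (2 * \<theta> * (t - s)) * (- (2 * \<theta>)))"
      unfolding F_def by (auto intro!: derivative_eq_intros)
    also have "a + b * (cos (2 * \<theta> * (t - s)) * (- (2 * \<theta>))) = (sin (\<theta> * (t - s)) / \<theta>)\<^sup>2"
    proof -
      have "cos (2 * \<theta> * (t - s)) = 1 - 2 * (sin (\<theta> * (t - s)))\<^sup>2"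
        using cos_double_sin[of "\<theta> * (t - s)"] by (simp add: mult.assoc)
      then have c: "a + b * (cos (2 * \<theta> * (t - s)) * (- (2 * \<theta>))) = a + b * ((1 - 2 * (sin (\<theta> * (t - s)))\<^sup>2) * (- (2 * \<theta>)))"
        by (simp only:)
      define S where "S = sin (\<theta> * (t - s))"
      show ?thesis unfolding c S_def[symmetric] using \<theta> by (simp add: a_def b_def field_simps eval_nat_numeral)
    qed
    finally have "DERIV F s :> (sin (\<theta> * (t - s)) / \<theta>)\<^sup>2" .
    then show "DERIV F s :> (sin (\<theta> * (t - s)) / \<theta>)\<^sup>2" .
  qed (use t in auto)
  also have "F t - F 0 = t / (2 * \<theta>\<^sup>2) - sin (2 * \<theta> * t) / (4 * \<theta> ^ 3)" by (simp add: F_def a_def b_def)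
  finally show ?thesis .
qed

definition wave_energy :: "real \<Rightarrow> real \<Rightarrow> ennreal" where
  "wave_energy t \<psi> = (\<integral>\<^sup>+s. ennreal ((real_wave \<psi> (t - s))\<^sup>2) * indicator {0..t} s \<partial>lborel)"

lemma wave_energy_0: "wave_energy 0 \<psi> = 0"
proof -
  have "AE s in lborel. s \<noteq> (0::real)" by (rule AE_lborel_singleton)
  then have "AE s in lborel. ennreal ((real_wave \<psi> (0 - s))\<^sup>2) * indicator {0..0} s = 0"
    by eventually_elim simp
  then show ?thesis unfolding wave_energy_def by (simp add: nn_integral_0_iff_AE)
qed

lemma wave_energy_le:
  assumes \<psi>: "0 \<le> \<psi>" and t: "0 < t"
  shows "wave_energy t \<psi> \<le> ennreal (2 * t * (1 / (1 / t\<^sup>2 + \<psi>)))"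
proof -
  have "wave_energy t \<psi> \<le> (\<integral>\<^sup>+s. ennreal (2 / (1 / t\<^sup>2 + \<psi>)) * indicator {0..t} s \<partial>lborel)"
    unfolding wave_energy_def
    by (intro nn_integral_mono) (auto simp: indicator_def \<psi> t intro!: ennreal_leI real_wave_sq_le)
  also have "\<dots> = ennreal (2 / (1 / t\<^sup>2 + \<psi>)) * ennreal t"
    using t by (simp add: nn_integral_cmult_indicator)
  also have "\<dots> = ennreal (2 * t * (1 / (1 / t\<^sup>2 + \<psi>)))"
    using t \<psi> by (subst ennreal_mult[symmetric]) (auto simp: mult.commute)
  finally show ?thesis .
qed

lemma wave_energy_ge:
  assumes \<psi>: "0 \<le> \<psi>" and t: "0 < t"
  shows "ennreal (t / 4 * (1 / (1 / t\<^sup>2 + \<psi>))) \<le> wave_energy t \<psi>"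
proof (cases "\<psi> = 0")
  case True
  define F where "F s = - ((t - s) ^ 3) / 3" for s
  have "wave_energy t \<psi> = (\<integral>\<^sup>+s. ennreal ((t - s)\<^sup>2) * indicator {0..t} s \<partial>lborel)"
    unfolding wave_energy_def real_wave_def by (simp add: True)
  also have "\<dots> = ennreal (F t - F 0)"
  proof (rule nn_integral_FTC_Icc)
    fix s
    show "DERIV F s :> (t - s)\<^sup>2"
      unfolding F_def by (auto intro!: derivative_eq_intros)
  qed (use t in auto)
  also have "F t - F 0 = t ^ 3 / 3" by (simp add: F_def)
  finally have "wave_energy t \<psi> = ennreal (t ^ 3 / 3)" .
  moreover have "t / 4 * (1 / (1 / t\<^sup>2 + \<psi>)) \<le> t ^ 3 / 3"
    using t True by (simp add: eval_nat_numeral)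
  ultimately show ?thesis by (simp add: ennreal_leI)
next
  case False
  define \<theta> where "\<theta> = sqrt \<psi>"
  have \<theta>: "0 < \<theta>" "\<theta>\<^sup>2 = \<psi>" using False \<psi> by (simp_all add: \<theta>_def)
  have "wave_energy t \<psi> = (\<integral>\<^sup>+s. ennreal ((sin (\<theta> * (t - s)) / \<theta>)\<^sup>2) * indicator {0..t} s \<partial>lborel)"
    unfolding wave_energy_def real_wave_def using False by (simp add: \<theta>_def)
  also have "\<dots> = ennreal (t / (2 * \<theta>\<^sup>2) - sin (2 * \<theta> * t) / (4 * \<theta> ^ 3))"
    using \<theta> t by (intro wave_integral_eq) auto
  finally have eq: "wave_energy t \<psi> = ennreal (t / (2 * \<theta>\<^sup>2) - sin (2 * \<theta> * t) / (4 * \<theta> ^ 3))" .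
  \<comment> \<open>Multiplied by 4 \<theta>^3, the claim reads u^3 / (1 + u^2) \<le> 2 u - sin (2
    u), that is, sin (2 u) \<le> u (2 + u^2) / (1 + u^2).\<close>
  define u where "u = \<theta> * t"
  have u: "0 < u" using \<theta> t by (simp add: u_def)
  have "sin (2 * u) \<le> 2 * u * (8 + (2 * u)\<^sup>2) / (8 + 2 * (2 * u)\<^sup>2)"
    using u by (intro sin_le_rational) simp
  also have "\<dots> = u * (2 + u\<^sup>2) / (1 + u\<^sup>2)"
  proof -
    have "0 < 1 + u\<^sup>2" by (simp add: add_pos_nonneg)
    then show ?thesis by (simp add: divide_simps power_mult_distrib) (simp add: algebra_simps eval_nat_numeral)
  qed
  finally have s: "sin (2 * \<theta> * t) \<le> u * (2 + u\<^sup>2) / (1 + u\<^sup>2)" by (simp add: u_def mult.assoc)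
  have den: "0 < 1 + u\<^sup>2" by (simp add: add_pos_nonneg)
  have "t / 4 * (1 / (1 / t\<^sup>2 + \<psi>)) = t / 4 * (t\<^sup>2 / (1 + u\<^sup>2))"
    using t \<theta> den by (simp add: u_def power_mult_distrib divide_simps)
  also have "\<dots> = t / (2 * \<theta>\<^sup>2) - u * (2 + u\<^sup>2) / (1 + u\<^sup>2) / (4 * \<theta> ^ 3)"
  proof -
    have alg: "v / \<theta> / 4 * ((v / \<theta>)\<^sup>2 / (1 + v\<^sup>2))
        = v / \<theta> / (2 * \<theta>\<^sup>2) - v * (2 + v\<^sup>2) / (1 + v\<^sup>2) / (4 * \<theta> ^ 3)" if "0 < 1 + v\<^sup>2" for v
    proof -
      have "\<theta> \<noteq> 0" "1 + v\<^sup>2 \<noteq> 0" using \<theta> that by auto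
      then show ?thesis by (simp add: divide_simps) (simp add: algebra_simps eval_nat_numeral)
    qed
    have "u / \<theta> = t" using \<theta> by (simp add: u_def)
    with alg[OF den] show ?thesis by simp
  qed
  also have "\<dots> \<le> t / (2 * \<theta>\<^sup>2) - sin (2 * \<theta> * t) / (4 * \<theta> ^ 3)"
    using s \<theta> by (intro diff_left_mono divide_right_mono) auto
  finally show ?thesis unfolding eq by (rule ennreal_leI)
qed

section \<open>Energy bounds\<close>

lemma integrable_inverse_1_plus_square_lborel: "integrable lborel (\<lambda>x::real. inverse (1 + x\<^sup>2))"
  using integrable_inverse_1_plus_square by (simp add: set_integrable_def einterval_def)

text \<open>An integrable majorant on R^d that factorizes over the coordinates, so that its
  integrability follows from dimension one without polar coordinates.\<close>

lemma integrable_prod_inverse_1_plus_square: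
  "integrable lborel (\<lambda>x::'a::euclidean_space. \<Prod>b\<in>Basis. inverse (1 + (x \<bullet> b)\<^sup>2))"
proof -
  interpret product_sigma_finite "\<lambda>_::'a. lborel :: real measure"
    by standard
  have comp: "(\<Sum>b'\<in>Basis. x b' *\<^sub>R b') \<bullet> b = x b" if "b \<in> Basis" for x and b :: 'a
    using that by (simp add: inner_sum_left inner_Basis if_distrib cong: if_cong)
  have eq: "(\<Prod>b\<in>Basis. inverse (1 + ((\<Sum>b'\<in>Basis. x b' *\<^sub>R b') \<bullet> b)\<^sup>2))
      = (\<Prod>b\<in>(Basis :: 'a set). inverse (1 + (x b)\<^sup>2))" for x
    by (intro prod.cong refl) (simp add: comp)
  show ?thesis
    by (subst lborel_eq, subst integrable_distr_eq)
       (auto simp only: eq intro!: product_integrable_prod integrable_inverse_1_plus_square_lborel finite_Basis, measurable)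
qed

text \<open>A bound for |f| together with one for |x|^(2d) |f| dominates |f| by a multiple of the
  product majorant. Square integrability follows since |f|^2 \<le> B0 * |f|.\<close>

lemma schwartz_L1_L2:
  fixes f :: "'a::euclidean_space \<Rightarrow> complex"
  assumes f: "f \<in> schwartz"
  shows "f \<in> L1_L2 lborel"
proof -
  have nil: "[] \<in> lists (Basis :: 'a set)" by simp
  have "(\<forall>x. iterated_partial [] f differentiable (at x)) \<and>
      (\<forall>k::nat. bounded (range (\<lambda>x. norm x ^ k * cmod (iterated_partial [] f x))))"
    using f unfolding schwartz_def mem_Collect_eq by (rule bspec[OF _ nil])
  then have diff: "f differentiable (at x)" and bdd: "bounded (range (\<lambda>x. norm x ^ k * cmod (f x)))" for x and k :: nat
    by simp_all
  have "continuous_on UNIV f"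
    using diff by (simp add: continuous_on_eq_continuous_at differentiable_imp_continuous_within)
  then have [measurable]: "f \<in> borel_measurable borel" by (rule borel_measurable_continuous_onI)
  define d where "d = DIM('a)"
  obtain B0 where B0: "\<And>x. cmod (f x) \<le> B0"
    using bdd[of 0] by (auto simp: bounded_iff)
  obtain B1 where B1: "\<And>x. norm x ^ (2 * d) * cmod (f x) \<le> B1"
    using bdd[of "2 * d"] by (auto simp: bounded_iff abs_mult)
  define p where "p x = (\<Prod>b\<in>Basis. inverse (1 + (x \<bullet> b)\<^sup>2))" for x :: 'a
  have p: "0 < p x" for x unfolding p_def by (intro prod_pos) (auto simp: add_pos_nonneg)
  \<comment> \<open>Each factor of 1 / p is at most 1 + |x|^2, and (1 + |x|^2)^d \<le> 2^d (1 +
    |x|^(2d)) by comparing |x| with 1. This fixes the exponent 2d.\<close>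
  have bound: "cmod (f x) \<le> 2 ^ d * (B0 + B1) * p x" for x
  proof -
    have "inverse (p x) = (\<Prod>b\<in>Basis. 1 + (x \<bullet> b)\<^sup>2)"
      unfolding p_def prod_inversef[symmetric] by (simp only: o_def inverse_inverse_eq)
    also have "\<dots> \<le> (\<Prod>b\<in>(Basis :: 'a set). 1 + (norm x)\<^sup>2)"
    proof (rule prod_mono)
      fix b :: 'a assume "b \<in> Basis"
      then have "\<bar>x \<bullet> b\<bar> \<le> norm x" by (rule Basis_le_norm)
      then have "\<bar>x \<bullet> b\<bar>\<^sup>2 \<le> (norm x)\<^sup>2" by (intro power_mono) auto
      then show "0 \<le> 1 + (x \<bullet> b)\<^sup>2 \<and> 1 + (x \<bullet> b)\<^sup>2 \<le> 1 + (norm x)\<^sup>2" by simp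
    qed
    also have "\<dots> = (1 + (norm x)\<^sup>2) ^ d" by (simp add: d_def)
    also have "\<dots> \<le> 2 ^ d * (1 + norm x ^ (2 * d))"
    proof (cases "norm x \<le> 1")
      case True
      then have "(norm x)\<^sup>2 \<le> 1" by (simp add: power_le_one)
      then have "(1 + (norm x)\<^sup>2) ^ d \<le> 2 ^ d" by (intro power_mono) auto
      also have "\<dots> \<le> 2 ^ d * (1 + norm x ^ (2 * d))" by simp
      finally show ?thesis .
    next
      case False
      then have "1 \<le> (norm x)\<^sup>2" by (simp add: one_le_power)
      then have "(1 + (norm x)\<^sup>2) ^ d \<le> (2 * (norm x)\<^sup>2) ^ d" by (intro power_mono) auto
      also have "\<dots> = 2 ^ d * norm x ^ (2 * d)" by (simp add: power_mult_distrib power_mult)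
      also have "\<dots> \<le> 2 ^ d * (1 + norm x ^ (2 * d))" by simp
      finally show ?thesis .
    qed
    finally have "inverse (p x) * cmod (f x) \<le> 2 ^ d * (1 + norm x ^ (2 * d)) * cmod (f x)"
      by (rule mult_right_mono) simp
    also have "\<dots> = 2 ^ d * (cmod (f x) + norm x ^ (2 * d) * cmod (f x))" by (simp add: algebra_simps)
    also have "\<dots> \<le> 2 ^ d * (B0 + B1)" by (intro mult_left_mono add_mono B0 B1) simp
    finally show ?thesis using p[of x] by (simp add: field_simps)
  qed
  have pint: "integrable lborel (\<lambda>x. 2 ^ d * (B0 + B1) * p x)"
    unfolding p_def by (intro integrable_mult_right integrable_prod_inverse_1_plus_square)
  have fi: "integrable lborel f"
  proof (rule Bochner_Integration.integrable_bound[OF pint])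
    show "AE x in lborel. norm (f x) \<le> norm (2 ^ d * (B0 + B1) * p x)"
      unfolding real_norm_def by (intro AE_I2 order_trans[OF bound abs_ge_self])
  qed simp
  have "integrable lborel (\<lambda>x. (cmod (f x))\<^sup>2)"
  proof (rule Bochner_Integration.integrable_bound)
    show "integrable lborel (\<lambda>x. B0 * cmod (f x))" using fi by simp
    show "AE x in lborel. norm ((cmod (f x))\<^sup>2) \<le> norm (B0 * cmod (f x))"
    proof (rule AE_I2)
      fix x
      have "cmod (f x) * cmod (f x) \<le> B0 * cmod (f x)" by (intro mult_right_mono B0) simp
      then show "norm ((cmod (f x))\<^sup>2) \<le> norm (B0 * cmod (f x))" by (simp add: power2_eq_square)
    qed
  qed simp
  with fi show ?thesis by (simp add: L1_L2_def L2_fun_def)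
qed

section \<open>The integrand of the weak solution and the energy norm\<close>

text \<open>The interface between probability and analysis: the lemmas below see the process only
  through these properties of its exponent.\<close>

locale nonneg_symbol =
  fixes \<Psi> :: "'a::euclidean_space \<Rightarrow> complex"
  assumes Im_symbol: "Im (\<Psi> \<xi>) = 0"
    and Re_symbol: "0 \<le> Re (\<Psi> \<xi>)"
    and measurable_symbol[measurable]: "\<Psi> \<in> borel_measurable borel"
begin

text \<open>The conjugated transform is abstracted to G so that differences of test functions become
  differences of G.\<close>

definition wave_kernel :: "real \<Rightarrow> ('a \<Rightarrow> complex) \<Rightarrow> real \<times> 'a \<Rightarrow> complex" where
  "wave_kernel t G = (\<lambda>(s, \<xi>). indicator {0..t} s * wave_multiplier (\<Psi> \<xi>) (t - s) * G \<xi>)"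

lemma wave_kernel_measurable:
  assumes [measurable]: "G \<in> borel_measurable borel"
  shows "wave_kernel t G \<in> borel_measurable st_measure"
proof -
  have id: "(\<lambda>s. s) \<in> restrict_space lborel {0..} \<rightarrow>\<^sub>M (borel :: real measure)"
    by (rule measurable_restrict_space1) simp
  have "(\<lambda>z. indicator {0..t} (fst z) * complex_of_real (real_wave (Re (\<Psi> (snd z))) (t - fst z)) * G (snd z))
      \<in> borel_measurable (restrict_space lborel {0..} \<Otimes>\<^sub>M lborel)"
  proof -
    have [measurable]: "fst \<in> restrict_space lborel {0..} \<Otimes>\<^sub>M lborel \<rightarrow>\<^sub>M (borel :: real measure)"
      by (rule measurable_compose[OF measurable_fst id])
    show ?thesis by measurable
  qed
  moreover have "wave_kernel t G
      = (\<lambda>z. indicator {0..t} (fst z) * complex_of_real (real_wave (Re (\<Psi> (snd z))) (t - fst z)) * G (snd z))"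
    by (auto simp: wave_kernel_def fun_eq_iff wave_multiplier_real Im_symbol Re_symbol)
  ultimately show ?thesis by (simp add: st_measure_def)
qed

lemma wave_kernel_diff:
  "wave_kernel t G z - wave_kernel t H z = wave_kernel t (\<lambda>\<xi>. G \<xi> - H \<xi>) z"
  by (cases z) (simp add: wave_kernel_def algebra_simps)

lemma L2_sq_wave_kernel:
  assumes G[measurable]: "G \<in> borel_measurable borel"
  shows "L2_sq st_measure (wave_kernel t G)
    = (\<integral>\<^sup>+\<xi>. ennreal ((cmod (G \<xi>))\<^sup>2) * wave_energy t (Re (\<Psi> \<xi>)) \<partial>lborel)"
proof -
  interpret pair_sigma_finite "restrict_space lborel {0..} :: real measure" "lborel :: 'a measure"
    by (rule pair_sigma_finite_st)
  have m: "(\<lambda>z. ennreal ((cmod (wave_kernel t G z))\<^sup>2)) \<in> borel_measurable (restrict_space lborel {0..} \<Otimes>\<^sub>M lborel)"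
    using wave_kernel_measurable[OF G, of t] unfolding st_measure_def by measurable
  have "L2_sq st_measure (wave_kernel t G)
      = (\<integral>\<^sup>+\<xi>. (\<integral>\<^sup>+s. ennreal ((cmod (wave_kernel t G (s, \<xi>)))\<^sup>2) \<partial>restrict_space lborel {0..}) \<partial>lborel)"
    unfolding L2_sq_def st_measure_def by (rule nn_integral_snd[OF m, symmetric])
  also have "\<dots> = (\<integral>\<^sup>+\<xi>. ennreal ((cmod (G \<xi>))\<^sup>2) * wave_energy t (Re (\<Psi> \<xi>)) \<partial>lborel)"
  proof (rule nn_integral_cong)
    fix \<xi>
    have "(\<integral>\<^sup>+s. ennreal ((cmod (wave_kernel t G (s, \<xi>)))\<^sup>2) \<partial>restrict_space lborel {0..})
        = (\<integral>\<^sup>+s. ennreal ((cmod (wave_kernel t G (s, \<xi>)))\<^sup>2) * indicator {0..} s \<partial>lborel)"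
      by (rule nn_integral_restrict_space) simp
    also have "\<dots> = (\<integral>\<^sup>+s. ennreal ((cmod (G \<xi>))\<^sup>2) * (ennreal ((real_wave (Re (\<Psi> \<xi>)) (t - s))\<^sup>2) * indicator {0..t} s) \<partial>lborel)"
      by (intro nn_integral_cong)
         (simp add: wave_kernel_def wave_multiplier_real Im_symbol Re_symbol norm_mult power_mult_distrib
           ennreal_mult mult.commute split: split_indicator)
    also have "\<dots> = ennreal ((cmod (G \<xi>))\<^sup>2) * wave_energy t (Re (\<Psi> \<xi>))"
      unfolding wave_energy_def by (rule nn_integral_cmult) measurable
    finally show "(\<integral>\<^sup>+s. ennreal ((cmod (wave_kernel t G (s, \<xi>)))\<^sup>2) \<partial>restrict_space lborel {0..})
        = ennreal ((cmod (G \<xi>))\<^sup>2) * wave_energy t (Re (\<Psi> \<xi>))" .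
  qed
  finally show ?thesis .
qed

lemma L2_sq_wave_kernel_0:
  "G \<in> borel_measurable borel \<Longrightarrow> L2_sq st_measure (wave_kernel 0 G) = 0"
  by (simp add: L2_sq_wave_kernel wave_energy_0)

lemma L2_sq_wave_kernel_bounds:
  assumes G[measurable]: "G \<in> borel_measurable borel" and t: "0 < t"
  defines "E \<equiv> (\<integral>\<^sup>+\<xi>. ennreal ((cmod (G \<xi>))\<^sup>2 / (1 / t\<^sup>2 + Re (\<Psi> \<xi>))) \<partial>lborel)"
  shows "ennreal (t / 4) * E \<le> L2_sq st_measure (wave_kernel t G)"
    and "L2_sq st_measure (wave_kernel t G) \<le> ennreal (2 * t) * E"
proof -
  have den: "0 < 1 / t\<^sup>2 + Re (\<Psi> \<xi>)" for \<xi> using t Re_symbol by (simp add: add_pos_nonneg)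
  have scale: "ennreal c * ennreal ((cmod (G \<xi>))\<^sup>2 / (1 / t\<^sup>2 + Re (\<Psi> \<xi>)))
      = ennreal ((cmod (G \<xi>))\<^sup>2) * ennreal (c * (1 / (1 / t\<^sup>2 + Re (\<Psi> \<xi>))))" if "0 \<le> c" for c \<xi>
    using that den[of \<xi>] by (subst (1 2) ennreal_mult[symmetric]) (auto simp: less_imp_le)
  have "ennreal (t / 4) * E = (\<integral>\<^sup>+\<xi>. ennreal (t / 4) * ennreal ((cmod (G \<xi>))\<^sup>2 / (1 / t\<^sup>2 + Re (\<Psi> \<xi>))) \<partial>lborel)"
    unfolding E_def by (rule nn_integral_cmult[symmetric]) measurable
  also have "\<dots> \<le> (\<integral>\<^sup>+\<xi>. ennreal ((cmod (G \<xi>))\<^sup>2) * wave_energy t (Re (\<Psi> \<xi>)) \<partial>lborel)"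
    using t by (intro nn_integral_mono) (simp only: scale divide_nonneg_nonneg less_imp_le zero_le_numeral, intro mult_left_mono wave_energy_ge Re_symbol t zero_le)
  finally show "ennreal (t / 4) * E \<le> L2_sq st_measure (wave_kernel t G)"
    by (simp only: L2_sq_wave_kernel[OF G])
  have "(\<integral>\<^sup>+\<xi>. ennreal ((cmod (G \<xi>))\<^sup>2) * wave_energy t (Re (\<Psi> \<xi>)) \<partial>lborel)
      \<le> (\<integral>\<^sup>+\<xi>. ennreal (2 * t) * ennreal ((cmod (G \<xi>))\<^sup>2 / (1 / t\<^sup>2 + Re (\<Psi> \<xi>))) \<partial>lborel)"
    using t by (intro nn_integral_mono) (simp only: scale mult_nonneg_nonneg less_imp_le zero_le_numeral, intro mult_left_mono wave_energy_le Re_symbol t zero_le)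
  also have "\<dots> = ennreal (2 * t) * E"
    unfolding E_def by (rule nn_integral_cmult) measurable
  finally show "L2_sq st_measure (wave_kernel t G) \<le> ennreal (2 * t) * E"
    by (simp only: L2_sq_wave_kernel[OF G])
qed

text \<open>Turns the energy into a squared norm in plain L2, where completeness and continuity of
  the norm are available.\<close>

definition weighted_fourier :: "real \<Rightarrow> ('a \<Rightarrow> complex) \<Rightarrow> 'a \<Rightarrow> complex" where
  "weighted_fourier \<kappa> \<phi> \<xi> = fourier \<phi> \<xi> / complex_of_real (sqrt (1 / \<kappa> + Re (\<Psi> \<xi>)))"

lemma weight_pos: "0 < \<kappa> \<Longrightarrow> 0 < 1 / \<kappa> + Re (\<Psi> \<xi>)"
  by (rule add_pos_nonneg) (simp_all add: Re_symbol)

lemma energy_eq_L2_sq: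
  assumes \<kappa>: "0 < \<kappa>"
  shows "energy \<Psi> \<kappa> \<phi> = ennreal (1 / (2 * pi) ^ DIM('a)) * L2_sq lborel (weighted_fourier \<kappa> \<phi>)"
proof -
  have "(cmod (weighted_fourier \<kappa> \<phi> \<xi>))\<^sup>2 = (cmod (fourier \<phi> \<xi>))\<^sup>2 / (1 / \<kappa> + Re (\<Psi> \<xi>))" for \<xi>
    using weight_pos[OF \<kappa>, of \<xi>] by (simp add: weighted_fourier_def norm_divide power_divide)
  then show ?thesis using \<kappa> by (simp add: energy_def L2_sq_def)
qed

lemma weighted_fourier_L2:
  assumes \<kappa>: "0 < \<kappa>" and \<phi>: "\<phi> \<in> L1_L2 lborel"
  shows "weighted_fourier \<kappa> \<phi> \<in> L2_fun lborel"
proof (rule L2_fun_bound)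
  note [measurable] = L2_fun_measurable[OF fourier_L2[OF \<phi>], simplified]
  show "(\<lambda>\<xi>. complex_of_real (1 / sqrt (1 / \<kappa>)) * fourier \<phi> \<xi>) \<in> L2_fun lborel"
    by (intro L2_fun_cmult fourier_L2 \<phi>)
  show "weighted_fourier \<kappa> \<phi> \<in> borel_measurable lborel"
    unfolding weighted_fourier_def by measurable
  show "norm (weighted_fourier \<kappa> \<phi> \<xi>) \<le> norm (complex_of_real (1 / sqrt (1 / \<kappa>)) * fourier \<phi> \<xi>)" for \<xi>
  proof -
    have "sqrt (1 / \<kappa>) \<le> sqrt (1 / \<kappa> + Re (\<Psi> \<xi>))" using Re_symbol[of \<xi>] by (intro real_sqrt_le_mono) simp
    moreover have "0 < sqrt (1 / \<kappa>)" using \<kappa> by simp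
    ultimately have "cmod (fourier \<phi> \<xi>) / sqrt (1 / \<kappa> + Re (\<Psi> \<xi>)) \<le> cmod (fourier \<phi> \<xi>) / sqrt (1 / \<kappa>)"
      using weight_pos[OF \<kappa>, of \<xi>] by (intro divide_left_mono mult_pos_pos) auto
    moreover have "norm (weighted_fourier \<kappa> \<phi> \<xi>) = cmod (fourier \<phi> \<xi>) / sqrt (1 / \<kappa> + Re (\<Psi> \<xi>))"
      using weight_pos[OF \<kappa>, of \<xi>] unfolding weighted_fourier_def norm_divide norm_of_real by simp
    moreover have "norm (complex_of_real (1 / sqrt (1 / \<kappa>)) * fourier \<phi> \<xi>) = cmod (fourier \<phi> \<xi>) / sqrt (1 / \<kappa>)"
      using \<kappa> unfolding norm_mult norm_of_real by simp
    ultimately show ?thesis by linarith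
  qed
qed

lemma energy_finite:
  assumes "0 < \<kappa>" "\<phi> \<in> L1_L2 lborel"
  shows "energy \<Psi> \<kappa> \<phi> < \<infinity>"
  using weighted_fourier_L2[OF assms] energy_eq_L2_sq[OF assms(1)]
  by (simp add: L2_fun_iff ennreal_mult_less_top)

lemma weighted_fourier_diff:
  assumes "\<phi> \<in> L1_L2 lborel" "\<eta> \<in> L1_L2 lborel"
  shows "weighted_fourier \<kappa> (\<lambda>x. \<phi> x - \<eta> x) = (\<lambda>\<xi>. weighted_fourier \<kappa> \<phi> \<xi> - weighted_fourier \<kappa> \<eta> \<xi>)"
  by (simp add: weighted_fourier_def fourier_diff[OF L1_L2_D(1)[OF assms(1)] L1_L2_D(1)[OF assms(2)]]
      diff_divide_distrib fun_eq_iff)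

text \<open>The constant satisfies (1 + \<mu>/\<kappa>) * (1/\<mu>) = 1/\<mu> + 1/\<kappa>, so it
  lifts the weight 1/\<mu> + \<Psi> above 1/\<kappa> + \<Psi>. By exchanging the parameters, all
  these norms are equivalent.\<close>

lemma energy_le_energy:
  assumes \<kappa>: "0 < \<kappa>" and \<mu>: "0 < \<mu>" and \<phi>: "\<phi> \<in> L1_L2 lborel"
  shows "energy \<Psi> \<mu> \<phi> \<le> ennreal (1 + \<mu> / \<kappa>) * energy \<Psi> \<kappa> \<phi>"
proof -
  note [measurable] = L2_fun_measurable[OF fourier_L2[OF \<phi>], simplified]
  have inv: "1 / b \<le> c * (1 / a)" if "a \<le> c * b" "0 < a" "0 < b" for a b c :: real
    using that by (simp add: field_simps)
  have C: "0 < 1 + \<mu> / \<kappa>" using \<kappa> \<mu> by (simp add: add_pos_pos)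
  have "(\<integral>\<^sup>+\<xi>. ennreal ((cmod (fourier \<phi> \<xi>))\<^sup>2 / (1 / \<mu> + Re (\<Psi> \<xi>))) \<partial>lborel)
      \<le> (\<integral>\<^sup>+\<xi>. ennreal (1 + \<mu> / \<kappa>) * ennreal ((cmod (fourier \<phi> \<xi>))\<^sup>2 / (1 / \<kappa> + Re (\<Psi> \<xi>))) \<partial>lborel)"
  proof (rule nn_integral_mono)
    fix \<xi>
    have "1 / \<kappa> + Re (\<Psi> \<xi>) \<le> (1 + \<mu> / \<kappa>) * (1 / \<mu> + Re (\<Psi> \<xi>))"
    proof -
      have "(1 + \<mu> / \<kappa>) * (1 / \<mu> + Re (\<Psi> \<xi>)) = 1 / \<mu> + 1 / \<kappa> + Re (\<Psi> \<xi>) + \<mu> / \<kappa> * Re (\<Psi> \<xi>)"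
        using \<kappa> \<mu> by (simp add: field_simps)
      moreover have "0 \<le> \<mu> / \<kappa> * Re (\<Psi> \<xi>)" using \<kappa> \<mu> Re_symbol[of \<xi>] by (intro mult_nonneg_nonneg) auto
      moreover have "0 \<le> 1 / \<mu>" using \<mu> by simp
      ultimately show ?thesis by linarith
    qed
    then have "1 / (1 / \<mu> + Re (\<Psi> \<xi>)) \<le> (1 + \<mu> / \<kappa>) * (1 / (1 / \<kappa> + Re (\<Psi> \<xi>)))"
      by (intro inv weight_pos \<kappa> \<mu>)
    then have "(cmod (fourier \<phi> \<xi>))\<^sup>2 * (1 / (1 / \<mu> + Re (\<Psi> \<xi>)))
        \<le> (cmod (fourier \<phi> \<xi>))\<^sup>2 * ((1 + \<mu> / \<kappa>) * (1 / (1 / \<kappa> + Re (\<Psi> \<xi>))))"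
      by (rule mult_left_mono) simp
    then have "ennreal ((cmod (fourier \<phi> \<xi>))\<^sup>2 / (1 / \<mu> + Re (\<Psi> \<xi>)))
        \<le> ennreal ((1 + \<mu> / \<kappa>) * ((cmod (fourier \<phi> \<xi>))\<^sup>2 / (1 / \<kappa> + Re (\<Psi> \<xi>))))"
      by (intro ennreal_leI) (simp add: mult.commute)
    also have "\<dots> = ennreal (1 + \<mu> / \<kappa>) * ennreal ((cmod (fourier \<phi> \<xi>))\<^sup>2 / (1 / \<kappa> + Re (\<Psi> \<xi>)))"
      using C weight_pos[OF \<kappa>, of \<xi>] by (intro ennreal_mult divide_nonneg_pos) auto
    finally show "ennreal ((cmod (fourier \<phi> \<xi>))\<^sup>2 / (1 / \<mu> + Re (\<Psi> \<xi>)))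
        \<le> ennreal (1 + \<mu> / \<kappa>) * ennreal ((cmod (fourier \<phi> \<xi>))\<^sup>2 / (1 / \<kappa> + Re (\<Psi> \<xi>)))" .
  qed
  also have "\<dots> = ennreal (1 + \<mu> / \<kappa>) * (\<integral>\<^sup>+\<xi>. ennreal ((cmod (fourier \<phi> \<xi>))\<^sup>2 / (1 / \<kappa> + Re (\<Psi> \<xi>))) \<partial>lborel)"
    by (rule nn_integral_cmult) measurable
  finally have le: "(\<integral>\<^sup>+\<xi>. ennreal ((cmod (fourier \<phi> \<xi>))\<^sup>2 / (1 / \<mu> + Re (\<Psi> \<xi>))) \<partial>lborel)
      \<le> ennreal (1 + \<mu> / \<kappa>) * (\<integral>\<^sup>+\<xi>. ennreal ((cmod (fourier \<phi> \<xi>))\<^sup>2 / (1 / \<kappa> + Re (\<Psi> \<xi>))) \<partial>lborel)" .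
  show ?thesis
    unfolding energy_def mult.left_commute[of "ennreal (1 + \<mu> / \<kappa>)"] if_not_P[OF less_imp_neq[OF \<kappa>, symmetric]]
      if_not_P[OF less_imp_neq[OF \<mu>, symmetric]]
    by (rule mult_left_mono[OF le]) simp
qed

end

section \<open>Extension to the completion\<close>

lemma second_moment_eq: "second_moment P Y = L2_sq P Y"
  by (simp add: second_moment_def L2_sq_def)

lemma energy_Cauchy_schwartz: "\<phi> \<in> energy_Cauchy \<Psi> \<kappa> \<Longrightarrow> \<phi> n \<in> schwartz"
  by (simp add: energy_Cauchy_def)

lemma energy_zero: "energy \<Psi> \<kappa> (\<lambda>x. 0) = 0"
  by (simp add: energy_def fourier_def)

text \<open>Spares the proof that \<open>energy_equiv\<close> is an equivalence relation: one
  representative whose energy distance to every member of the class tends to 0 is enough for the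
  limits below.\<close>

lemma L2_completion_rep:
  assumes "\<Phi> \<in> L2_completion \<Psi> \<kappa>"
  obtains x where "x \<in> \<Phi>" "\<forall>\<phi>\<in>\<Phi>. \<phi> \<in> energy_Cauchy \<Psi> \<kappa>"
    "\<forall>\<phi>\<in>\<Phi>. (\<lambda>n. energy \<Psi> \<kappa> (\<lambda>y. x n y - \<phi> n y)) \<longlonglongrightarrow> 0"
proof -
  from assms obtain x where x: "x \<in> energy_Cauchy \<Psi> \<kappa>" "\<Phi> = energy_equiv \<Psi> \<kappa> `` {x}"
    unfolding L2_completion_def by (rule quotientE)
  then have "x \<in> \<Phi>" by (simp add: energy_equiv_def energy_zero)
  then show ?thesis using x by (intro that[of x]) (auto simp: energy_equiv_def)
qed

lemma completion_of_in_completion: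
  assumes "\<phi> \<in> schwartz"
  shows "completion_of \<Psi> \<kappa> \<phi> \<in> L2_completion \<Psi> \<kappa>" "(\<lambda>_. \<phi>) \<in> completion_of \<Psi> \<kappa> \<phi>"
proof -
  have c: "(\<lambda>_. \<phi>) \<in> energy_Cauchy \<Psi> \<kappa>"
    using assms by (simp add: energy_Cauchy_def energy_zero)
  then show "completion_of \<Psi> \<kappa> \<phi> \<in> L2_completion \<Psi> \<kappa>"
    unfolding completion_of_def L2_completion_def by (rule quotientI)
  show "(\<lambda>_. \<phi>) \<in> completion_of \<Psi> \<kappa> \<phi>"
    using c by (simp add: completion_of_def energy_equiv_def energy_zero)
qed

text \<open>A Lipschitz map into the complete space L2 sends one representative to a Cauchy
  sequence, and every other member of the class shares its limit. Linearity of T is not assumed,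
  which matters because the weak solution is linear only almost surely. The other instance is T =
  \<open>weighted_fourier \<mu>\<close>.\<close>

lemma completion_extension:
  fixes T :: "('a::euclidean_space \<Rightarrow> complex) \<Rightarrow> 'b \<Rightarrow> 'c::euclidean_space"
  assumes T: "\<And>\<phi>. \<phi> \<in> schwartz \<Longrightarrow> T \<phi> \<in> L2_fun M"
    and bound: "\<And>\<phi> \<eta>. \<phi> \<in> schwartz \<Longrightarrow> \<eta> \<in> schwartz \<Longrightarrow>
      L2_sq M (\<lambda>x. T \<phi> x - T \<eta> x) \<le> ennreal C * energy \<Psi> \<kappa> (\<lambda>x. \<phi> x - \<eta> x)"
    and \<Phi>: "\<Phi> \<in> L2_completion \<Psi> \<kappa>"
  shows "\<exists>G\<in>L2_fun M. \<forall>\<phi>\<in>\<Phi>. L2_tendsto M (\<lambda>n. T (\<phi> n)) G"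
proof -
  obtain x where "x \<in> \<Phi>" and mem: "\<forall>\<phi>\<in>\<Phi>. \<phi> \<in> energy_Cauchy \<Psi> \<kappa>"
    and equiv: "\<forall>\<phi>\<in>\<Phi>. (\<lambda>n. energy \<Psi> \<kappa> (\<lambda>y. x n y - \<phi> n y)) \<longlonglongrightarrow> 0"
    by (rule L2_completion_rep[OF \<Phi>])
  then have x: "x \<in> energy_Cauchy \<Psi> \<kappa>" by blast
  have xs: "x n \<in> schwartz" for n by (rule energy_Cauchy_schwartz[OF x])
  have "\<exists>N. \<forall>m\<ge>N. \<forall>n\<ge>N. L2_sq M (\<lambda>y. T (x m) y - T (x n) y) \<le> ennreal e" if e: "e > 0" for e
  proof -
    \<comment> \<open>The Lipschitz constant may be 0, as for the weak solution at t = 0, and e has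
      to be divided by it.\<close>
    define C' where "C' = max C 1"
    have C': "0 < C'" "C \<le> C'" by (simp_all add: C'_def)
    define \<delta> where "\<delta> = sqrt (e / C')"
    have \<delta>: "0 < \<delta>" "\<delta>\<^sup>2 = e / C'" using e C' by (simp_all add: \<delta>_def)
    obtain N where N: "\<And>m n. m \<ge> N \<Longrightarrow> n \<ge> N \<Longrightarrow> energy \<Psi> \<kappa> (\<lambda>y. x m y - x n y) < ennreal (\<delta>\<^sup>2)"
      using x \<delta>(1) unfolding energy_Cauchy_def by blast
    have "L2_sq M (\<lambda>y. T (x m) y - T (x n) y) \<le> ennreal e" if "m \<ge> N" "n \<ge> N" for m n
    proof -
      have "L2_sq M (\<lambda>y. T (x m) y - T (x n) y) \<le> ennreal C * energy \<Psi> \<kappa> (\<lambda>y. x m y - x n y)"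
        by (rule bound[OF xs xs])
      also have "\<dots> \<le> ennreal C' * ennreal (\<delta>\<^sup>2)"
        by (intro mult_mono ennreal_leI C'(2) less_imp_le[OF N[OF that]]) auto
      also have "\<dots> = ennreal (C' * \<delta>\<^sup>2)" using C' by (intro ennreal_mult[symmetric]) auto
      also have "C' * \<delta>\<^sup>2 = e" using C' \<delta> by simp
      finally show ?thesis .
    qed
    then show ?thesis by blast
  qed
  then obtain G where G: "G \<in> L2_fun M" and lim: "L2_tendsto M (\<lambda>n. T (x n)) G"
    using L2_complete[of "\<lambda>n. T (x n)" M, OF T[OF xs]] by blast
  have "L2_tendsto M (\<lambda>n. T (\<phi> n)) G" if \<phi>: "\<phi> \<in> \<Phi>" for \<phi>
  proof (rule L2_tendsto_close[OF _ _ _ lim])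
    have s: "\<phi> n \<in> schwartz" for n by (rule energy_Cauchy_schwartz[OF bspec[OF mem \<phi>]])
    show "(\<lambda>n. L2_sq M (\<lambda>y. T (x n) y - T (\<phi> n) y)) \<longlonglongrightarrow> 0"
    proof (rule tendsto_sandwich[where f = "\<lambda>_. 0"])
      show "\<forall>\<^sub>F n in sequentially. L2_sq M (\<lambda>y. T (x n) y - T (\<phi> n) y) \<le> ennreal C * energy \<Psi> \<kappa> (\<lambda>y. x n y - \<phi> n y)"
        by (intro always_eventually allI bound xs s)
      have "(\<lambda>n. ennreal C * energy \<Psi> \<kappa> (\<lambda>y. x n y - \<phi> n y)) \<longlonglongrightarrow> ennreal C * 0"
        using bspec[OF equiv \<phi>] by (intro ennreal_tendsto_cmult) auto
      then show "(\<lambda>n. ennreal C * energy \<Psi> \<kappa> (\<lambda>y. x n y - \<phi> n y)) \<longlonglongrightarrow> 0" by simp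
    qed auto
    show "T (\<phi> n) \<in> borel_measurable M" "T (x n) \<in> borel_measurable M" "G \<in> borel_measurable M" for n
      using T[OF s] T[OF xs] G by (auto simp: L2_fun_def)
  qed
  with G show ?thesis by blast
qed

context nonneg_symbol
begin

text \<open>Justifies the definite description in \<open>completion_energy\<close>: the weighted
  transforms of all members of the class converge to one function, whose norm gives the common
  limit, and the class is nonempty. The case \<mu> = 0 rests on the convention that this energy is
  0; it is needed for t = 0.\<close>

lemma completion_energy_limit:
  assumes \<kappa>: "0 < \<kappa>" and \<mu>: "0 \<le> \<mu>" and \<Phi>: "\<Phi> \<in> L2_completion \<Psi> \<kappa>" and \<phi>: "\<phi> \<in> \<Phi>"
  shows "(\<lambda>n. energy \<Psi> \<mu> (\<phi> n)) \<longlonglongrightarrow> completion_energy \<Psi> \<mu> \<Phi>"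
proof -
  have "\<exists>E. \<forall>\<phi>\<in>\<Phi>. (\<lambda>n. energy \<Psi> \<mu> (\<phi> n)) \<longlonglongrightarrow> E"
  proof (cases "\<mu> = 0")
    case True
    then show ?thesis by (auto simp: energy_def intro!: exI[of _ 0])
  next
    case False
    then have \<mu>: "0 < \<mu>" using \<open>0 \<le> \<mu>\<close> by simp
    define c where "c = 1 / (2 * pi) ^ DIM('a)"
    have c: "0 < c" by (simp add: c_def)
    have bound: "L2_sq lborel (\<lambda>\<xi>. weighted_fourier \<mu> \<phi> \<xi> - weighted_fourier \<mu> \<eta> \<xi>)
        \<le> ennreal (1 / c * (1 + \<mu> / \<kappa>)) * energy \<Psi> \<kappa> (\<lambda>x. \<phi> x - \<eta> x)"
      if s: "\<phi> \<in> schwartz" "\<eta> \<in> schwartz" for \<phi> \<eta>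
    proof -
      note L = schwartz_L1_L2[OF s(1)] schwartz_L1_L2[OF s(2)]
      have "L2_sq lborel (\<lambda>\<xi>. weighted_fourier \<mu> \<phi> \<xi> - weighted_fourier \<mu> \<eta> \<xi>)
          = ennreal (1 / c) * energy \<Psi> \<mu> (\<lambda>x. \<phi> x - \<eta> x)"
      proof -
        have "ennreal (1 / c) * ennreal c = 1" using c by (subst ennreal_mult[symmetric]) auto
        then show ?thesis
          unfolding energy_eq_L2_sq[OF \<mu>] weighted_fourier_diff[OF L] c_def[symmetric]
          by (simp only: mult.assoc[symmetric] mult_1)
      qed
      also have "\<dots> \<le> ennreal (1 / c) * (ennreal (1 + \<mu> / \<kappa>) * energy \<Psi> \<kappa> (\<lambda>x. \<phi> x - \<eta> x))"
        by (intro mult_left_mono energy_le_energy \<kappa> \<mu> L1_L2_diff L) simp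
      also have "\<dots> = ennreal (1 / c * (1 + \<mu> / \<kappa>)) * energy \<Psi> \<kappa> (\<lambda>x. \<phi> x - \<eta> x)"
        using c \<kappa> \<mu> by (subst ennreal_mult) (auto simp: mult.assoc)
      finally show ?thesis .
    qed
    obtain G where G: "G \<in> L2_fun lborel" "\<And>\<phi>. \<phi> \<in> \<Phi> \<Longrightarrow> L2_tendsto lborel (\<lambda>n. weighted_fourier \<mu> (\<phi> n)) G"
      using completion_extension[of "weighted_fourier \<mu>" lborel, OF weighted_fourier_L2[OF \<mu> schwartz_L1_L2] bound \<Phi>]
      by blast
    have "(\<lambda>n. energy \<Psi> \<mu> (\<phi> n)) \<longlonglongrightarrow> ennreal c * L2_sq lborel G" if \<phi>: "\<phi> \<in> \<Phi>" for \<phi>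
    proof -
      have "\<phi> n \<in> schwartz" for n
        by (rule L2_completion_rep[OF \<Phi>]) (rule energy_Cauchy_schwartz, use \<phi> in blast)
      then show ?thesis
        unfolding energy_eq_L2_sq[OF \<mu>] c_def[symmetric]
        by (intro ennreal_tendsto_cmult L2_tendsto_sq G \<phi> weighted_fourier_L2 \<mu> schwartz_L1_L2) auto
    qed
    then show ?thesis by blast
  qed
  then obtain E where E: "\<forall>\<phi>\<in>\<Phi>. (\<lambda>n. energy \<Psi> \<mu> (\<phi> n)) \<longlonglongrightarrow> E" by blast
  then have "completion_energy \<Psi> \<mu> \<Phi> = E"
    unfolding completion_energy_def using \<phi> by (intro the_equality) (auto intro: LIMSEQ_unique)
  with E \<phi> show ?thesis by simp
qed

lemma cnj_fourier_measurable:
  "\<phi> \<in> L1_L2 lborel \<Longrightarrow> (\<lambda>\<xi>. cnj (fourier \<phi> \<xi>)) \<in> borel_measurable borel"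
  using L2_fun_measurable[OF fourier_L2] by measurable

lemma wave_kernel_energy_bounds:
  assumes \<phi>: "\<phi> \<in> L1_L2 lborel" and t: "0 \<le> t"
  defines "S \<equiv> ennreal (1 / (2 * pi) ^ DIM('a)) * L2_sq st_measure (wave_kernel t (\<lambda>\<xi>. cnj (fourier \<phi> \<xi>)))"
  shows "ennreal (t / 4) * energy \<Psi> (t\<^sup>2) \<phi> \<le> S" and "S \<le> ennreal (2 * t) * energy \<Psi> (t\<^sup>2) \<phi>"
proof -
  have "ennreal (t / 4) * energy \<Psi> (t\<^sup>2) \<phi> \<le> S \<and> S \<le> ennreal (2 * t) * energy \<Psi> (t\<^sup>2) \<phi>"
  proof (cases "t = 0")
    case True
    then show ?thesis by (simp add: S_def L2_sq_wave_kernel_0 cnj_fourier_measurable[OF \<phi>] energy_def)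
  next
    case False
    then have t: "0 < t" using t by simp
    note b = L2_sq_wave_kernel_bounds[OF cnj_fourier_measurable[OF \<phi>] t]
    show ?thesis
      unfolding S_def energy_def using t b
      by (auto simp: mult.left_commute[of "ennreal (t / 4)"] mult.left_commute[of "ennreal (2 * t)"] intro!: mult_left_mono)
  qed
  then show "ennreal (t / 4) * energy \<Psi> (t\<^sup>2) \<phi> \<le> S" "S \<le> ennreal (2 * t) * energy \<Psi> (t\<^sup>2) \<phi>" by auto
qed

text \<open>The upper bound holds in \<open>ennreal\<close> before any integrability is known, and
  test functions have finite energy; so the bound itself provides the square integrability that the
  isometry of the noise requires.\<close>

lemma wave_kernel_L2:
  assumes \<phi>: "\<phi> \<in> L1_L2 lborel" and t: "0 \<le> t"
  shows "wave_kernel t (\<lambda>\<xi>. cnj (fourier \<phi> \<xi>)) \<in> L2_fun st_measure"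
proof -
  let ?k = "wave_kernel t (\<lambda>\<xi>. cnj (fourier \<phi> \<xi>))"
  have "energy \<Psi> (t\<^sup>2) \<phi> < \<infinity>"
    using energy_finite[OF _ \<phi>, of "t\<^sup>2"] by (cases "t = 0") (auto simp: energy_def)
  then have "ennreal (2 * t) * energy \<Psi> (t\<^sup>2) \<phi> < \<infinity>" by (simp add: ennreal_mult_less_top)
  then have fin: "ennreal (1 / (2 * pi) ^ DIM('a)) * L2_sq st_measure ?k < \<infinity>"
    using wave_kernel_energy_bounds(2)[OF \<phi> t] by (rule order_le_less_trans[rotated])
  have "L2_sq st_measure ?k = ennreal ((2 * pi) ^ DIM('a)) * (ennreal (1 / (2 * pi) ^ DIM('a)) * L2_sq st_measure ?k)"
    using two_pi_cancel[of "DIM('a)" "L2_sq st_measure ?k"] by (simp only: mult.left_commute)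
  also have "\<dots> < \<infinity>" using fin by (simp only: ennreal_mult_less_top infinity_ennreal_def) simp
  finally show ?thesis
    using wave_kernel_measurable[OF cnj_fourier_measurable[OF \<phi>]] by (simp add: L2_fun_iff)
qed

section \<open>Second moments of the weak solution and of its extension\<close>

lemma weak_solution_eq:
  "weak_solution \<Psi> w t \<phi> = (\<lambda>\<omega>. complex_of_real ((2 * pi) powr (- real DIM('a) / 2)) *
    noise_hat w (wave_kernel t (\<lambda>\<xi>. cnj (fourier \<phi> \<xi>))) \<omega>)"
  by (simp add: weak_solution_def wave_kernel_def fun_eq_iff)

lemma weak_solution_L2:
  fixes w :: "(real \<times> 'a \<Rightarrow> real) \<Rightarrow> 'p \<Rightarrow> real"
  assumes w: "white_noise P w" and \<phi>: "\<phi> \<in> L1_L2 lborel" and t: "0 \<le> t"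
  shows "weak_solution \<Psi> w t \<phi> \<in> L2_fun P"
  unfolding weak_solution_eq by (intro L2_fun_cmult noise_hat_L2(1) w wave_kernel_L2 \<phi> t)

lemma weak_solution_bounds:
  fixes w :: "(real \<times> 'a \<Rightarrow> real) \<Rightarrow> 'p \<Rightarrow> real"
  assumes w: "white_noise P w" and \<phi>: "\<phi> \<in> L1_L2 lborel" and t: "0 \<le> t"
  shows "ennreal (t / 4) * energy \<Psi> (t\<^sup>2) \<phi> \<le> L2_sq P (weak_solution \<Psi> w t \<phi>)"
    and "L2_sq P (weak_solution \<Psi> w t \<phi>) \<le> ennreal (2 * t) * energy \<Psi> (t\<^sup>2) \<phi>"
proof -
  note N = noise_hat_L2[OF w wave_kernel_L2[OF \<phi> t]]
  have "L2_sq P (weak_solution \<Psi> w t \<phi>)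
      = ennreal (1 / (2 * pi) ^ DIM('a)) * L2_sq st_measure (wave_kernel t (\<lambda>\<xi>. cnj (fourier \<phi> \<xi>)))"
    unfolding weak_solution_eq L2_sq_cmult[OF L2_fun_measurable[OF N(1)]] N(2) two_pi_powr_sq ..
  then show "ennreal (t / 4) * energy \<Psi> (t\<^sup>2) \<phi> \<le> L2_sq P (weak_solution \<Psi> w t \<phi>)"
    "L2_sq P (weak_solution \<Psi> w t \<phi>) \<le> ennreal (2 * t) * energy \<Psi> (t\<^sup>2) \<phi>"
    using wave_kernel_energy_bounds[OF \<phi> t] by simp_all
qed

text \<open>The integrand is linear in the test function even though the noise is not pointwise, so
  the difference has the second moment belonging to \<phi> - \<eta>. The factor 2 t is that of the
  upper bound, and 1 + t^2/\<kappa> is the price for passing from the parameter t^2 to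
  \<kappa>.\<close>

lemma weak_solution_diff_le:
  fixes w :: "(real \<times> 'a \<Rightarrow> real) \<Rightarrow> 'p \<Rightarrow> real"
  assumes w: "white_noise P w" and \<phi>: "\<phi> \<in> L1_L2 lborel" and \<eta>: "\<eta> \<in> L1_L2 lborel"
    and t: "0 \<le> t" and \<kappa>: "0 < \<kappa>"
  shows "L2_sq P (\<lambda>\<omega>. weak_solution \<Psi> w t \<phi> \<omega> - weak_solution \<Psi> w t \<eta> \<omega>)
    \<le> ennreal (2 * t * (1 + t\<^sup>2 / \<kappa>)) * energy \<Psi> \<kappa> (\<lambda>x. \<phi> x - \<eta> x)"
proof -
  note K = wave_kernel_L2[OF \<phi> t] wave_kernel_L2[OF \<eta> t]
  note m = L2_fun_measurable[OF L2_fun_diff[OF noise_hat_L2(1)[OF w K(1)] noise_hat_L2(1)[OF w K(2)]]]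
  have d: "(\<lambda>z. wave_kernel t (\<lambda>\<xi>. cnj (fourier \<phi> \<xi>)) z - wave_kernel t (\<lambda>\<xi>. cnj (fourier \<eta> \<xi>)) z)
      = wave_kernel t (\<lambda>\<xi>. cnj (fourier (\<lambda>x. \<phi> x - \<eta> x) \<xi>))"
    unfolding wave_kernel_diff fourier_diff[OF L1_L2_D(1)[OF \<phi>] L1_L2_D(1)[OF \<eta>]] complex_cnj_diff ..
  have "L2_sq P (\<lambda>\<omega>. weak_solution \<Psi> w t \<phi> \<omega> - weak_solution \<Psi> w t \<eta> \<omega>)
      = ennreal (1 / (2 * pi) ^ DIM('a)) * L2_sq st_measure (wave_kernel t (\<lambda>\<xi>. cnj (fourier (\<lambda>x. \<phi> x - \<eta> x) \<xi>)))"
    unfolding weak_solution_eq right_diff_distrib[symmetric] L2_sq_cmult[OF m]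
      noise_hat_diff_isometry[OF w K] d two_pi_powr_sq ..
  also have "\<dots> \<le> ennreal (2 * t) * energy \<Psi> (t\<^sup>2) (\<lambda>x. \<phi> x - \<eta> x)"
    by (intro wave_kernel_energy_bounds L1_L2_diff \<phi> \<eta> t)
  also have "\<dots> \<le> ennreal (2 * t) * (ennreal (1 + t\<^sup>2 / \<kappa>) * energy \<Psi> \<kappa> (\<lambda>x. \<phi> x - \<eta> x))"
  \<comment> \<open>Comparison of energies needs the positive parameter t^2; at t = 0 the prefactor
    vanishes.\<close>
  proof (cases "t = 0")
    case False
    then show ?thesis
      by (intro mult_left_mono energy_le_energy \<kappa> L1_L2_diff \<phi> \<eta>) auto
  qed simp
  also have "\<dots> = ennreal (2 * t * (1 + t\<^sup>2 / \<kappa>)) * energy \<Psi> \<kappa> (\<lambda>x. \<phi> x - \<eta> x)"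
    using t \<kappa> by (subst ennreal_mult) (auto simp: mult.assoc)
  finally show ?thesis .
qed

lemma weak_solution_extension:
  fixes w :: "(real \<times> 'a \<Rightarrow> real) \<Rightarrow> 'p \<Rightarrow> real"
  assumes w: "white_noise P w" and \<kappa>: "0 < \<kappa>"
  shows "\<exists>W. \<forall>t\<ge>0. \<forall>\<Phi>\<in>L2_completion \<Psi> \<kappa>.
    W t \<Phi> \<in> L2_fun P \<and> (\<forall>\<phi>\<in>\<Phi>. L2_tendsto P (\<lambda>n. weak_solution \<Psi> w t (\<phi> n)) (W t \<Phi>))"
proof -
  have "\<exists>Y\<in>L2_fun P. \<forall>\<phi>\<in>\<Phi>. L2_tendsto P (\<lambda>n. weak_solution \<Psi> w t (\<phi> n)) Y"
    if "0 \<le> t" "\<Phi> \<in> L2_completion \<Psi> \<kappa>" for t \<Phi>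
    by (rule completion_extension[OF weak_solution_L2[OF w] weak_solution_diff_le[OF w] that(2)])
       (use that \<kappa> in \<open>auto intro: schwartz_L1_L2\<close>)
  then have "\<forall>t \<Phi>. \<exists>Y. 0 \<le> t \<longrightarrow> \<Phi> \<in> L2_completion \<Psi> \<kappa> \<longrightarrow>
      Y \<in> L2_fun P \<and> (\<forall>\<phi>\<in>\<Phi>. L2_tendsto P (\<lambda>n. weak_solution \<Psi> w t (\<phi> n)) Y)"
    by blast
  then show ?thesis by metis
qed

text \<open>Along a representative, second moments and energies converge to those of the extension,
  and non-strict inequalities survive the limit with the same constants.\<close>

lemma extension_bounds:
  fixes w :: "(real \<times> 'a \<Rightarrow> real) \<Rightarrow> 'p \<Rightarrow> real"
  assumes w: "white_noise P w" and \<kappa>: "0 < \<kappa>" and t: "0 \<le> t" and \<Phi>: "\<Phi> \<in> L2_completion \<Psi> \<kappa>"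
    and Y: "Y \<in> L2_fun P" and lim: "\<forall>\<phi>\<in>\<Phi>. L2_tendsto P (\<lambda>n. weak_solution \<Psi> w t (\<phi> n)) Y"
  shows "ennreal (t / 4) * completion_energy \<Psi> (t\<^sup>2) \<Phi> \<le> L2_sq P Y"
    and "L2_sq P Y \<le> ennreal (2 * t) * completion_energy \<Psi> (t\<^sup>2) \<Phi>"
proof -
  obtain x where x: "x \<in> \<Phi>" "x \<in> energy_Cauchy \<Psi> \<kappa>"
    using \<Phi> by (rule L2_completion_rep) blast
  have xL: "x n \<in> L1_L2 lborel" for n by (rule schwartz_L1_L2[OF energy_Cauchy_schwartz[OF x(2)]])
  have W: "(\<lambda>n. L2_sq P (weak_solution \<Psi> w t (x n))) \<longlonglongrightarrow> L2_sq P Y"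
    using lim x by (intro L2_tendsto_sq weak_solution_L2 w xL t Y) auto
  have E: "(\<lambda>n. ennreal c * energy \<Psi> (t\<^sup>2) (x n)) \<longlonglongrightarrow> ennreal c * completion_energy \<Psi> (t\<^sup>2) \<Phi>" for c
    by (intro ennreal_tendsto_cmult completion_energy_limit[OF \<kappa> _ \<Phi> x(1)]) auto
  show "ennreal (t / 4) * completion_energy \<Psi> (t\<^sup>2) \<Phi> \<le> L2_sq P Y"
    by (rule LIMSEQ_le[OF E W]) (use weak_solution_bounds(1)[OF w xL t] in blast)
  show "L2_sq P Y \<le> ennreal (2 * t) * completion_energy \<Psi> (t\<^sup>2) \<Phi>"
    by (rule LIMSEQ_le[OF W E]) (use weak_solution_bounds(2)[OF w xL t] in blast)
qed

end

theorem proposition3p6: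
  fixes M :: "'o measure"
    and X :: "real \<Rightarrow> 'o \<Rightarrow> 'a::euclidean_space"
    and \<Psi> :: "'a \<Rightarrow> complex"
    and P :: "'p measure"
    and w :: "(real \<times> 'a \<Rightarrow> real) \<Rightarrow> 'p \<Rightarrow> real"
  assumes "levy_process M X"
    and "symmetric_process M X"
    and "characteristic_exponent M X \<Psi>"
    and "white_noise P w"
  shows "(\<forall>t\<ge>0. \<forall>\<phi>\<in>schwartz.
            ennreal (t / 4) * energy \<Psi> (t\<^sup>2) \<phi> \<le> second_moment P (weak_solution \<Psi> w t \<phi>) \<and>
            second_moment P (weak_solution \<Psi> w t \<phi>) \<le> ennreal (2 * t) * energy \<Psi> (t\<^sup>2) \<phi>) \<and>
         (\<forall>\<kappa>>0. \<exists>W :: real \<Rightarrow> (nat \<Rightarrow> 'a \<Rightarrow> complex) set \<Rightarrow> 'p \<Rightarrow> complex. \<forall>t\<ge>0.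
            (\<forall>\<phi>\<in>schwartz. AE \<omega> in P. W t (completion_of \<Psi> \<kappa> \<phi>) \<omega> = weak_solution \<Psi> w t \<phi> \<omega>) \<and>
            (\<forall>\<Phi>\<in>L2_completion \<Psi> \<kappa>.
               W t \<Phi> \<in> L2_fun P \<and>
               (\<forall>\<phi>\<in>\<Phi>. L2_tendsto P (\<lambda>n. weak_solution \<Psi> w t (\<phi> n)) (W t \<Phi>)) \<and>
               ennreal (t / 4) * completion_energy \<Psi> (t\<^sup>2) \<Phi> \<le> second_moment P (W t \<Phi>) \<and>
               second_moment P (W t \<Phi>) \<le> ennreal (2 * t) * completion_energy \<Psi> (t\<^sup>2) \<Phi>))"
proof -
  interpret nonneg_symbol \<Psi>
    by unfold_locales (intro symmetric_exponent_real[OF assms(1-3)])+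
  note w = assms(4)
  show ?thesis
    unfolding second_moment_eq
  proof (intro conjI allI impI ballI)
    fix t :: real and \<phi> :: "'a \<Rightarrow> complex"
    assume t: "0 \<le> t" and \<phi>: "\<phi> \<in> schwartz"
    show "ennreal (t / 4) * energy \<Psi> (t\<^sup>2) \<phi> \<le> L2_sq P (weak_solution \<Psi> w t \<phi>)"
      and "L2_sq P (weak_solution \<Psi> w t \<phi>) \<le> ennreal (2 * t) * energy \<Psi> (t\<^sup>2) \<phi>"
      by (intro weak_solution_bounds w schwartz_L1_L2 \<phi> t)+
  next
    fix \<kappa> :: real assume \<kappa>: "0 < \<kappa>"
    obtain W where W: "\<And>t \<Phi>. 0 \<le> t \<Longrightarrow> \<Phi> \<in> L2_completion \<Psi> \<kappa> \<Longrightarrow> W t \<Phi> \<in> L2_fun P"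
      and lim: "\<And>t \<Phi>. 0 \<le> t \<Longrightarrow> \<Phi> \<in> L2_completion \<Psi> \<kappa> \<Longrightarrow>
        \<forall>\<phi>\<in>\<Phi>. L2_tendsto P (\<lambda>n. weak_solution \<Psi> w t (\<phi> n)) (W t \<Phi>)"
      using weak_solution_extension[OF w \<kappa>] by blast
    have "AE \<omega> in P. W t (completion_of \<Psi> \<kappa> \<phi>) \<omega> = weak_solution \<Psi> w t \<phi> \<omega>"
      if t: "0 \<le> t" and \<phi>: "\<phi> \<in> schwartz" for t \<phi>
    \<comment> \<open>A test function is represented by its constant sequence. The corresponding
      constant sequence of random variables converges both to the extension and to the weak solution
      itself.\<close>
    proof (rule L2_tendsto_unique)
      note c = completion_of_in_completion[OF \<phi>, of \<Psi> \<kappa>]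
      note m = weak_solution_L2[OF w schwartz_L1_L2[OF \<phi>] t]
      show "L2_tendsto P (\<lambda>n. weak_solution \<Psi> w t \<phi>) (W t (completion_of \<Psi> \<kappa> \<phi>))"
        by (rule bspec[OF lim[OF t c(1)] c(2)])
      show "L2_tendsto P (\<lambda>n. weak_solution \<Psi> w t \<phi>) (weak_solution \<Psi> w t \<phi>)"
        by (simp add: L2_tendsto_def)
      show "W t (completion_of \<Psi> \<kappa> \<phi>) \<in> borel_measurable P"
        by (rule L2_fun_measurable[OF W[OF t c(1)]])
    qed (rule L2_fun_measurable[OF weak_solution_L2[OF w schwartz_L1_L2[OF \<phi>] t]])+
    then show "\<exists>W :: real \<Rightarrow> (nat \<Rightarrow> 'a \<Rightarrow> complex) set \<Rightarrow> 'p \<Rightarrow> complex. \<forall>t\<ge>0.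
            (\<forall>\<phi>\<in>schwartz. AE \<omega> in P. W t (completion_of \<Psi> \<kappa> \<phi>) \<omega> = weak_solution \<Psi> w t \<phi> \<omega>) \<and>
            (\<forall>\<Phi>\<in>L2_completion \<Psi> \<kappa>.
               W t \<Phi> \<in> L2_fun P \<and>
               (\<forall>\<phi>\<in>\<Phi>. L2_tendsto P (\<lambda>n. weak_solution \<Psi> w t (\<phi> n)) (W t \<Phi>)) \<and>
               ennreal (t / 4) * completion_energy \<Psi> (t\<^sup>2) \<Phi> \<le> L2_sq P (W t \<Phi>) \<and>
               L2_sq P (W t \<Phi>) \<le> ennreal (2 * t) * completion_energy \<Psi> (t\<^sup>2) \<Phi>)"
      using W lim extension_bounds[OF w \<kappa> _ _ W lim]
      by (intro exI[of _ W] allI impI conjI ballI) auto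
  qed
qed

end
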